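(* Let $\mathbb{Z}_2\subset A_5$ be a subgroup of order 2, acting on Bring's curve $\mathcal{B}$ by even permutations of coordinates. The quotient curve $\mathcal{B}/_{\mathbb{Z}_2}$ is biholomorphic to the algebraic curve defined by the affine equation $$y^2 = (4x^3+8x^2+7x+1)(x^3+7x^2+8x+4).$$
   Context: Bring's curve $\mathcal{B}\subset\mathbb{CP}^4$ is the genus-4 curve defined by $\sum_{i=1}^5 x_i=\sum_{i=1}^5 x_i^2=\sum_{i=1}^5 x_i^3=0$. The group $A_5$ acts on $\mathcal{B}$ by even permutations of the five homogeneous coordinates (it is the automorphism group of the dessin d'enfant $I_4$, the icosahedron of genus 4, embedded in $\mathcal{B}$); e.g. one may take $\mathbb{Z}_2=\langle(24)(35)\rangle$. For a subgroup $G\subset A_5$, $\mathcal{B}/_G$ denotes the quotient compact Riemann surface. The curve given by an affine equation $y^2=P(x)$ means the compact Riemann surface (smooth projective model) of that affine curve over $\mathbb{C}$. *)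

theory Defs
  imports "HOL-Analysis.Analysis" "HOL-Combinatorics.Permutations" "HOL-Algebra.Group_Action"
begin

section \<open>Riemann surfaces\<close>

record 'a surface =
  space_of :: "'a topology"
  atlas :: "('a set \<times> ('a \<Rightarrow> complex)) set"

text \<open>In a chart \<open>(U, \<phi>)\<close> only the restriction of \<open>\<phi>\<close> to \<open>U\<close> is relevant; its inverse
  is \<open>the_inv_into U \<phi>\<close>.\<close>

definition complex_chart :: "'a topology \<Rightarrow> 'a set \<Rightarrow> ('a \<Rightarrow> complex) \<Rightarrow> bool" where
  "complex_chart X U \<phi> \<longleftrightarrow> openin X U \<and> open (\<phi> ` U) \<and>
     homeomorphic_map (subtopology X U) (top_of_set (\<phi> ` U)) \<phi>"

definition riemann_surface :: "'a surface \<Rightarrow> bool" where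
  "riemann_surface S \<longleftrightarrow>
     Hausdorff_space (space_of S) \<and> connected_space (space_of S) \<and>
     (\<forall>(U, \<phi>) \<in> atlas S. complex_chart (space_of S) U \<phi>) \<and>
     (\<Union>(U, \<phi>) \<in> atlas S. U) = topspace (space_of S) \<and>
     (\<forall>(U, \<phi>) \<in> atlas S. \<forall>(V, \<psi>) \<in> atlas S.
        (\<psi> \<circ> the_inv_into U \<phi>) holomorphic_on \<phi> ` (U \<inter> V))"

definition holomorphic_map :: "'a surface \<Rightarrow> 'b surface \<Rightarrow> ('a \<Rightarrow> 'b) \<Rightarrow> bool" where
  "holomorphic_map S T f \<longleftrightarrow> continuous_map (space_of S) (space_of T) f \<and>
     (\<forall>(U, \<phi>) \<in> atlas S. \<forall>(V, \<psi>) \<in> atlas T.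
        (\<psi> \<circ> f \<circ> the_inv_into U \<phi>) holomorphic_on \<phi> ` (U \<inter> f -` V))"

definition biholomorphic :: "'a surface \<Rightarrow> 'b surface \<Rightarrow> bool" where
  "biholomorphic S T \<longleftrightarrow> riemann_surface S \<and> riemann_surface T \<and>
     (\<exists>f g. holomorphic_map S T f \<and> holomorphic_map T S g \<and>
        (\<forall>x \<in> topspace (space_of S). g (f x) = x) \<and>
        (\<forall>y \<in> topspace (space_of T). f (g y) = y))"


section \<open>Quotients\<close>

definition quotient_topology :: "'a topology \<Rightarrow> ('a \<Rightarrow> 'b) \<Rightarrow> 'b topology" where
  "quotient_topology X q =
     topology (\<lambda>W. W \<subseteq> q ` topspace X \<and> openin X {x \<in> topspace X. q x \<in> W})"

lemma openin_quotient_topology: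
  "openin (quotient_topology X q) W \<longleftrightarrow>
     W \<subseteq> q ` topspace X \<and> openin X {x \<in> topspace X. q x \<in> W}"
proof -
  let ?L = "\<lambda>W. W \<subseteq> q ` topspace X \<and> openin X {x \<in> topspace X. q x \<in> W}"
  have "istopology ?L"
    unfolding istopology_def
  proof (intro conjI allI impI)
    fix V W assume "?L V" "?L W"
    moreover have "{x \<in> topspace X. q x \<in> V \<inter> W} =
        {x \<in> topspace X. q x \<in> V} \<inter> {x \<in> topspace X. q x \<in> W}" by auto
    ultimately show "V \<inter> W \<subseteq> q ` topspace X"
      and "openin X {x \<in> topspace X. q x \<in> V \<inter> W}" by auto
  next
    fix \<W> assume *: "\<forall>W\<in>\<W>. ?L W"
    then show "\<Union>\<W> \<subseteq> q ` topspace X" by blast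
    have "{x \<in> topspace X. q x \<in> \<Union>\<W>} = (\<Union>W\<in>\<W>. {x \<in> topspace X. q x \<in> W})" by auto
    with * show "openin X {x \<in> topspace X. q x \<in> \<Union>\<W>}" by auto
  qed
  then show ?thesis by (simp add: quotient_topology_def)
qed

lemma topspace_quotient_topology [simp]:
  "topspace (quotient_topology X q) = q ` topspace X"
proof
  show "topspace (quotient_topology X q) \<subseteq> q ` topspace X"
    using openin_quotient_topology[of X q] openin_topspace by blast
  have "{x \<in> topspace X. q x \<in> q ` topspace X} = topspace X" by auto
  then have "openin (quotient_topology X q) (q ` topspace X)"
    by (simp add: openin_quotient_topology)
  then show "q ` topspace X \<subseteq> topspace (quotient_topology X q)"
    by (rule openin_subset)
qed

lemma quotient_map_quotient_topology: "quotient_map X (quotient_topology X q) q"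
  unfolding quotient_map_def by (auto simp: openin_quotient_topology)

text \<open>The complex structure of a quotient surface is the one making the projection \<open>q\<close>
  holomorphic: its charts are all topological charts \<open>\<phi>\<close> for which \<open>\<phi> \<circ> q\<close> is holomorphic.
  (If such charts cover the quotient, then they are automatically holomorphically compatible, provided
  \<open>q\<close> is nowhere locally constant.)\<close>

definition quotient_surface :: "'a surface \<Rightarrow> ('a \<Rightarrow> 'b) \<Rightarrow> 'b surface" where
  "quotient_surface S q =
     \<lparr>space_of = quotient_topology (space_of S) q,
      atlas = {(U, \<phi>). complex_chart (quotient_topology (space_of S) q) U \<phi> \<and>
        (\<forall>(V, \<psi>) \<in> atlas S.
           (\<phi> \<circ> q \<circ> the_inv_into V \<psi>) holomorphic_on \<psi> ` (V \<inter> q -` U))}\<rparr>"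


section \<open>Projective space and projective curves\<close>

text \<open>A point of projective space is a line through the origin, as a set of vectors.\<close>

definition proj_point :: "complex ^ 'n \<Rightarrow> (complex ^ 'n) set" where
  "proj_point x = {c *s x | c. True}"

definition proj_topology :: "(complex ^ 'n) set topology" where
  "proj_topology = quotient_topology (top_of_set (- {0})) proj_point"

definition affine_patch :: "'n \<Rightarrow> (complex ^ 'n) set set" where
  "affine_patch i = {proj_point x | x. x $ i \<noteq> 0}"

text \<open>The affine coordinates on \<open>affine_patch i\<close> are the ratios \<open>x $ j / x $ i\<close>.\<close>

definition affine_coord :: "'n \<Rightarrow> (complex ^ 'n) set \<Rightarrow> complex ^ 'n" where
  "affine_coord i p = (THE x. x \<in> p \<and> x $ i = 1)"

text \<open>A projective curve, as a one-dimensional complex submanifold of projective space: its charts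
  are the inverses of the local parametrizations that are homeomorphisms onto relatively open
  pieces of the curve and, in every affine patch, holomorphic with nonvanishing derivative.
  No such chart exists around a singular point, so the result can be a
  Riemann surface only if the curve is smooth.\<close>

definition projective_curve :: "(complex ^ 'n) set set \<Rightarrow> (complex ^ 'n) set surface" where
  "projective_curve C =
     \<lparr>space_of = subtopology proj_topology C,
      atlas = {(U, \<phi>). complex_chart (subtopology proj_topology C) U \<phi> \<and>
        (\<forall>i. (\<forall>j. (\<lambda>t. affine_coord i (the_inv_into U \<phi> t) $ j)
                    holomorphic_on \<phi> ` (U \<inter> affine_patch i)) \<and>
             (\<forall>p \<in> U \<inter> affine_patch i. \<exists>j.
                deriv (\<lambda>t. affine_coord i (the_inv_into U \<phi> t) $ j) (\<phi> p) \<noteq> 0))}\<rparr>"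


section \<open>Bring's curve and its quotients\<close>

definition bring_curve :: "(complex ^ 5) set surface" where
  "bring_curve = projective_curve
     {proj_point x | x. x \<noteq> 0 \<and> (\<Sum>i\<in>UNIV. x $ i) = 0 \<and>
        (\<Sum>i\<in>UNIV. (x $ i)\<^sup>2) = 0 \<and> (\<Sum>i\<in>UNIV. (x $ i) ^ 3) = 0}"

text \<open>The alternating group on a finite type; \<open>A\<^sub>5\<close> is its instance at the index type \<open>5\<close>.\<close>

definition alternating_group :: "('n::finite \<Rightarrow> 'n) monoid" where
  "alternating_group = \<lparr>carrier = {\<sigma>. \<sigma> permutes UNIV \<and> evenperm \<sigma>}, mult = (\<circ>), one = id\<rparr>"

definition permute_coords :: "('n \<Rightarrow> 'n) \<Rightarrow> (complex ^ 'n) set \<Rightarrow> (complex ^ 'n) set" where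
  "permute_coords \<sigma> p = (\<lambda>x. \<chi> i. x $ Hilbert_Choice.inv \<sigma> i) ` p"

definition bring_quotient :: "(5 \<Rightarrow> 5) set \<Rightarrow> (complex ^ 5) set set surface" where
  "bring_quotient G = quotient_surface bring_curve
     (orbit (alternating_group\<lparr>carrier := G\<rparr>) permute_coords)"


section \<open>The smooth projective model of a genus 2 curve\<close>

text \<open>The closed embedding \<open>(x, y) \<mapsto> [1 : x : x\<^sup>2 : x\<^sup>3 : y]\<close> of the affine plane into an affine
  patch of projective 4-space, followed by projective closure. For an affine curve \<open>y\<^sup>2 = P(x)\<close>
  with \<open>P\<close> squarefree of degree 6, the closure is
  \<open>{[s\<^sup>3 : s\<^sup>2t : st\<^sup>2 : t\<^sup>3 : w] | w\<^sup>2 = s\<^sup>6 P(t/s)}\<close>; it adds the two points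
  \<open>[0 : 0 : 0 : 1 : w]\<close> with \<open>w\<^sup>2\<close> the leading coefficient of \<open>P\<close>. It is smooth there, in contrast to
  the closure in the projective plane, and is hence the smooth projective model of the affine
  curve.\<close>

definition genus2_model :: "(complex \<times> complex) set \<Rightarrow> (complex ^ 5) set surface" where
  "genus2_model C = projective_curve
     (proj_topology closure_of {proj_point (vector [1, x, x\<^sup>2, x ^ 3, y]) | x y. (x, y) \<in> C})"

end

theory Submission
  imports Defs "HOL-Complex_Analysis.Complex_Analysis"
begin

text \<open>For the involution exchanging \<open>x\<^sub>i, x\<^sub>j\<close> and \<open>x\<^sub>k, x\<^sub>l\<close>, put \<open>a = x\<^sub>i + x\<^sub>j\<close>, \<open>b = x\<^sub>k + x\<^sub>l\<close>.
  On Bring's curve \<open>a\<close> and \<open>b\<close> determine the other coordinate and, unless \<open>a = b = 0\<close>, the products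
  \<open>x\<^sub>i x\<^sub>j\<close> and \<open>x\<^sub>k x\<^sub>l\<close>. The discriminants satisfy
  \<open>(x\<^sub>i - x\<^sub>j)\<^sup>2 (a - b) = a\<^sup>3 + 7 a\<^sup>2 b + 8 a b\<^sup>2 + 4 b\<^sup>3\<close> and
  \<open>(x\<^sub>k - x\<^sub>l)\<^sup>2 (a - b) = - (4 a\<^sup>3 + 8 a\<^sup>2 b + 7 a b\<^sup>2 + b\<^sup>3)\<close>, so that \<open>x = a / b\<close> and
  \<open>y = \<i> (x\<^sub>i - x\<^sub>j) (x\<^sub>k - x\<^sub>l) (a - b) / b\<^sup>3\<close> satisfy the equation of the genus 2 curve, and the fibres of
  \<open>(x, y)\<close> are the orbits. Since Bring's curve is compact, the induced bijection from the quotient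
  is a homeomorphism. Charts of the quotient are compatible wherever Bring's curve has the local parameter
  \<open>a / b\<close>, and the finitely many remaining points are removable singularities.\<close>

text \<open>The factor \<open>a - b\<close> has one source: once \<open>x_e\<close> and the product
  \<open>x_k x_l\<close> are eliminated, the cubic equation of the curve is linear in
  \<open>x_i x_j\<close> with coefficient \<open>a - b\<close>, and clearing this denominator leaves
  cubic forms in \<open>a\<close> and \<open>b\<close>. Exchanging the two pairs swaps these forms
  up to sign, which makes the sextic palindromic; the sign is compensated by the factor
  \<open>\<i>\<close> in \<open>y\<close>. Two obstacles shape the proof. At the fixed points of the
  involution \<open>a = b = 0\<close>, so the formulas for \<open>x\<close> and \<open>y\<close> are
  indeterminate and a second homogeneous expression of the same map is required. Moreover, the atlas
  of the quotient consists of all charts whose composition with the projection is holomorphic, so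
  compatibility concerns arbitrary charts, including those around images of fixed points. The
  quotient receives its charts, its connectedness and its Hausdorff property from the genus 2 curve
  along the homeomorphism, while explicit charts of Bring's curve serve only to compare two given
  quotient charts.\<close>

no_notation fps_nth (infixl \<open>$\<close> 75)

section \<open>Projective space\<close>

lemma proj_point_eq_iff: "proj_point x = proj_point y \<longleftrightarrow> (\<exists>c. c \<noteq> 0 \<and> y = c *s x)"
proof
  assume eq: "proj_point x = proj_point y"
  have "y \<in> proj_point y" "x \<in> proj_point x"
    unfolding proj_point_def using vector_smult_lid[symmetric] by blast+
  then obtain c d where c: "y = c *s x" and d: "x = d *s y"
    using eq unfolding proj_point_def by blast
  show "\<exists>c. c \<noteq> 0 \<and> y = c *s x"
  proof (cases "c = 0")
    case True
    then have "y = 0" "x = 0" using c d by auto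
    then have "y = 1 *s x" by simp
    then show ?thesis using zero_neq_one by metis
  qed (use c in auto)
next
  assume "\<exists>c. c \<noteq> 0 \<and> y = c *s x"
  then obtain c where c: "c \<noteq> 0" "y = c *s x" by auto
  have "d *s x = (d / c) *s y" for d using c by simp
  moreover have "d *s y = (d * c) *s x" for d using c by simp
  ultimately show "proj_point x = proj_point y" unfolding proj_point_def by blast
qed

lemma mem_proj_point_self: "x \<in> proj_point x"
  unfolding proj_point_def using vector_smult_lid[symmetric] by blast

lemma topspace_proj_topology: "topspace proj_topology = proj_point ` (- {0})"
  by (simp add: proj_topology_def)

lemma quotient_map_proj_point: "quotient_map (top_of_set (- {0})) proj_topology proj_point"
  unfolding proj_topology_def by (rule quotient_map_quotient_topology)

text \<open>Punctured cones are the saturated sets of the projection onto projective space, so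
  subsets of projective space can be handled through equations on vectors.\<close>

definition punctured_cone :: "(complex ^ 'n) set \<Rightarrow> bool" where
  "punctured_cone S \<longleftrightarrow> 0 \<notin> S \<and> (\<forall>x\<in>S. \<forall>c. c \<noteq> 0 \<longrightarrow> c *s x \<in> S)"

lemma proj_point_mem_image_cone:
  assumes "punctured_cone S"
  shows "proj_point x \<in> proj_point ` S \<longleftrightarrow> x \<in> S"
proof
  assume "proj_point x \<in> proj_point ` S"
  then obtain y where "y \<in> S" "proj_point y = proj_point x" by force
  then show "x \<in> S" using assms by (auto simp: proj_point_eq_iff punctured_cone_def)
qed auto

lemma vimage_proj_point_cone:
  assumes "punctured_cone S"
  shows "{x \<in> - {0}. proj_point x \<in> proj_point ` S} = S"
  using assms proj_point_mem_image_cone[OF assms] by (auto simp: punctured_cone_def)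

lemma openin_proj_point_cone:
  assumes "punctured_cone S" "open S"
  shows "openin proj_topology (proj_point ` S)"
proof -
  have "S \<subseteq> - {0}" using assms by (auto simp: punctured_cone_def)
  then have "openin (top_of_set (- {0})) S" using assms(2) by (metis open_openin_trans open_Compl closed_singleton)
  then show ?thesis using \<open>S \<subseteq> - {0}\<close>
    unfolding proj_topology_def openin_quotient_topology
    by (simp add: vimage_proj_point_cone[OF assms(1), simplified] image_mono)
qed

lemma closedin_proj_point_cone:
  assumes "punctured_cone S" "closedin (top_of_set (- {0})) S"
  shows "closedin proj_topology (proj_point ` S)"
proof -
  have *: "S \<subseteq> - {0}" using assms by (auto simp: punctured_cone_def)
  have "proj_point ` S \<subseteq> topspace proj_topology"
    using * by (auto simp: topspace_proj_topology)
  moreover have "{x \<in> topspace (top_of_set (- {0})). proj_point x \<in> proj_point ` S} = S"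
    using vimage_proj_point_cone[OF assms(1)] by simp
  ultimately show ?thesis
    using quotient_map_proj_point[unfolded quotient_map_closedin, THEN conjunct2, rule_format,
        of "proj_point ` S"] assms(2) by simp
qed

text \<open>A quotient map stays one when restricted to an open or closed saturated set. Hence
  continuity of a map out of a projective curve can be checked on the cone over it.\<close>

lemma quotient_map_proj_point_cone:
  assumes "punctured_cone S" "open S \<or> closedin (top_of_set (- {0})) S"
  shows "quotient_map (top_of_set S) (subtopology proj_topology (proj_point ` S)) proj_point"
proof -
  have *: "S \<subseteq> - {0}" using assms by (auto simp: punctured_cone_def)
  have "quotient_map (subtopology (top_of_set (- {0})) S)
      (subtopology proj_topology (proj_point ` S)) proj_point"
    by (rule quotient_map_restriction[OF quotient_map_proj_point])
      (use assms vimage_proj_point_cone[OF assms(1)] openin_proj_point_cone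
         closedin_proj_point_cone in auto)
  then show ?thesis using * by (simp add: subtopology_subtopology inf_absorb2)
qed

lemma continuous_map_proj_point: "continuous_map (top_of_set (- {0})) proj_topology proj_point"
  using quotient_map_proj_point by (rule quotient_imp_continuous_map)

lemma continuous_map_proj_point_comp:
  assumes "continuous_map X euclidean g" "\<And>x. x \<in> topspace X \<Longrightarrow> g x \<noteq> 0"
  shows "continuous_map X proj_topology (\<lambda>x. proj_point (g x))"
proof -
  have "continuous_map X (top_of_set (- {0})) g"
    using assms by (auto simp: continuous_map_in_subtopology)
  from continuous_map_compose[OF this continuous_map_proj_point] show ?thesis by (simp add: o_def)
qed

text \<open>Evaluation at an arbitrarily chosen nonzero representative; it agrees with
  \<open>f\<close> on every representative when \<open>f\<close> is invariant under scaling.\<close>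

definition on_rep :: "(complex ^ 'n \<Rightarrow> 'b) \<Rightarrow> (complex ^ 'n) set \<Rightarrow> 'b" where
  "on_rep f p = f (SOME x. x \<noteq> 0 \<and> x \<in> p)"

lemma on_rep_proj_point:
  assumes "\<And>c. c \<noteq> 0 \<Longrightarrow> f (c *s x) = f x" "x \<noteq> 0"
  shows "on_rep f (proj_point x) = f x"
proof -
  let ?y = "SOME y. y \<noteq> 0 \<and> y \<in> proj_point x"
  have "?y \<noteq> 0 \<and> ?y \<in> proj_point x"
    by (rule someI[of _ x]) (use assms mem_proj_point_self in auto)
  then obtain c where "?y = c *s x" "c \<noteq> 0" unfolding proj_point_def by auto
  then show ?thesis using assms unfolding on_rep_def by metis
qed

lemma continuous_map_on_rep:
  fixes f :: "complex ^ 'n \<Rightarrow> 'b::topological_space"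
  assumes "punctured_cone S" "open S \<or> closedin (top_of_set (- {0})) S"
    and "continuous_on S f" "\<And>x c. x \<in> S \<Longrightarrow> c \<noteq> 0 \<Longrightarrow> f (c *s x) = f x"
  shows "continuous_map (subtopology proj_topology (proj_point ` S)) euclidean (on_rep f)"
proof (rule continuous_compose_quotient_map[OF quotient_map_proj_point_cone[OF assms(1,2)]])
  have "on_rep f (proj_point x) = f x" if "x \<in> S" for x
    using on_rep_proj_point[of f x] assms that by (auto simp: punctured_cone_def)
  then have "continuous_on S (on_rep f \<circ> proj_point)"
    using assms(3) by (subst continuous_on_cong[OF refl, of _ _ f]) auto
  then show "continuous_map (top_of_set S) euclidean (on_rep f \<circ> proj_point)" by simp
qed

section \<open>Affine patches and the Hausdorff property of projective space\<close>

lemma punctured_cone_nonzero: "punctured_cone (- {0})"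
  by (auto simp: punctured_cone_def)

lemma punctured_cone_affine: "punctured_cone {x. x $ i \<noteq> 0}"
  by (auto simp: punctured_cone_def)

lemma affine_patch_eq: "affine_patch i = proj_point ` {x. x $ i \<noteq> 0}"
  by (auto simp: affine_patch_def)

lemma proj_point_mem_affine_patch: "proj_point x \<in> affine_patch i \<longleftrightarrow> x $ i \<noteq> 0"
  unfolding affine_patch_eq by (simp add: proj_point_mem_image_cone[OF punctured_cone_affine])

lemma openin_affine_patch: "openin proj_topology (affine_patch i)"
  unfolding affine_patch_eq
  by (intro openin_proj_point_cone punctured_cone_affine open_Collect_neq continuous_intros)

lemma affine_coord_proj_point:
  assumes "x $ i \<noteq> 0"
  shows "affine_coord i (proj_point x) = (1 / x $ i) *s x"
  unfolding affine_coord_def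
  by (rule the_equality) (use assms in \<open>auto simp: proj_point_def nonzero_eq_divide_eq\<close>)

lemma affine_coord_nth:
  assumes "x $ i \<noteq> 0"
  shows "affine_coord i (proj_point x) $ j = x $ j / x $ i"
  using assms by (simp add: affine_coord_proj_point)

lemma proj_point_affine_coord:
  assumes "p \<in> affine_patch i"
  shows "proj_point (affine_coord i p) = p" "affine_coord i p $ i = 1"
proof -
  obtain x where x: "p = proj_point x" "x $ i \<noteq> 0" using assms by (auto simp: affine_patch_def)
  then show "affine_coord i p $ i = 1" by (simp add: affine_coord_nth)
  show "proj_point (affine_coord i p) = p"
    using x by (auto simp: affine_coord_proj_point proj_point_eq_iff intro!: exI[of _ "x $ i"])
qed

lemma proj_point_cases:
  assumes "p \<in> topspace proj_topology"
  obtains i x where "p = proj_point x" "x $ i \<noteq> 0" "p \<in> affine_patch i"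
proof -
  obtain x where "p = proj_point x" "x \<noteq> 0"
    using assms by (auto simp: topspace_proj_topology)
  moreover then obtain i where "x $ i \<noteq> 0" by (auto simp: vec_eq_iff)
  ultimately show ?thesis using that by (auto simp: proj_point_mem_affine_patch)
qed

lemma Hausdorff_proj_topology: "Hausdorff_space (proj_topology :: (complex ^ 'n) set topology)"
  unfolding Hausdorff_space_def
proof (intro allI impI)
  fix p q :: "(complex ^ 'n) set"
  assume pq: "p \<in> topspace proj_topology \<and> q \<in> topspace proj_topology \<and> p \<noteq> q"
  then obtain x y where x: "p = proj_point x" "x \<noteq> 0" and y: "q = proj_point y" "y \<noteq> 0"
    by (auto simp: topspace_proj_topology)
  \<comment> \<open>The numerator collects the 2 by 2 minors of \<open>z\<close> and
    \<open>x\<close>, so \<open>f\<close> vanishes exactly on the line through \<open>x\<close>.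
    Dividing by the 1-norm makes \<open>f\<close> scaling invariant, hence a continuous function
    that separates \<open>p\<close> from every other point.\<close>
  define f where "f z = (\<Sum>i\<in>UNIV. \<Sum>j\<in>UNIV. norm (z $ i * x $ j - z $ j * x $ i)) / (\<Sum>i\<in>UNIV. norm (z $ i))"
    for z :: "complex ^ 'n"
  have pos: "(\<Sum>i\<in>UNIV. norm (z $ i)) \<noteq> 0" if "z \<noteq> 0" for z :: "complex ^ 'n"
    using that by (simp add: sum_nonneg_eq_0_iff vec_eq_iff)
  have "f (c *s z) = f z" if "z \<noteq> 0" "c \<noteq> 0" for c z
  proof -
    have "(\<Sum>i\<in>UNIV. \<Sum>j\<in>UNIV. norm ((c *s z) $ i * x $ j - (c *s z) $ j * x $ i))
      = norm c * (\<Sum>i\<in>UNIV. \<Sum>j\<in>UNIV. norm (z $ i * x $ j - z $ j * x $ i))"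
      by (simp add: sum_distrib_left norm_mult [symmetric] algebra_simps)
    moreover have "(\<Sum>i\<in>UNIV. norm ((c *s z) $ i)) = norm c * (\<Sum>i\<in>UNIV. norm (z $ i))"
      by (simp add: sum_distrib_left norm_mult)
    ultimately show ?thesis using that by (simp add: f_def)
  qed
  note hom = this
  have cont: "continuous_on (- {0}) f"
    unfolding f_def by (intro continuous_intros) (use pos in auto)
  have "continuous_map (subtopology proj_topology (proj_point ` (- {0}))) euclidean (on_rep f)"
    by (rule continuous_map_on_rep[OF punctured_cone_nonzero _ cont]) (use hom in auto)
  then have F: "continuous_map proj_topology euclidean (on_rep f)"
    by (metis subtopology_topspace topspace_proj_topology)
  have "f x = 0" by (simp add: f_def mult.commute)
  then have "on_rep f p = 0" using x hom by (simp add: on_rep_proj_point)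
  moreover have "on_rep f q \<noteq> 0"
  proof
    assume "on_rep f q = 0"
    then have "f y = 0" using y hom by (simp add: on_rep_proj_point)
    then have z: "y $ i * x $ j = y $ j * x $ i" for i j
      using pos[OF y(2)] by (simp add: f_def sum_nonneg_eq_0_iff sum_nonneg)
    obtain k where k: "x $ k \<noteq> 0" using x(2) by (auto simp: vec_eq_iff)
    have eq: "y = (y $ k / x $ k) *s x"
      using k z by (auto simp: vec_eq_iff field_simps)
    moreover from eq have "y $ k / x $ k \<noteq> 0" using y(2) by (metis vector_smult_lzero)
    ultimately have "p = q" unfolding x y proj_point_eq_iff by blast
    then show False using pq by simp
  qed
  ultimately obtain U V where UV: "open U" "open V" "on_rep f p \<in> U" "on_rep f q \<in> V" "U \<inter> V = {}"
    by (metis hausdorff)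
  let ?P = "\<lambda>U. {p \<in> topspace proj_topology. on_rep f p \<in> U}"
  have "openin proj_topology (?P U)" "openin proj_topology (?P V)"
    using F UV by (auto intro: openin_continuous_map_preimage)
  then show "\<exists>U V. openin proj_topology U \<and> openin proj_topology V \<and> p \<in> U \<and> q \<in> V \<and> disjnt U V"
    using UV pq by (intro exI[of _ "?P U"] exI[of _ "?P V"]) (auto simp: disjnt_def)
qed

section \<open>Charts\<close>

lemma complex_chartD:
  assumes "complex_chart X U \<phi>"
  shows "openin X U" "inj_on \<phi> U" "open (\<phi> ` U)"
    and "continuous_map (subtopology X U) euclidean \<phi>"
    and "\<And>W. openin X W \<Longrightarrow> open (\<phi> ` (U \<inter> W))"
    and "continuous_map (top_of_set (\<phi> ` U)) (subtopology X U) (the_inv_into U \<phi>)"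
proof -
  show U: "openin X U" and oU: "open (\<phi> ` U)" using assms by (auto simp: complex_chart_def)
  then have tU: "topspace (subtopology X U) = U" using openin_subset by (auto simp: topspace_subtopology)
  have h: "homeomorphic_map (subtopology X U) (top_of_set (\<phi> ` U)) \<phi>"
    using assms by (auto simp: complex_chart_def)
  show inj: "inj_on \<phi> U" using homeomorphic_imp_injective_map[OF h] tU by simp
  show "continuous_map (subtopology X U) euclidean \<phi>"
    using homeomorphic_imp_continuous_map[OF h] by (simp add: continuous_map_in_subtopology)
  show op: "open (\<phi> ` (U \<inter> W))" if "openin X W" for W
  proof -
    have "openin (subtopology X U) (U \<inter> W)" using that by (auto simp: openin_subtopology)
    then have "openin (top_of_set (\<phi> ` U)) (\<phi> ` (U \<inter> W))"
      using homeomorphic_imp_open_map[OF h] by (auto simp: open_map_def)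
    then show ?thesis using oU openin_open_trans by blast
  qed
  show "continuous_map (top_of_set (\<phi> ` U)) (subtopology X U) (the_inv_into U \<phi>)"
    unfolding continuous_map_def
  proof (intro conjI allI impI)
    show "the_inv_into U \<phi> \<in> topspace (top_of_set (\<phi> ` U)) \<rightarrow> topspace (subtopology X U)"
      unfolding tU using the_inv_into_into[OF inj _ subset_refl] by simp
    fix W assume "openin (subtopology X U) W"
    then obtain T where "openin X T" "W = U \<inter> T" by (auto simp: openin_subtopology)
    moreover have "{x \<in> topspace (top_of_set (\<phi> ` U)). the_inv_into U \<phi> x \<in> U \<inter> T} = \<phi> ` (U \<inter> T)"
      using inj by (auto simp: the_inv_into_f_f)
    ultimately show "openin (top_of_set (\<phi> ` U)) {x \<in> topspace (top_of_set (\<phi> ` U)). the_inv_into U \<phi> x \<in> W}"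
      using op[of T] by (auto intro!: openin_open_eq[THEN iffD2] simp: oU)
  qed
qed

text \<open>By Caratheodory's factorisation \<open>g (f t) - g (f z) = G (f t) * (f t - f z)\<close>
  with \<open>G (f z) = D\<close>, and continuity of \<open>f\<close> allows division by
  \<open>G (f t)\<close> near \<open>z\<close>. In the application \<open>f\<close> is a chart along
  a curve and \<open>g\<close> an affine coordinate of the inverse chart.\<close>

lemma has_field_derivative_lift:
  fixes f g :: "complex \<Rightarrow> complex"
  assumes f: "isCont f z" and g: "(g has_field_derivative D) (at (f z))" and D: "D \<noteq> 0"
    and gf: "((\<lambda>t. g (f t)) has_field_derivative E) (at z)"
  shows "(f has_field_derivative E / D) (at z)"
proof -
  obtain G where G: "\<And>w. g w - g (f z) = G w * (w - f z)" "isCont G (f z)" "G (f z) = D"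
    using g unfolding CARAT_DERIV by metis
  obtain H where H: "\<And>t. g (f t) - g (f z) = H t * (t - z)" "isCont H z" "H z = E"
    using gf unfolding CARAT_DERIV by metis
  have cGf: "isCont (\<lambda>t. G (f t)) z" using isCont_o2[OF f G(2)] .
  have ev: "eventually (\<lambda>t. G (f t) \<noteq> 0) (at z)"
    using cGf G(3) D by (intro tendsto_imp_eventually_ne) (auto simp: isCont_def)
  have "((\<lambda>t. H t / G (f t)) \<longlongrightarrow> E / D) (at z)"
    using H(2,3) cGf G(3) D by (auto simp: isCont_def intro!: tendsto_divide)
  moreover have "eventually (\<lambda>t. H t / G (f t) = (f t - f z) / (t - z)) (at z)"
    using ev eventually_neq_at_within[of z z UNIV]
  proof (eventually_elim)
    case (elim t)
    then show ?case using G(1)[of "f t"] H(1)[of t]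
      by (cases "t = z") (auto simp: field_simps)
  qed
  ultimately show ?thesis
    unfolding has_field_derivative_iff using tendsto_cong[THEN iffD1] by fast
qed

section \<open>Homogeneous lifts and holomorphic maps between projective curves\<close>

lemma space_of_projective_curve: "space_of (projective_curve C) = subtopology proj_topology C"
  by (simp add: projective_curve_def)

text \<open>Holomorphy of a map into projective space is expressed by nowhere vanishing homogeneous
  coordinates, so that no affine patch has to be fixed in advance.\<close>

definition holomorphic_lift_on :: "(complex \<Rightarrow> (complex ^ 'n) set) \<Rightarrow> complex set \<Rightarrow> bool" where
  "holomorphic_lift_on h N \<longleftrightarrow> open N \<and>
     (\<exists>G. (\<forall>j. (\<lambda>t. G t $ j) holomorphic_on N) \<and> (\<forall>t\<in>N. G t \<noteq> 0 \<and> h t = proj_point (G t)))"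

text \<open>The atlas only makes the inverse of \<open>\<psi>\<close> holomorphic. Near a given
  point some affine coordinate of that inverse has nonzero derivative, and the same coordinate of
  \<open>h\<close> is a quotient of two components of the lift, hence holomorphic;
  \<open>has_field_derivative_lift\<close> transfers differentiability to
  \<open>\<psi> \<circ> h\<close>.\<close>

lemma chart_comp_holomorphic:
  fixes C :: "(complex ^ 'n) set set"
  assumes chart: "(V, \<psi>) \<in> atlas (projective_curve C)" and "open M"
    and h: "continuous_map (top_of_set M) (subtopology proj_topology C) h" and hV: "h ` M \<subseteq> V"
    and lift: "\<And>z. z \<in> M \<Longrightarrow> \<exists>N. z \<in> N \<and> N \<subseteq> M \<and> holomorphic_lift_on h N"
  shows "(\<lambda>t. \<psi> (h t)) holomorphic_on M"
proof -
  have V: "complex_chart (subtopology proj_topology C) V \<psi>"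
    and hol: "\<And>i j. (\<lambda>t. affine_coord i (the_inv_into V \<psi> t) $ j) holomorphic_on \<psi> ` (V \<inter> affine_patch i)"
    and der: "\<And>i p. p \<in> V \<inter> affine_patch i \<Longrightarrow>
      \<exists>j. deriv (\<lambda>t. affine_coord i (the_inv_into V \<psi> t) $ j) (\<psi> p) \<noteq> 0"
    using chart by (auto simp: projective_curve_def)
  note V' = complex_chartD[OF V]
  have inv: "the_inv_into V \<psi> (\<psi> (h t)) = h t" if "t \<in> M" for t
    using the_inv_into_f_f[OF V'(2)] hV that by blast
  have hV': "continuous_map (top_of_set M) (subtopology (subtopology proj_topology C) V) h"
    using h hV by (auto simp: continuous_map_in_subtopology)
  have "continuous_map (top_of_set M) euclidean (\<psi> \<circ> h)"
    by (rule continuous_map_compose[OF hV' V'(4)])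
  then have cont: "continuous_on M (\<lambda>t. \<psi> (h t))" by (simp add: o_def)
  have "(\<lambda>t. \<psi> (h t)) field_differentiable (at z)" if z: "z \<in> M" for z
  proof -
    obtain N G where N: "z \<in> N" "N \<subseteq> M" "open N"
      and G: "\<And>j. (\<lambda>t. G t $ j) holomorphic_on N" "\<And>t. t \<in> N \<Longrightarrow> G t \<noteq> 0 \<and> h t = proj_point (G t)"
      using lift[OF z] unfolding holomorphic_lift_on_def by blast
    obtain i where i: "G z $ i \<noteq> 0" using G(2)[OF N(1)] by (auto simp: vec_eq_iff)
    have hz: "h z \<in> V \<inter> affine_patch i" using hV z i G(2)[OF N(1)] proj_point_mem_affine_patch by auto
    obtain j where j: "deriv (\<lambda>t. affine_coord i (the_inv_into V \<psi> t) $ j) (\<psi> (h z)) \<noteq> 0"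
      using der[OF hz] by blast
    let ?g = "\<lambda>t. affine_coord i (the_inv_into V \<psi> t) $ j"
    have "openin (subtopology proj_topology C) (C \<inter> affine_patch i)"
      using openin_affine_patch by (auto simp: openin_subtopology)
    then have op: "open (\<psi> ` (V \<inter> (C \<inter> affine_patch i)))" by (rule V'(5))
    moreover have "V \<inter> (C \<inter> affine_patch i) = V \<inter> affine_patch i"
      using openin_subset[OF V'(1)] by auto
    ultimately have g: "(?g has_field_derivative deriv ?g (\<psi> (h z))) (at (\<psi> (h z)))"
      using hol[of i j] hz by (auto intro!: holomorphic_derivI)
    define N' where "N' = {t \<in> N. G t $ i \<noteq> 0}"
    have N': "open N'" "z \<in> N'"
      unfolding N'_def using N i holomorphic_on_imp_continuous_on[OF G(1)[of i]]
      by (auto intro: continuous_open_preimage[of N "\<lambda>t. G t $ i" "- {0}", simplified, unfolded vimage_def Int_def, simplified])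
    have "(\<lambda>t. G t $ j / G t $ i) holomorphic_on N'"
      by (intro holomorphic_intros holomorphic_on_subset[OF G(1)]) (auto simp: N'_def)
    then have "(\<lambda>t. ?g (\<psi> (h t))) holomorphic_on N'"
    proof (rule holomorphic_transform)
      fix t assume "t \<in> N'"
      then have t: "t \<in> N" "t \<in> M" "G t $ i \<noteq> 0" using N by (auto simp: N'_def)
      then show "G t $ j / G t $ i = ?g (\<psi> (h t))"
        unfolding inv[OF t(2)] using G(2)[OF t(1)] by (simp add: affine_coord_nth)
    qed
    then have gf: "((\<lambda>t. ?g (\<psi> (h t))) has_field_derivative deriv (\<lambda>t. ?g (\<psi> (h t))) z) (at z)"
      using N' by (auto intro: holomorphic_derivI)
    have "isCont (\<lambda>t. \<psi> (h t)) z"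
      using cont z \<open>open M\<close> by (simp add: continuous_on_eq_continuous_at)
    from has_field_derivative_lift[OF this g j gf] show ?thesis
      by (auto simp: field_differentiable_def)
  qed
  then show ?thesis using \<open>open M\<close> by (simp add: holomorphic_on_open field_differentiable_def)
qed

text \<open>Affine coordinates normalised by \<open>x $ i = 1\<close> serve as the homogeneous lift
  of the inverse chart.\<close>

lemma chart_inverse_lift:
  assumes chart: "(U, \<phi>) \<in> atlas (projective_curve C)" and "u \<in> U" and C: "C \<subseteq> topspace proj_topology"
  shows "\<exists>i. u \<in> affine_patch i \<and> open (\<phi> ` (U \<inter> affine_patch i)) \<and>
    (\<forall>j. (\<lambda>t. affine_coord i (the_inv_into U \<phi> t) $ j) holomorphic_on \<phi> ` (U \<inter> affine_patch i)) \<and>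
    (\<forall>t \<in> \<phi> ` (U \<inter> affine_patch i). affine_coord i (the_inv_into U \<phi> t) $ i = 1 \<and>
      proj_point (affine_coord i (the_inv_into U \<phi> t)) = the_inv_into U \<phi> t)"
proof -
  have U: "complex_chart (subtopology proj_topology C) U \<phi>"
    and hol: "\<And>i j. (\<lambda>t. affine_coord i (the_inv_into U \<phi> t) $ j) holomorphic_on \<phi> ` (U \<inter> affine_patch i)"
    using chart by (auto simp: projective_curve_def)
  note U' = complex_chartD[OF U]
  have UC: "U \<subseteq> C" using openin_subset[OF U'(1)] by auto
  with C \<open>u \<in> U\<close> obtain i where i: "u \<in> affine_patch i"
    using proj_point_cases by blast
  have "openin (subtopology proj_topology C) (C \<inter> affine_patch i)"
    using openin_affine_patch by (auto simp: openin_subtopology)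
  then have "open (\<phi> ` (U \<inter> (C \<inter> affine_patch i)))" by (rule U'(5))
  moreover have "U \<inter> (C \<inter> affine_patch i) = U \<inter> affine_patch i" using UC by auto
  ultimately show ?thesis
    using i hol U'(2) by (intro exI[of _ i]) (auto simp: the_inv_into_f_f proj_point_affine_coord)
qed

text \<open>The Hausdorff property is inherited from projective space, and charts are compatible
  because the inverse of one is a lifted curve to which the other applies. What remains for a
  concrete curve is connectedness and a supply of charts.\<close>

lemma riemann_surface_projective_curve:
  fixes C :: "(complex ^ 'n) set set"
  assumes conn: "connectedin proj_topology C"
    and charts: "\<And>p. p \<in> C \<Longrightarrow> \<exists>U \<phi>. (U, \<phi>) \<in> atlas (projective_curve C) \<and> p \<in> U"
  shows "riemann_surface (projective_curve C)"
proof -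
  have C: "C \<subseteq> topspace proj_topology" using conn connectedin_subset_topspace by blast
  have cc: "complex_chart (subtopology proj_topology C) U \<phi>" if "(U, \<phi>) \<in> atlas (projective_curve C)" for U \<phi>
    using that by (auto simp: projective_curve_def)
  have sub: "U \<subseteq> C" if "(U, \<phi>) \<in> atlas (projective_curve C)" for U \<phi>
    using openin_subset[OF complex_chartD(1)[OF cc[OF that]]] by auto
  have "(\<psi> \<circ> the_inv_into U \<phi>) holomorphic_on \<phi> ` (U \<inter> V)"
    if U: "(U, \<phi>) \<in> atlas (projective_curve C)" and V: "(V, \<psi>) \<in> atlas (projective_curve C)" for U \<phi> V \<psi>
  proof -
    note U' = complex_chartD[OF cc[OF U]] and V' = complex_chartD[OF cc[OF V]]
    let ?M = "\<phi> ` (U \<inter> V)" and ?h = "the_inv_into U \<phi>"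
    have M: "open ?M" using U'(5) V'(1) by blast
    have "(\<lambda>t. \<psi> (?h t)) holomorphic_on ?M"
    proof (rule chart_comp_holomorphic[OF V M])
      have "continuous_map (top_of_set (\<phi> ` U)) (subtopology proj_topology C) ?h"
        using U'(6) by (simp add: continuous_map_in_subtopology)
      then show "continuous_map (top_of_set ?M) (subtopology proj_topology C) ?h"
        by (rule continuous_map_from_subtopology_mono) auto
      show "?h ` ?M \<subseteq> V" using U'(2) by (auto simp: the_inv_into_f_f)
      fix z assume "z \<in> ?M"
      then obtain u where u: "z = \<phi> u" "u \<in> U" "u \<in> V" by auto
      obtain i where
        i: "u \<in> affine_patch i" "open (\<phi> ` (U \<inter> affine_patch i))"
        "\<And>j. (\<lambda>t. affine_coord i (?h t) $ j) holomorphic_on \<phi> ` (U \<inter> affine_patch i)"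
        "\<And>t. t \<in> \<phi> ` (U \<inter> affine_patch i) \<Longrightarrow> affine_coord i (?h t) $ i = 1"
        "\<And>t. t \<in> \<phi> ` (U \<inter> affine_patch i) \<Longrightarrow> proj_point (affine_coord i (?h t)) = ?h t"
        using chart_inverse_lift[OF U u(2) C] by blast
      let ?N = "\<phi> ` (U \<inter> affine_patch i) \<inter> ?M"
      have "affine_coord i (?h t) \<noteq> 0" if "t \<in> ?N" for t
        using i(4)[of t] that by (metis IntD1 zero_index zero_neq_one)
      then have "holomorphic_lift_on ?h ?N"
        unfolding holomorphic_lift_on_def
        by (intro conjI exI[of _ "\<lambda>t. affine_coord i (?h t)"] allI ballI open_Int i(2) M
            holomorphic_on_subset[OF i(3)]) (use i(5) in auto)
      moreover have "z \<in> ?N" using u i(1) by auto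
      ultimately show "\<exists>N. z \<in> N \<and> N \<subseteq> ?M \<and> holomorphic_lift_on ?h N"
        by (intro exI[of _ ?N] conjI Int_lower2)
    qed
    then show ?thesis by (simp add: o_def)
  qed
  moreover have "(\<Union>(U, \<phi>) \<in> atlas (projective_curve C). U) = C"
    using charts sub by fastforce
  ultimately show ?thesis
    unfolding riemann_surface_def space_of_projective_curve
    using cc C conn by (auto simp: Hausdorff_space_subtopology Hausdorff_proj_topology connectedin_def)
qed

text \<open>Holomorphy in several variables is replaced by its effect on holomorphic curves, the
  form in which it meets the inverse of a chart.\<close>

definition preserves_holomorphic :: "(complex ^ 'm \<Rightarrow> complex ^ 'n) \<Rightarrow> bool" where
  "preserves_holomorphic g \<longleftrightarrow> (\<forall>N G. open N \<longrightarrow> (\<forall>j. (\<lambda>t::complex. G t $ j) holomorphic_on N) \<longrightarrow>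
     (\<forall>j. (\<lambda>t. g (G t) $ j) holomorphic_on N))"

text \<open>Local formulas in homogeneous coordinates turn a lift of an inverse chart into a lift of
  its image curve. They are requested near representatives with some coordinate 1, since these are
  the values of the lifted inverse charts.\<close>

lemma holomorphic_map_into_projective_curve:
  fixes C :: "(complex ^ 'm) set set" and D :: "(complex ^ 'n) set set"
  assumes cont: "continuous_map (subtopology proj_topology C) (subtopology proj_topology D) f"
    and C: "C \<subseteq> topspace proj_topology"
    and lift: "\<And>x i. proj_point x \<in> C \<Longrightarrow> x $ i = 1 \<Longrightarrow> \<exists>W g. open W \<and> x \<in> W \<and> preserves_holomorphic g \<and>
      (\<forall>y\<in>W. proj_point y \<in> C \<longrightarrow> g y \<noteq> 0 \<and> f (proj_point y) = proj_point (g y))"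
  shows "holomorphic_map (projective_curve C) (projective_curve D) f"
  unfolding holomorphic_map_def space_of_projective_curve
proof (intro conjI cont, clarify)
  fix U \<phi> V \<psi>
  assume U: "(U, \<phi>) \<in> atlas (projective_curve C)" and V: "(V, \<psi>) \<in> atlas (projective_curve D)"
  have U': "complex_chart (subtopology proj_topology C) U \<phi>" using U by (auto simp: projective_curve_def)
  note U' = complex_chartD[OF U']
  have V': "complex_chart (subtopology proj_topology D) V \<psi>" using V by (auto simp: projective_curve_def)
  note V' = complex_chartD[OF V']
  let ?M = "\<phi> ` (U \<inter> f -` V)" and ?h = "the_inv_into U \<phi>"
  have UC: "U \<subseteq> C" using openin_subset[OF U'(1)] by auto
  have "openin (subtopology proj_topology C) {x \<in> topspace (subtopology proj_topology C). f x \<in> V}"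
    using openin_continuous_map_preimage[OF cont V'(1)] .
  from U'(5)[OF this] have "open (\<phi> ` (U \<inter> {x \<in> topspace (subtopology proj_topology C). f x \<in> V}))" .
  moreover have "U \<inter> {x \<in> topspace (subtopology proj_topology C). f x \<in> V} = U \<inter> f -` V"
    using UC C by auto
  ultimately have M: "open ?M" by simp
  have ch: "continuous_map (top_of_set (\<phi> ` U)) (subtopology proj_topology C) ?h"
    using U'(6) by (simp add: continuous_map_in_subtopology)
  have "(\<lambda>t. \<psi> ((f \<circ> ?h) t)) holomorphic_on ?M"
  proof (rule chart_comp_holomorphic[OF V M])
    have "continuous_map (top_of_set ?M) (subtopology proj_topology C) ?h"
      by (rule continuous_map_from_subtopology_mono[OF ch]) auto
    then show "continuous_map (top_of_set ?M) (subtopology proj_topology D) (f \<circ> ?h)"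
      using cont by (rule continuous_map_compose)
    show "(f \<circ> ?h) ` ?M \<subseteq> V" using U'(2) by (auto simp: the_inv_into_f_f)
    fix z assume z: "z \<in> ?M"
    then obtain u where u: "z = \<phi> u" "u \<in> U" "f u \<in> V" by auto
    have hz: "?h z = u" using u U'(2) by (simp add: the_inv_into_f_f)
    obtain i where
      i: "u \<in> affine_patch i" "open (\<phi> ` (U \<inter> affine_patch i))"
      "\<And>j. (\<lambda>t. affine_coord i (?h t) $ j) holomorphic_on \<phi> ` (U \<inter> affine_patch i)"
      "\<And>t. t \<in> \<phi> ` (U \<inter> affine_patch i) \<Longrightarrow> affine_coord i (?h t) $ i = 1"
      "\<And>t. t \<in> \<phi> ` (U \<inter> affine_patch i) \<Longrightarrow> proj_point (affine_coord i (?h t)) = ?h t"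
        using chart_inverse_lift[OF U u(2) C] by blast
    let ?O = "\<phi> ` (U \<inter> affine_patch i)" and ?G = "\<lambda>t. affine_coord i (?h t)"
    have zO: "z \<in> ?O" using u i(1) by auto
    have inC: "?h t \<in> C" if "t \<in> ?O" for t using that UC U'(2) by (auto simp: the_inv_into_f_f)
    obtain W g where W: "open W" "?G z \<in> W"
      and g: "preserves_holomorphic g"
      and fg: "\<And>y. y \<in> W \<Longrightarrow> proj_point y \<in> C \<Longrightarrow> g y \<noteq> 0 \<and> f (proj_point y) = proj_point (g y)"
      using lift[of "?G z" i, unfolded i(5)[OF zO], OF inC[OF zO] i(4)[OF zO]] by blast
    have "continuous_on ?O ?G"
    proof -
      have "continuous_on ?O (\<lambda>t. \<chi> j. ?G t $ j)"
        by (intro continuous_on_vec_lambda holomorphic_on_imp_continuous_on i(3))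
      then show ?thesis by simp
    qed
    then have "open (?O \<inter> ?G -` W)" using continuous_open_preimage[OF _ i(2) W(1)] by blast
    then have oN: "open ((?O \<inter> ?G -` W) \<inter> ?M)" using M by (rule open_Int)
    let ?N = "(?O \<inter> ?G -` W) \<inter> ?M"
    have "holomorphic_lift_on (f \<circ> ?h) ?N"
      unfolding holomorphic_lift_on_def
    proof (intro conjI oN exI[of _ "\<lambda>t. g (?G t)"] allI ballI)
      show "(\<lambda>t. g (?G t) $ j) holomorphic_on ?N" for j
      proof (rule g[unfolded preserves_holomorphic_def, rule_format, OF oN])
        show "(\<lambda>t. ?G t $ j) holomorphic_on ?N" for j
          by (rule holomorphic_on_subset[OF i(3)]) auto
      qed
      fix t assume "t \<in> ?N"
      then have t: "t \<in> ?O" "?G t \<in> W" by auto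
      with fg[OF t(2)] i(5)[OF t(1)] inC[OF t(1)]
      show "g (?G t) \<noteq> 0" "(f \<circ> ?h) t = proj_point (g (?G t))" by auto
    qed
    moreover have "z \<in> ?N" using zO W z by simp
    ultimately show "\<exists>N. z \<in> N \<and> N \<subseteq> ?M \<and> holomorphic_lift_on (f \<circ> ?h) N"
      by (intro exI[of _ ?N] conjI Int_lower2)
  qed
  then show "(\<psi> \<circ> f \<circ> the_inv_into U \<phi>) holomorphic_on \<phi> ` (U \<inter> f -` V)" by (simp add: o_def)
qed

section \<open>Charts given by a ratio of two linear forms\<close>

definition lin_form :: "complex ^ 'n \<Rightarrow> complex ^ 'n \<Rightarrow> complex" where
  "lin_form a x = (\<Sum>j\<in>UNIV. a $ j * x $ j)"

lemma lin_form_axis [simp]: "lin_form (axis k 1) x = x $ k"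
proof -
  have "lin_form (axis k 1) x = (\<Sum>j\<in>UNIV. if j = k then x $ j else 0)"
    unfolding lin_form_def by (rule sum.cong) (auto simp: axis_def)
  then show ?thesis by simp
qed

lemma lin_form_add [simp]: "lin_form (a + b) x = lin_form a x + lin_form b x"
  by (simp add: lin_form_def algebra_simps sum.distrib)

lemma lin_form_scale: "lin_form a (c *s x) = c * lin_form a x"
  by (simp add: lin_form_def sum_distrib_left algebra_simps)

text \<open>General linear forms occur because the parameter on Bring's curve is a ratio of sums of
  coordinates. Normalising \<open>\<gamma>\<close> by \<open>lin_form b (\<gamma> t) = 1\<close> and
  \<open>lin_form a (\<gamma> t) = t\<close> makes it inverse to the ratio and also forces some
  affine coordinate to have nonzero derivative.\<close>

lemma parametrization_in_atlas:
  fixes C :: "(complex ^ 'n) set set" and \<gamma> :: "complex \<Rightarrow> complex ^ 'n"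
  assumes W: "open W" "punctured_cone W" "\<And>x. x \<in> W \<Longrightarrow> lin_form b x \<noteq> 0"
    and M: "open M" and hol: "\<And>j. (\<lambda>t. \<gamma> t $ j) holomorphic_on M"
    and \<gamma>: "\<And>t. t \<in> M \<Longrightarrow> \<gamma> t \<in> W" "\<And>t. t \<in> M \<Longrightarrow> proj_point (\<gamma> t) \<in> C"
      "\<And>t. t \<in> M \<Longrightarrow> lin_form b (\<gamma> t) = 1" "\<And>t. t \<in> M \<Longrightarrow> lin_form a (\<gamma> t) = t"
    and inv: "\<And>x. x \<in> W \<Longrightarrow> proj_point x \<in> C \<Longrightarrow> lin_form a x / lin_form b x \<in> M"
      "\<And>x. x \<in> W \<Longrightarrow> proj_point x \<in> C \<Longrightarrow> proj_point (\<gamma> (lin_form a x / lin_form b x)) = proj_point x"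
  shows "(C \<inter> proj_point ` W, on_rep (\<lambda>x. lin_form a x / lin_form b x)) \<in> atlas (projective_curve C)"
proof -
  define V where "V = C \<inter> proj_point ` W"
  define f where "f = (\<lambda>x. lin_form a x / lin_form b x)"
  define \<psi> where "\<psi> = on_rep f"
  have f_scale: "f (c *s x) = f x" if "c \<noteq> 0" for c x
    using that by (simp add: f_def lin_form_scale)
  have \<psi>x: "\<psi> (proj_point x) = f x" if "x \<in> W" for x
    unfolding \<psi>_def using that W(2) f_scale by (intro on_rep_proj_point) (auto simp: punctured_cone_def)
  have fin: "f x \<in> M" "proj_point (\<gamma> (f x)) = proj_point x" if "x \<in> W" "proj_point x \<in> C" for x
    using inv that by (auto simp: f_def)
  have \<psi>V: "\<psi> p \<in> M" "proj_point (\<gamma> (\<psi> p)) = p" if "p \<in> V" for p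
    using that fin \<psi>x by (auto simp: V_def)
  have \<gamma>V: "proj_point (\<gamma> t) \<in> V" "\<psi> (proj_point (\<gamma> t)) = t" if "t \<in> M" for t
    using that \<gamma> \<psi>x by (auto simp: V_def f_def)
  have im: "\<psi> ` V = M" using \<psi>V \<gamma>V by (auto simp: image_iff) metis
  have inj: "inj_on \<psi> V" using \<psi>V by (metis inj_onI)
  have inv_eq: "the_inv_into V \<psi> t = proj_point (\<gamma> t)" if "t \<in> M" for t
    by (rule the_inv_into_f_eq[OF inj]) (use \<gamma>V that in auto)
  have opW: "openin proj_topology (proj_point ` W)" using W openin_proj_point_cone by blast
  have opV: "openin (subtopology proj_topology C) V"
    using opW by (auto simp: V_def openin_subtopology)
  have "continuous_on W f"
    unfolding f_def lin_form_def by (intro continuous_intros) (use W in \<open>auto simp: lin_form_def\<close>)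
  then have "continuous_map (subtopology proj_topology (proj_point ` W)) euclidean \<psi>"
    unfolding \<psi>_def using W f_scale by (intro continuous_map_on_rep) auto
  then have c1: "continuous_map (subtopology (subtopology proj_topology C) V) (top_of_set (\<psi> ` V)) \<psi>"
    unfolding subtopology_subtopology continuous_map_in_subtopology
    by (auto intro: continuous_map_from_subtopology_mono simp: V_def)
  have "continuous_on M (\<lambda>t. \<chi> j. \<gamma> t $ j)"
    by (intro continuous_on_vec_lambda holomorphic_on_imp_continuous_on hol)
  then have "continuous_on M \<gamma>" by simp
  moreover have nz: "\<gamma> t \<noteq> 0" if "t \<in> M" for t
    using \<gamma>(1)[OF that] W(2) unfolding punctured_cone_def by metis
  ultimately have "continuous_map (top_of_set M) proj_topology (\<lambda>t. proj_point (\<gamma> t))"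
    using nz by (intro continuous_map_proj_point_comp) auto
  then have c2: "continuous_map (top_of_set (\<psi> ` V)) (subtopology (subtopology proj_topology C) V) (\<lambda>t. proj_point (\<gamma> t))"
    unfolding im subtopology_subtopology continuous_map_in_subtopology using \<gamma>V \<gamma>(2) by auto
  have chart: "complex_chart (subtopology proj_topology C) V \<psi>"
    unfolding complex_chart_def homeomorphic_map_maps homeomorphic_maps_def
    using opV c1 c2 M im \<psi>V \<gamma>V
    by (intro conjI exI[of _ "\<lambda>t. proj_point (\<gamma> t)"]) auto
  have ac: "affine_coord i (the_inv_into V \<psi> t) $ j = \<gamma> t $ j / \<gamma> t $ i"
    if "t \<in> M" "\<gamma> t $ i \<noteq> 0" for i j t
    using that inv_eq by (simp add: affine_coord_nth)
  define M' where "M' i = {t \<in> M. \<gamma> t $ i \<noteq> 0}" for i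
  have M'_eq: "\<psi> ` (V \<inter> affine_patch i) = M' i" for i
  proof safe
    fix p assume p: "p \<in> V" "p \<in> affine_patch i"
    then have "proj_point (\<gamma> (\<psi> p)) \<in> affine_patch i" using \<psi>V by simp
    then show "\<psi> p \<in> M' i" using \<psi>V(1)[OF p(1)] by (simp add: M'_def proj_point_mem_affine_patch)
  next
    fix t assume "t \<in> M' i"
    then show "t \<in> \<psi> ` (V \<inter> affine_patch i)"
      using \<gamma>V by (intro image_eqI[of _ _ "proj_point (\<gamma> t)"]) (auto simp: M'_def proj_point_mem_affine_patch)
  qed
  have oM': "open (M' i)" for i
    unfolding M'_def
    using continuous_open_preimage[OF holomorphic_on_imp_continuous_on[OF hol] M, of "- {0}" i]
    by (auto simp: vimage_def Int_def)
  have quot: "(\<lambda>t. \<gamma> t $ j / \<gamma> t $ i) holomorphic_on M' i" for i j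
    by (intro holomorphic_intros holomorphic_on_subset[OF hol]) (auto simp: M'_def)
  have hol': "(\<lambda>t. affine_coord i (the_inv_into V \<psi> t) $ j) holomorphic_on \<psi> ` (V \<inter> affine_patch i)" for i j
    unfolding M'_eq by (rule holomorphic_transform[OF quot]) (auto simp: M'_def ac)
  \<comment> \<open>If all affine coordinates had derivative 0, so would their combinations with the
    coefficients of \<open>b\<close> and \<open>a\<close>, which are
    \<open>1 / \<gamma> t $ i\<close> and \<open>t / \<gamma> t $ i\<close>. The product rule for
    the second then yields \<open>1 / \<gamma> t $ i = 0\<close>, which is absurd.\<close>
  have der: "\<exists>j. deriv (\<lambda>t. affine_coord i (the_inv_into V \<psi> t) $ j) (\<psi> p) \<noteq> 0"
    if "p \<in> V \<inter> affine_patch i" for i p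
  proof (rule ccontr)
    let ?A = "\<lambda>j t. affine_coord i (the_inv_into V \<psi> t) $ j"
    assume "\<not> ?thesis"
    then have d0: "deriv (?A j) (\<psi> p) = 0" for j by auto
    let ?t = "\<psi> p"
    have t: "?t \<in> M' i" using M'_eq that by blast
    have A0: "(?A j has_field_derivative 0) (at ?t)" for j
      using holomorphic_derivI[OF hol'[of i j, unfolded M'_eq] oM' t] d0 by simp
    have lin: "((\<lambda>t. \<Sum>j\<in>UNIV. c $ j * ?A j t) has_field_derivative 0) (at ?t)" for c :: "complex ^ 'n"
    proof -
      have "((\<lambda>t. \<Sum>j\<in>UNIV. c $ j * ?A j t) has_field_derivative (\<Sum>j\<in>UNIV. c $ j * 0)) (at ?t)"
        by (intro DERIV_sum DERIV_cmult A0)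
      then show ?thesis by simp
    qed
    have lf: "(\<Sum>j\<in>UNIV. c $ j * ?A j t) = lin_form c (\<gamma> t) / \<gamma> t $ i" if "t \<in> M' i" for c t
      using that ac by (simp add: M'_def lin_form_def sum_divide_distrib)
    have B: "((\<lambda>t. 1 / \<gamma> t $ i) has_field_derivative 0) (at ?t)"
      by (rule has_field_derivative_transform_within_open[OF lin[of b] oM' t])
        (subst lf, assumption, use \<gamma>(3) in \<open>simp add: M'_def\<close>)
    have A: "((\<lambda>t. t * (1 / \<gamma> t $ i)) has_field_derivative 0) (at ?t)"
      by (rule has_field_derivative_transform_within_open[OF lin[of a] oM' t])
        (subst lf, assumption, use \<gamma>(4) in \<open>simp add: M'_def\<close>)
    have "((\<lambda>t. t * (1 / \<gamma> t $ i)) has_field_derivative 1 * (1 / \<gamma> ?t $ i) + 0 * ?t) (at ?t)"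
      by (intro DERIV_mult DERIV_ident B)
    from DERIV_unique[OF this A] show False using t by (simp add: M'_def)
  qed
  show ?thesis
    using chart hol' der unfolding projective_curve_def V_def \<psi>_def f_def by auto
qed

section \<open>Quotients\<close>

lemma complex_chart_pullback:
  assumes h: "homeomorphic_maps X Y f g" and V: "complex_chart Y V \<psi>"
  defines "V' \<equiv> {u \<in> topspace X. f u \<in> V}"
  shows "complex_chart X V' (\<psi> \<circ> f)" "(\<psi> \<circ> f) ` V' = \<psi> ` V"
proof -
  have VY: "V \<subseteq> topspace Y" and Vo: "openin Y V" using V openin_subset by (auto simp: complex_chart_def)
  have f: "continuous_map X Y f" "continuous_map Y X g" "\<And>x. x \<in> topspace X \<Longrightarrow> g (f x) = x"
    "\<And>y. y \<in> topspace Y \<Longrightarrow> f (g y) = y"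
    using h by (auto simp: homeomorphic_maps_def)
  have gY: "g y \<in> topspace X" if "y \<in> topspace Y" for y
    using continuous_map_image_subset_topspace[OF f(2)] that by blast
  have fV': "f ` V' = V"
    using f(4) gY VY by (auto simp: V'_def image_iff) (metis subsetD)
  then show im: "(\<psi> \<circ> f) ` V' = \<psi> ` V" by (metis image_comp)
  have "homeomorphic_map (subtopology X V') (subtopology Y V) f"
    by (rule homeomorphic_map_subtopologies)
      (use h homeomorphic_map_maps fV' VY in \<open>auto simp: V'_def\<close>)
  then have "homeomorphic_map (subtopology X V') (top_of_set (\<psi> ` V)) (\<psi> \<circ> f)"
    using V by (auto simp: complex_chart_def intro: homeomorphic_map_compose)
  moreover have "openin X V'"
    unfolding V'_def using f(1) Vo by (rule openin_continuous_map_preimage)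
  ultimately show "complex_chart X V' (\<psi> \<circ> f)"
    using V im by (simp add: complex_chart_def)
qed

lemma holomorphic_inverse_exists:
  assumes "f holomorphic_on S" "open S" "inj_on f S"
  shows "\<exists>g. g holomorphic_on f ` S \<and> (\<forall>z\<in>S. g (f z) = z)"
  using holomorphic_has_inverse[OF assms] by metis

text \<open>Where \<open>q\<close> is injective on a chart of \<open>S\<close>, both quotient charts
  read in that chart are holomorphic and injective, so the transition is one of them composed with
  the holomorphic inverse of the other. At the exceptional points the transition is still
  continuous, and finitely many such points are removable.\<close>

lemma quotient_surface_charts_compatible:
  fixes S :: "'a surface" and q :: "'a \<Rightarrow> 'b"
  assumes charts: "\<And>V \<psi>. (V, \<psi>) \<in> atlas S \<Longrightarrow> complex_chart (space_of S) V \<psi>"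
    and fin: "finite K"
    and good: "\<And>x. x \<in> topspace (space_of S) \<Longrightarrow> q x \<notin> K \<Longrightarrow> \<exists>V \<psi>. (V, \<psi>) \<in> atlas S \<and> x \<in> V \<and> inj_on q V"
    and U: "(U, \<phi>) \<in> atlas (quotient_surface S q)" and U': "(U', \<phi>') \<in> atlas (quotient_surface S q)"
  shows "(\<phi>' \<circ> the_inv_into U \<phi>) holomorphic_on \<phi> ` (U \<inter> U')"
proof -
  let ?X = "space_of S" and ?Q = "quotient_topology (space_of S) q"
  have c: "complex_chart ?Q U \<phi>" "complex_chart ?Q U' \<phi>'"
    using U U' by (auto simp: quotient_surface_def)
  note cU = complex_chartD[OF c(1)] and cU' = complex_chartD[OF c(2)]
  let ?k = "\<phi>' \<circ> the_inv_into U \<phi>" and ?O = "\<phi> ` (U \<inter> U')"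
  have oO: "open ?O" using cU(5) cU'(1) by blast
  have "continuous_map (top_of_set (\<phi> ` U)) ?Q (the_inv_into U \<phi>)"
    using cU(6) by (simp add: continuous_map_in_subtopology)
  then have "continuous_map (top_of_set ?O) ?Q (the_inv_into U \<phi>)"
    by (rule continuous_map_from_subtopology_mono) auto
  then have "continuous_map (top_of_set ?O) (subtopology ?Q U') (the_inv_into U \<phi>)"
    using cU(2) by (auto simp: continuous_map_in_subtopology the_inv_into_f_f)
  from continuous_map_compose[OF this cU'(4)] have cont: "continuous_on ?O ?k" by simp
  show ?thesis
  proof (rule no_isolated_singularity[OF cont _ oO])
    show "finite (\<phi> ` K)" using fin by simp
    have "?k field_differentiable (at z)" if z: "z \<in> ?O - \<phi> ` K" for z
    proof -
      obtain u where u: "u \<in> U" "u \<in> U'" "z = \<phi> u" "u \<notin> K" using z by auto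
      then obtain x where x: "x \<in> topspace ?X" "u = q x"
        using openin_subset[OF cU(1)] by auto
      obtain V \<psi> where V: "(V, \<psi>) \<in> atlas S" "x \<in> V" "inj_on q V"
        using good[OF x(1)] x u by blast
      note cV = complex_chartD[OF charts[OF V(1)]]
      have VX: "V \<subseteq> topspace ?X" using openin_subset[OF cV(1)] .
      let ?P = "{x \<in> topspace ?X. q x \<in> U \<inter> U'}"
      let ?M = "\<psi> ` (V \<inter> ?P)"
      have "openin ?X ?P"
        by (rule openin_continuous_map_preimage[OF quotient_imp_continuous_map[OF quotient_map_quotient_topology]])
          (use cU(1) cU'(1) in auto)
      then have oM: "open ?M" by (rule cV(5))
      let ?h = "\<phi> \<circ> q \<circ> the_inv_into V \<psi>" and ?h' = "\<phi>' \<circ> q \<circ> the_inv_into V \<psi>"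
      have inv: "the_inv_into V \<psi> (\<psi> v) = v" if "v \<in> V" for v
        using cV(2) that by (simp add: the_inv_into_f_f)
      have "?h holomorphic_on \<psi> ` (V \<inter> q -` U)" "?h' holomorphic_on \<psi> ` (V \<inter> q -` U')"
        using U U' V(1) by (auto simp: quotient_surface_def)
      then have hh: "?h holomorphic_on ?M" "?h' holomorphic_on ?M"
        by (auto elim!: holomorphic_on_subset)
      have inj: "inj_on ?h ?M"
      proof (rule inj_onI)
        fix s t assume "s \<in> ?M" "t \<in> ?M" and eq: "?h s = ?h t"
        then obtain v w where vw: "v \<in> V" "w \<in> V" "q v \<in> U" "q w \<in> U" "s = \<psi> v" "t = \<psi> w" by auto
        then have "q v = q w" using eq cU(2) by (auto simp: inv dest: inj_onD)
        then show "s = t" using vw V(3) by (auto dest: inj_onD)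
      qed
      obtain g where g: "g holomorphic_on ?h ` ?M" "\<And>t. t \<in> ?M \<Longrightarrow> g (?h t) = t"
        using holomorphic_inverse_exists[OF hh(1) oM inj] by blast
      have ohM: "open (?h ` ?M)" using open_mapping_thm3[OF hh(1) oM inj] .
      have "g ` (?h ` ?M) \<subseteq> ?M" using g(2) by auto
      then have "(?h' \<circ> g) holomorphic_on ?h ` ?M"
        using holomorphic_on_compose_gen[OF g(1) hh(2)] by blast
      moreover have "(?h' \<circ> g) y = ?k y" if y: "y \<in> ?h ` ?M" for y
      proof -
        obtain v where v: "v \<in> V" "q v \<in> U" "v \<in> topspace ?X" "q v \<in> U'" "y = \<phi> (q v)"
          using y by (auto simp: inv)
        then have "\<psi> v \<in> ?M" by auto
        from g(2)[OF this] have "g y = \<psi> v" using v by (simp add: inv)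
        then show ?thesis using v cU(2) by (simp add: inv the_inv_into_f_f)
      qed
      ultimately have "?k holomorphic_on ?h ` ?M" by (rule holomorphic_transform)
      moreover have "z \<in> ?h ` ?M"
        using u x V(2) by (intro image_eqI[of _ _ "\<psi> x"]) (auto simp: inv)
      ultimately show ?thesis using ohM holomorphic_on_imp_differentiable_at by blast
    qed
    then show "?k holomorphic_on ?O - \<phi> ` K"
      by (auto simp: holomorphic_on_def intro: field_differentiable_at_within)
  qed
qed

text \<open>As \<open>f\<close> and \<open>q\<close> have the same fibres, the universal property of
  quotient maps gives mutually inverse homeomorphisms. Charts of \<open>T\<close> pull back to the
  quotient, and holomorphy of both maps becomes an instance of compatibility of quotient
  charts.\<close>

lemma biholomorphic_quotient_surface:
  fixes S :: "'a surface" and T :: "'b surface" and q :: "'a \<Rightarrow> 'c"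
  assumes T: "riemann_surface T"
    and charts: "\<And>V \<psi>. (V, \<psi>) \<in> atlas S \<Longrightarrow> complex_chart (space_of S) V \<psi>"
    and quo: "quotient_map (space_of S) (space_of T) f"
    and fib: "\<And>x y. x \<in> topspace (space_of S) \<Longrightarrow> y \<in> topspace (space_of S) \<Longrightarrow> q x = q y \<longleftrightarrow> f x = f y"
    and hol: "holomorphic_map S T f"
    and fin: "finite K"
    and good: "\<And>x. x \<in> topspace (space_of S) \<Longrightarrow> f x \<notin> K \<Longrightarrow> \<exists>V \<psi>. (V, \<psi>) \<in> atlas S \<and> x \<in> V \<and> inj_on f V"
  shows "biholomorphic (quotient_surface S q) T"
proof -
  let ?X = "space_of S" and ?Y = "space_of T" and ?Q = "quotient_topology (space_of S) q"
  let ?S = "quotient_surface S q"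
  have Q: "space_of ?S = ?Q" by (simp add: quotient_surface_def)
  have qq: "quotient_map ?X ?Q q" by (rule quotient_map_quotient_topology)
  obtain F where F: "continuous_map ?Q ?Y F" "\<And>x. x \<in> topspace ?X \<Longrightarrow> F (q x) = f x"
    using quotient_map_lift_exists[OF qq quotient_imp_continuous_map[OF quo]] fib by metis
  obtain G where G: "continuous_map ?Y ?Q G" "\<And>x. x \<in> topspace ?X \<Longrightarrow> G (f x) = q x"
    using quotient_map_lift_exists[OF quo quotient_imp_continuous_map[OF qq]] fib by metis
  have GF: "G (F u) = u" if "u \<in> topspace ?Q" for u using that F G by auto
  have tY: "topspace ?Y = f ` topspace ?X" using quo by (simp add: quotient_map_def)
  have FG: "F (G y) = y" if "y \<in> topspace ?Y" for y using that F G tY by auto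
  have hom: "homeomorphic_maps ?Q ?Y F G" using F G GF FG by (simp add: homeomorphic_maps_def)
  have FQ: "F u \<in> topspace ?Y" if "u \<in> topspace ?Q" for u
    using continuous_map_image_subset_topspace[OF F(1)] that by blast
  have GY: "G y \<in> topspace ?Q" if "y \<in> topspace ?Y" for y
    using continuous_map_image_subset_topspace[OF G(1)] that by blast
  have chartT: "complex_chart ?Y V \<psi>" if "(V, \<psi>) \<in> atlas T" for V \<psi>
    using T that by (auto simp: riemann_surface_def)
  have chartS: "complex_chart ?Q U \<phi>" if "(U, \<phi>) \<in> atlas ?S" for U \<phi>
    using that by (auto simp: quotient_surface_def)
  have compat: "(\<phi>' \<circ> the_inv_into U \<phi>) holomorphic_on \<phi> ` (U \<inter> U')"
    if "(U, \<phi>) \<in> atlas ?S" "(U', \<phi>') \<in> atlas ?S" for U \<phi> U' \<phi>'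
  proof (rule quotient_surface_charts_compatible[OF charts _ _ that])
    show "finite (G ` K)" using fin by simp
    fix x assume x: "x \<in> topspace ?X" "q x \<notin> G ` K"
    then have "f x \<notin> K" using G(2) by force
    then obtain V \<psi> where V: "(V, \<psi>) \<in> atlas S" "x \<in> V" "inj_on f V" using good x by blast
    then have "V \<subseteq> topspace ?X" using complex_chartD(1)[OF charts] openin_subset by blast
    then have "inj_on q V" using V(3) fib by (auto simp: inj_on_def subset_iff)
    then show "\<exists>V \<psi>. (V, \<psi>) \<in> atlas S \<and> x \<in> V \<and> inj_on q V" using V by blast
  qed
  define pre where "pre V = {u \<in> topspace ?Q. F u \<in> V}" for V
  \<comment> \<open>A pulled back chart belongs to the quotient atlas because
    \<open>\<psi> \<circ> F \<circ> q\<close> coincides with \<open>\<psi> \<circ> f\<close>, which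
    is holomorphic by assumption.\<close>
  have pull: "(pre V, \<psi> \<circ> F) \<in> atlas ?S" if V: "(V, \<psi>) \<in> atlas T" for V \<psi>
  proof -
    have "(\<psi> \<circ> F \<circ> q \<circ> the_inv_into W \<omega>) holomorphic_on \<omega> ` (W \<inter> q -` pre V)"
      if W: "(W, \<omega>) \<in> atlas S" for W \<omega>
    proof -
      note cW = complex_chartD[OF charts[OF W]]
      have WX: "W \<subseteq> topspace ?X" using openin_subset[OF cW(1)] .
      have "q w \<in> pre V \<longleftrightarrow> f w \<in> V" if "w \<in> W" for w
      proof -
        have w: "w \<in> topspace ?X" using WX that by blast
        then have "q w \<in> topspace ?Q" by simp
        with F(2)[OF w] show ?thesis unfolding pre_def mem_Collect_eq by metis
      qed
      then have "W \<inter> q -` pre V = W \<inter> f -` V" by auto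
      moreover have "(\<psi> \<circ> f \<circ> the_inv_into W \<omega>) holomorphic_on \<omega> ` (W \<inter> f -` V)"
        using hol V W by (auto simp: holomorphic_map_def)
      moreover have "(\<psi> \<circ> f \<circ> the_inv_into W \<omega>) t = (\<psi> \<circ> F \<circ> q \<circ> the_inv_into W \<omega>) t"
        if "t \<in> \<omega> ` (W \<inter> f -` V)" for t
        using that cW(2) WX F(2) by (auto simp: the_inv_into_f_f subset_iff)
      ultimately show ?thesis by (metis (no_types, lifting) holomorphic_transform)
    qed
    then show ?thesis
      using complex_chart_pullback(1)[OF hom chartT[OF V]]
      by (auto simp: quotient_surface_def pre_def)
  qed
  have subS: "U \<subseteq> topspace ?Q" if "(U, \<phi>) \<in> atlas ?S" for U \<phi>
    using openin_subset[OF complex_chartD(1)[OF chartS[OF that]]] .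
  have "Hausdorff_space ?Q"
    using T homeomorphic_Hausdorff_space[of ?Q ?Y] hom
    by (auto simp: riemann_surface_def homeomorphic_space_def)
  moreover have "connected_space ?Q"
    using T homeomorphic_connected_space[of ?Q ?Y] hom
    by (auto simp: riemann_surface_def homeomorphic_space_def)
  moreover have "(\<Union>(U, \<phi>) \<in> atlas ?S. U) = topspace ?Q"
  proof (intro equalityI subsetI)
    fix u assume u: "u \<in> topspace ?Q"
    then obtain V \<psi> where V: "(V, \<psi>) \<in> atlas T" "F u \<in> V"
      using T FQ[OF u] unfolding riemann_surface_def by blast
    then show "u \<in> (\<Union>(U, \<phi>) \<in> atlas ?S. U)" using pull[OF V(1)] u
      by (intro UN_I[of "(pre V, \<psi> \<circ> F)"]) (auto simp: pre_def)
  next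
    fix u assume "u \<in> (\<Union>(U, \<phi>) \<in> atlas ?S. U)"
    then show "u \<in> topspace ?Q" using subS by blast
  qed
  ultimately have S: "riemann_surface ?S"
    using chartS compat by (auto simp: riemann_surface_def Q)
  have "holomorphic_map ?S T F"
    unfolding holomorphic_map_def Q
  proof (intro conjI F(1), clarify)
    fix U \<phi> V \<psi> assume U: "(U, \<phi>) \<in> atlas ?S" and V: "(V, \<psi>) \<in> atlas T"
    have "U \<inter> F -` V = U \<inter> pre V" using subS[OF U] by (auto simp: pre_def)
    then show "(\<psi> \<circ> F \<circ> the_inv_into U \<phi>) holomorphic_on \<phi> ` (U \<inter> F -` V)"
      using compat[OF U pull[OF V]] by simp
  qed
  moreover have "holomorphic_map T ?S G"
    unfolding holomorphic_map_def Q
  proof (intro conjI G(1), clarify)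
    fix U \<phi> V \<psi> assume U: "(U, \<phi>) \<in> atlas ?S" and V: "(V, \<psi>) \<in> atlas T"
    note cV = complex_chartD[OF chartT[OF V]]
    have VY: "V \<subseteq> topspace ?Y" using openin_subset[OF cV(1)] .
    have inj: "inj_on (\<psi> \<circ> F) (pre V)" using complex_chartD(2)[OF chartS[OF pull[OF V]]] .
    have v: "G v \<in> pre V" "F (G v) = v" if "v \<in> V" for v
      using that VY FG GY by (auto simp: pre_def subset_iff)
    \<comment> \<open>The local expression of \<open>G\<close> is the transition from the pulled
      back chart to \<open>\<phi>\<close>; it remains to match domains and values.\<close>
    have "(\<psi> \<circ> F) ` (pre V \<inter> U) = \<psi> ` (V \<inter> G -` U)"
    proof (intro equalityI subsetI)
      fix t assume "t \<in> (\<psi> \<circ> F) ` (pre V \<inter> U)"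
      then obtain u where u: "u \<in> pre V" "u \<in> U" "t = \<psi> (F u)" by auto
      then show "t \<in> \<psi> ` (V \<inter> G -` U)" using GF[of u]
        by (intro image_eqI[of _ _ "F u"]) (auto simp: pre_def)
    next
      fix t assume "t \<in> \<psi> ` (V \<inter> G -` U)"
      then obtain w where w: "w \<in> V" "G w \<in> U" "t = \<psi> w" by auto
      then show "t \<in> (\<psi> \<circ> F) ` (pre V \<inter> U)" using v[of w]
        by (intro image_eqI[of _ _ "G w"]) auto
    qed
    moreover have "(\<phi> \<circ> the_inv_into (pre V) (\<psi> \<circ> F)) t = (\<phi> \<circ> G \<circ> the_inv_into V \<psi>) t"
      if "t \<in> \<psi> ` (V \<inter> G -` U)" for t
    proof -
      obtain w where w: "w \<in> V" "t = \<psi> w" using \<open>t \<in> _\<close> by auto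
      have "the_inv_into (pre V) (\<psi> \<circ> F) t = G w"
        by (rule the_inv_into_f_eq[OF inj]) (use v[OF w(1)] w in auto)
      then show ?thesis using w cV(2) by (simp add: the_inv_into_f_f)
    qed
    ultimately show "(\<phi> \<circ> G \<circ> the_inv_into V \<psi>) holomorphic_on \<psi> ` (V \<inter> G -` U)"
      using compat[OF pull[OF V] U] by (metis (no_types, lifting) holomorphic_transform)
  qed
  ultimately show ?thesis
    unfolding biholomorphic_def Q using S T GF FG by blast
qed

section \<open>Local square roots and double covers\<close>

lemma Re_csqrt_pos: "0 < Re (csqrt z)" if "0 < Re z"
proof (rule ccontr)
  assume "\<not> 0 < Re (csqrt z)"
  then have "Re (csqrt z) = 0" using csqrt_principal[of z] by auto
  then have "Re ((csqrt z)\<^sup>2) \<le> 0" by (simp add: power2_eq_square)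
  then show False using that by simp
qed

text \<open>Of two opposite roots at most one lies in the open half plane around \<open>r\<close>.
  Applied to ratios of coordinates, such an inequality selects a branch by an open condition that
  respects scaling.\<close>

lemma sqrt_unique_halfplane:
  fixes w s r :: complex
  assumes "w\<^sup>2 = s\<^sup>2" "0 < Re (w / r)" "0 < Re (s / r)"
  shows "w = s"
proof -
  have "w = s \<or> w = - s" using assms(1) by (simp add: power2_eq_iff)
  then show ?thesis using assms(2,3) by auto
qed

text \<open>Dividing by \<open>r\<^sup>2\<close> moves the value at \<open>z\<close> to 1, where the
  principal root is holomorphic and has positive real part.\<close>

lemma local_sqrt:
  fixes f :: "complex \<Rightarrow> complex"
  assumes "open S" "z \<in> S" "f holomorphic_on S" "f z = r\<^sup>2" "r \<noteq> 0"
  shows "\<exists>N s. open N \<and> z \<in> N \<and> N \<subseteq> S \<and> s holomorphic_on N \<and> s z = r \<and>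
    (\<forall>t\<in>N. (s t)\<^sup>2 = f t \<and> 0 < Re (s t / r))"
proof -
  define h where "h t = f t / r\<^sup>2" for t
  define N where "N = S \<inter> h -` {w. 0 < Re w}"
  define s where "s t = r * csqrt (h t)" for t
  have h: "h holomorphic_on S" unfolding h_def by (intro holomorphic_intros assms) (use assms in auto)
  have "open N" unfolding N_def
    by (rule continuous_open_preimage[OF holomorphic_on_imp_continuous_on[OF h] assms(1)])
      (simp add: open_halfspace_Re_gt)
  moreover have "z \<in> N" using assms by (simp add: N_def h_def)
  moreover have "s holomorphic_on N"
    unfolding s_def
    by (intro holomorphic_intros holomorphic_on_subset[OF h])
      (auto simp: N_def complex_nonpos_Reals_iff)
  moreover have "s z = r" using assms by (simp add: s_def h_def)
  moreover have "(s t)\<^sup>2 = f t \<and> 0 < Re (s t / r)" if "t \<in> N" for t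
    using that assms(5) Re_csqrt_pos[of "h t"] by (auto simp: N_def s_def power_mult_distrib h_def)
  moreover have "N \<subseteq> S" by (auto simp: N_def)
  ultimately show ?thesis by blast
qed

text \<open>For a root \<open>c\<close> of \<open>z\<close> the distances of \<open>c\<close> and
  \<open>- c\<close> from \<open>y\<close> have product \<open>norm (z - y\<^sup>2)\<close>, so one
  of them is below \<open>e\<close>. This is what makes the projection of a double cover
  open.\<close>

lemma nearby_sqrt:
  fixes y z :: complex
  assumes "0 < e" "norm (z - y\<^sup>2) < e\<^sup>2"
  shows "\<exists>w. w\<^sup>2 = z \<and> norm (w - y) < e"
proof -
  let ?c = "csqrt z"
  have "norm (?c - y) * norm (?c + y) = norm (z - y\<^sup>2)"
  proof -
    have "(?c - y) * (?c + y) = ?c\<^sup>2 - y\<^sup>2" by (simp add: algebra_simps power2_eq_square)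
    then show ?thesis by (metis norm_mult power2_csqrt)
  qed
  then have lt: "norm (?c - y) * norm (?c + y) < e\<^sup>2" using assms by simp
  have "norm (?c - y) < e \<or> norm (?c + y) < e"
  proof (rule ccontr)
    assume "\<not> ?thesis"
    then have "e * e \<le> norm (?c - y) * norm (?c + y)"
      using assms(1) by (intro mult_mono) auto
    then show False using lt by (simp add: power2_eq_square)
  qed
  then show ?thesis
  proof
    assume "norm (?c + y) < e"
    then have "norm (- ?c - y) < e" by (metis minus_add_distrib norm_minus_cancel uminus_add_conv_diff diff_conv_add_uminus)
    then show ?thesis by (intro exI[of _ "- ?c"]) simp
  qed (auto intro: exI[of _ ?c])
qed

text \<open>The projection to the \<open>x\<close>-line is open and proper, so each nonempty clopen part of the double
  cover meets every fibre; the fibre over a branch point is a single point.\<close>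

lemma connected_double_cover:
  fixes P :: "complex \<Rightarrow> complex"
  assumes cont: "continuous_on UNIV P" and root: "P x0 = 0"
  shows "connected {(x, y). y\<^sup>2 = P x}"
proof -
  let ?A = "{(x, y). y\<^sup>2 = P x}"
  have Pc: "continuous_on S P" for S using cont continuous_on_subset by blast
  have "?A = (\<lambda>v. (snd v)\<^sup>2 - P (fst v)) -` {0}" by auto
  moreover have "closed ((\<lambda>v. (snd v)\<^sup>2 - P (fst v)) -` {0})"
    by (intro closed_vimage closed_singleton continuous_intros continuous_on_compose2[OF cont]) auto
  ultimately have clA: "closed ?A" by simp
  have onto: "fst ` T = UNIV" if op: "openin (top_of_set ?A) T" and cl: "closedin (top_of_set ?A) T"
    and ne: "T \<noteq> {}" for T
  proof -
    have TA: "T \<subseteq> ?A" using op openin_subset by fastforce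
    obtain Q where Q: "open Q" "T = ?A \<inter> Q" using op by (auto simp: openin_open)
    have "open (fst ` T)"
      unfolding open_dist
    proof
      fix x assume "x \<in> fst ` T"
      then obtain y where xy: "(x, y) \<in> T" by auto
      then have "(x, y) \<in> Q" using Q by auto
      then obtain A B where AB: "open A" "open B" "x \<in> A" "y \<in> B" "A \<times> B \<subseteq> Q"
        using open_prod_elim[OF Q(1)] by (metis mem_Sigma_iff)
      obtain d where d: "d > 0" "\<And>x'. dist x' x < d \<Longrightarrow> x' \<in> A" using AB open_dist by blast
      obtain e where e: "e > 0" "\<And>y'. dist y' y < e \<Longrightarrow> y' \<in> B" using AB open_dist by blast
      have "isCont P x" using cont by (simp add: continuous_on_eq_continuous_at)
      then obtain d' where d': "d' > 0" "\<And>x'. dist x' x < d' \<Longrightarrow> dist (P x') (P x) < e\<^sup>2"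
        using e(1) unfolding continuous_at_eps_delta by (metis zero_less_power)
      have "x' \<in> fst ` T" if x': "dist x' x < min d d'" for x'
      proof -
        have "y\<^sup>2 = P x" using xy TA by auto
        then have "norm (P x' - y\<^sup>2) < e\<^sup>2" using d'(2)[of x'] x' by (simp add: dist_norm)
        then obtain w where w: "w\<^sup>2 = P x'" "norm (w - y) < e" using nearby_sqrt e(1) by blast
        then have "(x', w) \<in> Q" using AB d(2)[of x'] x' e(2)[of w] by (auto simp: dist_norm)
        then show ?thesis using w Q by force
      qed
      then show "\<exists>e>0. \<forall>y. dist y x < e \<longrightarrow> y \<in> fst ` T"
        using d(1) d'(1) by (intro exI[of _ "min d d'"]) auto
    qed
    \<comment> \<open>Ordinates over a convergent sequence are bounded because their squares
      converge; a convergent subsequence provides a point of \<open>T\<close> over the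
      limit.\<close>
    moreover have "closed (fst ` T)"
      unfolding closed_sequential_limits
    proof (intro allI impI, elim conjE)
      fix u l assume "\<forall>n. u n \<in> fst ` T" and ul: "u \<longlonglongrightarrow> l"
      then have "\<forall>n. \<exists>y. (u n, y) \<in> T" by force
      then obtain v where v: "\<And>n. (u n, v n) \<in> T" by metis
      have "(\<lambda>n. P (u n)) \<longlonglongrightarrow> P l"
        using ul cont by (metis continuous_on_eq_continuous_at isCont_tendsto_compose open_UNIV iso_tuple_UNIV_I)
      then have "Bseq (\<lambda>n. P (u n))" by (rule convergent_imp_Bseq[OF convergentI])
      then obtain K where K: "\<And>n. norm (P (u n)) \<le> K" by (auto simp: Bseq_def)
      have "norm (v n) \<le> 1 + K" for n
      proof -
        have "(v n)\<^sup>2 = P (u n)" using v[of n] TA by auto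
        then have "(norm (v n))\<^sup>2 \<le> K" using K[of n] by (metis norm_power)
        moreover have "norm (v n) \<le> 1 + (norm (v n))\<^sup>2"
        proof -
          have "0 \<le> (norm (v n) - 1)\<^sup>2" by simp
          then have "2 * norm (v n) \<le> 1 + (norm (v n))\<^sup>2" by (simp add: power2_eq_square algebra_simps)
          then show ?thesis using norm_ge_zero[of "v n"] by linarith
        qed
        ultimately show ?thesis by linarith
      qed
      then have "bounded (range v)" by (auto simp: bounded_iff)
      then obtain m r where r: "strict_mono r" "(v \<circ> r) \<longlonglongrightarrow> m"
        using bounded_imp_convergent_subsequence by blast
      have "(u \<circ> r) \<longlonglongrightarrow> l" using ul r(1) by (rule LIMSEQ_subseq_LIMSEQ)
      then have "(\<lambda>n. ((u \<circ> r) n, (v \<circ> r) n)) \<longlonglongrightarrow> (l, m)" using r(2) by (rule tendsto_Pair)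
      moreover have "closed T" using cl clA closedin_closed_trans by blast
      ultimately have "(l, m) \<in> T" using v by (auto elim!: closed_sequentially)
      then show "l \<in> fst ` T" by force
    qed
    moreover have "fst ` T \<noteq> {}" using ne by simp
    ultimately show ?thesis using clopen[of "fst ` T"] by simp
  qed
  have mem: "(x0, 0) \<in> T" if op: "openin (top_of_set ?A) T" and cl: "closedin (top_of_set ?A) T"
    and ne: "T \<noteq> {}" for T
  proof -
    have "x0 \<in> fst ` T" using onto[OF that] by simp
    then obtain y where y: "(x0, y) \<in> T" by auto
    moreover have "T \<subseteq> ?A" using op openin_subset by fastforce
    ultimately have "y\<^sup>2 = 0" using root by auto
    then show ?thesis using y by simp
  qed
  show ?thesis
    unfolding connected_clopen
  proof (intro allI impI, elim conjE)
    fix T assume T: "openin (top_of_set ?A) T" "closedin (top_of_set ?A) T"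
    have "openin (top_of_set ?A) (?A - T)" "closedin (top_of_set ?A) (?A - T)"
      using T openin_diff closedin_diff openin_topspace closedin_topspace
      by (metis topspace_euclidean_subtopology)+
    then have "?A - T = {} \<or> (x0, 0) \<in> ?A - T" using mem by blast
    moreover have "T = {} \<or> (x0, 0) \<in> T" using mem T by blast
    moreover have "T \<subseteq> ?A" using T openin_subset by fastforce
    ultimately show "T = {} \<or> T = ?A" by blast
  qed
qed

section \<open>The genus 2 curve\<close>

lemma exhaust_5:
  fixes x :: 5
  shows "x = 1 \<or> x = 2 \<or> x = 3 \<or> x = 4 \<or> x = 5"
proof (induct x)
  case (of_int z)
  then have "z = 0 \<or> z = 1 \<or> z = 2 \<or> z = 3 \<or> z = 4" by fastforce
  then show ?case by auto
qed

lemma forall_5: "(\<forall>i::5. P i) \<longleftrightarrow> P 1 \<and> P 2 \<and> P 3 \<and> P 4 \<and> P 5"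
  by (metis exhaust_5)

lemma vector_5 [simp]:
  "(vector [a, b, c, d, e] :: ('a::zero) ^ 5) $ 1 = a"
  "(vector [a, b, c, d, e] :: 'a ^ 5) $ 2 = b"
  "(vector [a, b, c, d, e] :: 'a ^ 5) $ 3 = c"
  "(vector [a, b, c, d, e] :: 'a ^ 5) $ 4 = d"
  "(vector [a, b, c, d, e] :: 'a ^ 5) $ 5 = e"
  unfolding vector_def by simp_all

definition sextic :: "complex \<Rightarrow> complex" where
  "sextic x = (4 * x ^ 3 + 8 * x\<^sup>2 + 7 * x + 1) * (x ^ 3 + 7 * x\<^sup>2 + 8 * x + 4)"

text \<open>The first three equations describe the twisted cubic
  \<open>[s^3 : s^2 t : s t^2 : t^3]\<close>. The last is \<open>w^2 = s^6 P(t/s)\<close> with each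
  monomial of degree 6 written as a product of two of these cubics.\<close>

definition genus2_cone :: "(complex ^ 5) set" where
  "genus2_cone = {X. X \<noteq> 0 \<and> X $ 1 * X $ 4 = X $ 2 * X $ 3 \<and> X $ 1 * X $ 3 = (X $ 2)\<^sup>2 \<and>
     X $ 2 * X $ 4 = (X $ 3)\<^sup>2 \<and> (X $ 5)\<^sup>2 = 4 * (X $ 4)\<^sup>2 + 36 * X $ 3 * X $ 4 + 95 * (X $ 3)\<^sup>2
       + 130 * X $ 2 * X $ 3 + 95 * (X $ 2)\<^sup>2 + 36 * X $ 1 * X $ 2 + 4 * (X $ 1)\<^sup>2}"

text \<open>The sextic is palindromic, so reversing the first four coordinates is a symmetry of the curve.
  It exchanges the affine part (\<open>c = True\<close>) with a neighbourhood of infinity (\<open>c = False\<close>).\<close>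

definition genus2_point :: "bool \<Rightarrow> complex \<Rightarrow> complex \<Rightarrow> complex ^ 5" where
  "genus2_point c x y = (if c then vector [1, x, x\<^sup>2, x ^ 3, y] else vector [x ^ 3, x\<^sup>2, x, 1, y])"

text \<open>In the patch \<open>c\<close> the parameter is the quotient of the coordinates
  \<open>num c\<close> and \<open>den c\<close>: \<open>t / s\<close> on the affine part and
  \<open>s / t\<close> near infinity.\<close>

definition den :: "bool \<Rightarrow> 5" where "den c = (if c then 1 else 4)"
definition num :: "bool \<Rightarrow> 5" where "num c = (if c then 2 else 3)"

lemma genus2_point_nth [simp]:
  "genus2_point c x y $ den c = 1" "genus2_point c x y $ num c = x" "genus2_point c x y $ 5 = y"
  by (auto simp: genus2_point_def den_def num_def)

lemma genus2_point_in_cone: "y\<^sup>2 = sextic x \<Longrightarrow> genus2_point c x y \<in> genus2_cone"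
  unfolding genus2_cone_def
  by (cases c) (auto simp: genus2_point_def sextic_def vec_eq_iff forall_5 algebra_simps
      power2_eq_square power3_eq_cube)

lemma punctured_cone_genus2: "punctured_cone genus2_cone"
proof -
  have "c *s X \<in> genus2_cone" if "X \<in> genus2_cone" "c \<noteq> 0" for c X
  proof -
    have "c *s X \<noteq> 0" using that by (auto simp: genus2_cone_def)
    moreover have "(c * X $ 5)\<^sup>2 = c\<^sup>2 * (4 * (X $ 4)\<^sup>2 + 36 * X $ 3 * X $ 4 + 95 * (X $ 3)\<^sup>2
       + 130 * X $ 2 * X $ 3 + 95 * (X $ 2)\<^sup>2 + 36 * X $ 1 * X $ 2 + 4 * (X $ 1)\<^sup>2)"
      using that by (simp add: genus2_cone_def power_mult_distrib)
    moreover have "c\<^sup>2 * (X $ 1 * X $ 4) = c\<^sup>2 * (X $ 2 * X $ 3)" "c\<^sup>2 * (X $ 1 * X $ 3) = c\<^sup>2 * (X $ 2)\<^sup>2"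
      "c\<^sup>2 * (X $ 2 * X $ 4) = c\<^sup>2 * (X $ 3)\<^sup>2"
      using that by (simp_all add: genus2_cone_def)
    ultimately show ?thesis by (simp add: genus2_cone_def algebra_simps power2_eq_square)
  qed
  then show ?thesis unfolding punctured_cone_def by (auto simp: genus2_cone_def)
qed

lemma genus2_cone_eq_point:
  assumes X: "X \<in> genus2_cone" and nz: "X $ den c \<noteq> 0"
  defines "x \<equiv> X $ num c / X $ den c" and "y \<equiv> X $ 5 / X $ den c"
  shows "X = X $ den c *s genus2_point c x y" "y\<^sup>2 = sextic x"
    "proj_point (genus2_point c x y) = proj_point X"
proof -
  show eq: "X = X $ den c *s genus2_point c x y"
  proof (cases c)
    case True
    then have X1: "X $ 1 \<noteq> 0" using nz by (simp add: den_def)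
    have "X $ 3 = (X $ 2)\<^sup>2 / X $ 1" "X $ 4 = X $ 2 * X $ 3 / X $ 1"
      using X X1 by (auto simp: genus2_cone_def field_simps)
    then show ?thesis using True X1
      by (simp add: vec_eq_iff forall_5 genus2_point_def x_def y_def den_def num_def
          power2_eq_square power3_eq_cube)
  next
    case False
    then have X4: "X $ 4 \<noteq> 0" using nz by (simp add: den_def)
    have "X $ 2 = (X $ 3)\<^sup>2 / X $ 4" "X $ 1 = X $ 2 * X $ 3 / X $ 4"
      using X X4 by (auto simp: genus2_cone_def field_simps)
    then show ?thesis using False X4
      by (simp add: vec_eq_iff forall_5 genus2_point_def x_def y_def den_def num_def
          power2_eq_square power3_eq_cube)
  qed
  show "proj_point (genus2_point c x y) = proj_point X"
    using eq nz unfolding proj_point_eq_iff by blast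
  then have "genus2_point c x y \<in> genus2_cone"
    using proj_point_mem_image_cone[OF punctured_cone_genus2] X by (metis image_eqI)
  then show "y\<^sup>2 = sextic x"
    by (cases c) (auto simp: genus2_cone_def genus2_point_def sextic_def algebra_simps
        power2_eq_square power3_eq_cube)
qed

lemma genus2_cone_den_nonzero:
  assumes X: "X \<in> genus2_cone"
  shows "X $ den True \<noteq> 0 \<or> X $ den False \<noteq> 0"
proof (rule ccontr)
  assume "\<not> ?thesis"
  then have "X $ 1 = 0" "X $ 4 = 0" by (auto simp: den_def)
  moreover from this have "X $ 2 = 0" "X $ 3 = 0" using X by (auto simp: genus2_cone_def)
  moreover from calculation have "X $ 5 = 0" using X by (auto simp: genus2_cone_def)
  ultimately have "X = 0" by (simp add: vec_eq_iff forall_5)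
  then show False using X by (simp add: genus2_cone_def)
qed

lemma closedin_genus2_cone: "closedin (top_of_set (- {0})) genus2_cone"
proof -
  let ?E = "{X :: complex ^ 5. X $ 1 * X $ 4 = X $ 2 * X $ 3 \<and> X $ 1 * X $ 3 = (X $ 2)\<^sup>2 \<and>
     X $ 2 * X $ 4 = (X $ 3)\<^sup>2 \<and> (X $ 5)\<^sup>2 = 4 * (X $ 4)\<^sup>2 + 36 * X $ 3 * X $ 4 + 95 * (X $ 3)\<^sup>2
       + 130 * X $ 2 * X $ 3 + 95 * (X $ 2)\<^sup>2 + 36 * X $ 1 * X $ 2 + 4 * (X $ 1)\<^sup>2}"
  have "closed ?E"
    by (intro closed_Collect_conj closed_Collect_eq continuous_intros)
  moreover have "genus2_cone = - {0} \<inter> ?E" by (auto simp: genus2_cone_def)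
  ultimately show ?thesis by (auto simp: closedin_closed)
qed

section \<open>Charts of the genus 2 curve\<close>

lemma holomorphic_sextic: "sextic holomorphic_on S"
  unfolding sextic_def by (intro holomorphic_intros)

lemma holomorphic_on_genus2_point:
  assumes "f holomorphic_on N" "g holomorphic_on N"
  shows "(\<lambda>t. genus2_point c (f t) (g t) $ j) holomorphic_on N"
  using exhaust_5[of j] assms
  by (cases c) (auto simp: genus2_point_def intro!: holomorphic_intros)

lemma open_chart_domain:
  assumes N: "open N"
  shows "open {X :: complex ^ 'n. X $ i \<noteq> 0 \<and> X $ j / X $ i \<in> N}"
    and "open {X :: complex ^ 'n. X $ i \<noteq> 0 \<and> X $ j / X $ i \<in> N \<and> 0 < Re (X $ k / X $ i / r)}"
proof -
  have o: "open {X :: complex ^ 'n. X $ i \<noteq> 0}" by (intro open_Collect_neq continuous_intros)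
  have 1: "open ({X :: complex ^ 'n. X $ i \<noteq> 0} \<inter> (\<lambda>X. X $ j / X $ i) -` N)" if "open N" for N j
    using that by (intro continuous_open_preimage o continuous_intros) auto
  from 1[OF N, of j] show "open {X :: complex ^ 'n. X $ i \<noteq> 0 \<and> X $ j / X $ i \<in> N}"
    by (simp add: vimage_def Int_def)
  have "open ((\<lambda>z. z / r) -` {z. 0 < Re z})"
    by (rule open_vimage) (auto intro: open_halfspace_Re_gt continuous_intros simp: divide_inverse)
  from open_Int[OF 1[OF N, of j] 1[OF this, of k]]
  show "open {X :: complex ^ 'n. X $ i \<noteq> 0 \<and> X $ j / X $ i \<in> N \<and> 0 < Re (X $ k / X $ i / r)}"
    by (rule back_subst[of "open"]) auto
qed

text \<open>Where the sextic does not vanish, \<open>x\<close> is a local parameter and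
  \<open>y\<close> is the branch of the root singled out by a half plane.\<close>

lemma genus2_chart_unramified:
  assumes X: "X \<in> genus2_cone" and nz: "X $ den c \<noteq> 0" "X $ 5 \<noteq> 0"
  shows "\<exists>U \<phi>. (U, \<phi>) \<in> atlas (projective_curve (proj_point ` genus2_cone)) \<and> proj_point X \<in> U"
proof -
  define x0 where "x0 = X $ num c / X $ den c"
  define y0 where "y0 = X $ 5 / X $ den c"
  have "sextic x0 = y0\<^sup>2" "y0 \<noteq> 0"
    using genus2_cone_eq_point(2)[OF X nz(1)] nz by (auto simp: x0_def y0_def)
  then obtain N s where N: "open N" "x0 \<in> N" "s holomorphic_on N"
    and s: "\<And>t. t \<in> N \<Longrightarrow> (s t)\<^sup>2 = sextic t" "\<And>t. t \<in> N \<Longrightarrow> 0 < Re (s t / y0)"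
    using local_sqrt[OF open_UNIV UNIV_I holomorphic_sextic] by metis
  define W where "W = {Y :: complex ^ 5. Y $ den c \<noteq> 0 \<and> Y $ num c / Y $ den c \<in> N \<and>
      0 < Re (Y $ 5 / Y $ den c / y0)}"
  let ?a = "axis (num c) 1" and ?b = "axis (den c) 1"
  have "(proj_point ` genus2_cone \<inter> proj_point ` W, on_rep (\<lambda>x. lin_form ?a x / lin_form ?b x))
      \<in> atlas (projective_curve (proj_point ` genus2_cone))"
  proof (rule parametrization_in_atlas[where M = N and \<gamma> = "\<lambda>t. genus2_point c t (s t)"])
    show "open W" unfolding W_def by (rule open_chart_domain(2)[OF N(1)])
    show "punctured_cone W" by (auto simp: punctured_cone_def W_def)
    show "lin_form ?b x \<noteq> 0" if "x \<in> W" for x using that by (simp add: W_def)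
    show "open N" by (rule N)
    show "(\<lambda>t. genus2_point c t (s t) $ j) holomorphic_on N" for j
      by (intro holomorphic_on_genus2_point N holomorphic_intros)
    fix t assume t: "t \<in> N"
    show "genus2_point c t (s t) \<in> W" using t s by (simp add: W_def)
    show "proj_point (genus2_point c t (s t)) \<in> proj_point ` genus2_cone"
      using t s by (intro imageI genus2_point_in_cone)
    show "lin_form ?b (genus2_point c t (s t)) = 1" "lin_form ?a (genus2_point c t (s t)) = t" by simp_all
  next
    fix Y assume Y: "Y \<in> W" "proj_point Y \<in> proj_point ` genus2_cone"
    then have Y': "Y \<in> genus2_cone" using proj_point_mem_image_cone[OF punctured_cone_genus2] by blast
    let ?x = "Y $ num c / Y $ den c" and ?y = "Y $ 5 / Y $ den c"
    have YW: "Y $ den c \<noteq> 0" "?x \<in> N" "0 < Re (?y / y0)" using Y by (auto simp: W_def)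
    then show "lin_form ?a Y / lin_form ?b Y \<in> N" by simp
    have "s ?x = ?y"
      by (rule sqrt_unique_halfplane[of _ _ y0])
        (use s[OF YW(2)] YW(3) genus2_cone_eq_point(2)[OF Y' YW(1)] in auto)
    then show "proj_point (genus2_point c (lin_form ?a Y / lin_form ?b Y) (s (lin_form ?a Y / lin_form ?b Y)))
        = proj_point Y"
      using genus2_cone_eq_point(3)[OF Y' YW(1)] by simp
  qed
  moreover have "X \<in> W" using nz N \<open>y0 \<noteq> 0\<close> by (auto simp: W_def x0_def y0_def)
  ultimately show ?thesis using X by blast
qed

lemma sextic_simple_roots:
  assumes "sextic x = 0"
  shows "(sextic has_field_derivative deriv sextic x) (at x)" "deriv sextic x \<noteq> 0"
proof -
  let ?d = "24 * x ^ 5 + 180 * x ^ 4 + 380 * x ^ 3 + 390 * x\<^sup>2 + 190 * x + 36"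
  have eq: "sextic = (\<lambda>x. 4 * x ^ 6 + 36 * x ^ 5 + 95 * x ^ 4 + 130 * x ^ 3 + 95 * x\<^sup>2 + 36 * x + 4)"
    by (rule ext) (simp add: sextic_def algebra_simps power2_eq_square power_numeral_reduce)
  have D: "(sextic has_field_derivative ?d) (at x)"
    unfolding eq by (rule derivative_eq_intros refl | simp)+
  then have d: "deriv sextic x = ?d" by (rule DERIV_imp_deriv)
  then show "(sextic has_field_derivative deriv sextic x) (at x)" using D by simp
  \<comment> \<open>Bezout coefficients of the sextic and its derivative\<close>
  have "(712 + 17542 * x + 33152 * x\<^sup>2 + 21612 * x ^ 3 + 3192 * x ^ 4) * sextic x
      + (32 - 2830 * x - 8515 * x\<^sup>2 - 9155 * x ^ 3 - 4400 * x ^ 4 - 532 * x ^ 5) * ?d = 4000"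
    unfolding eq by (simp add: algebra_simps power2_eq_square power_numeral_reduce)
  then show "deriv sextic x \<noteq> 0" using assms d by auto
qed

text \<open>At a root of the sextic \<open>y\<close> is the local parameter: the root is simple, so
  the sextic is locally invertible and \<open>x\<close> is a holomorphic function of
  \<open>y\<^sup>2\<close>.\<close>

lemma genus2_chart_ramified:
  assumes X: "X \<in> genus2_cone" and nz: "X $ den c \<noteq> 0" "X $ 5 = 0"
  shows "\<exists>U \<phi>. (U, \<phi>) \<in> atlas (projective_curve (proj_point ` genus2_cone)) \<and> proj_point X \<in> U"
proof -
  define x0 where "x0 = X $ num c / X $ den c"
  have "sextic x0 = 0"
    using genus2_cone_eq_point(2)[OF X nz(1)] nz by (simp add: x0_def)
  from sextic_simple_roots[OF this] obtain r where r: "r > 0" "inj_on sextic (ball x0 r)" "open (sextic ` ball x0 r)"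
    using has_complex_derivative_locally_invertible[OF holomorphic_sextic UNIV_I open_UNIV] by metis
  obtain g where g: "g holomorphic_on sextic ` ball x0 r" "\<And>z. z \<in> ball x0 r \<Longrightarrow> g (sextic z) = z"
    using holomorphic_inverse_exists[OF holomorphic_sextic open_ball r(2)] by blast
  define M where "M = (\<lambda>t. t\<^sup>2) -` (sextic ` ball x0 r)"
  have oM: "open M" unfolding M_def by (intro open_vimage r continuous_intros)
  have gM: "g (t\<^sup>2) \<in> ball x0 r" "t\<^sup>2 = sextic (g (t\<^sup>2))" if "t \<in> M" for t
    using that g(2) by (auto simp: M_def)
  define W where "W = {Y :: complex ^ 5. Y $ den c \<noteq> 0 \<and> Y $ num c / Y $ den c \<in> ball x0 r}"
  let ?a = "axis 5 1" and ?b = "axis (den c) 1" and ?\<gamma> = "\<lambda>t. genus2_point c (g (t\<^sup>2)) t"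
  have "(proj_point ` genus2_cone \<inter> proj_point ` W, on_rep (\<lambda>x. lin_form ?a x / lin_form ?b x))
      \<in> atlas (projective_curve (proj_point ` genus2_cone))"
  proof (rule parametrization_in_atlas[where M = M and \<gamma> = ?\<gamma>])
    show "open W" unfolding W_def by (rule open_chart_domain(1)) simp
    show "punctured_cone W" by (auto simp: punctured_cone_def W_def)
    show "lin_form ?b x \<noteq> 0" if "x \<in> W" for x using that by (simp add: W_def)
    show "open M" by (rule oM)
    have "(\<lambda>t. g (t\<^sup>2)) holomorphic_on M"
    proof -
      have "(\<lambda>t. t\<^sup>2) holomorphic_on M" by (intro holomorphic_intros)
      from holomorphic_on_compose_gen[OF this g(1)] show ?thesis by (auto simp: o_def M_def)
    qed
    then show "(\<lambda>t. ?\<gamma> t $ j) holomorphic_on M" for j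
      by (intro holomorphic_on_genus2_point holomorphic_intros)
    fix t assume t: "t \<in> M"
    show "?\<gamma> t \<in> W" using gM(1)[OF t] by (simp add: W_def)
    show "proj_point (?\<gamma> t) \<in> proj_point ` genus2_cone"
      using gM(2)[OF t] by (intro imageI genus2_point_in_cone)
    show "lin_form ?b (?\<gamma> t) = 1" "lin_form ?a (?\<gamma> t) = t" by simp_all
  next
    fix Y assume Y: "Y \<in> W" "proj_point Y \<in> proj_point ` genus2_cone"
    then have Y': "Y \<in> genus2_cone" using proj_point_mem_image_cone[OF punctured_cone_genus2] by blast
    let ?x = "Y $ num c / Y $ den c" and ?y = "Y $ 5 / Y $ den c"
    have YW: "Y $ den c \<noteq> 0" "?x \<in> ball x0 r" using Y by (auto simp: W_def)
    note y = genus2_cone_eq_point(2)[OF Y' YW(1)]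
    show "lin_form ?a Y / lin_form ?b Y \<in> M" using y YW(2) unfolding M_def by simp
    have "g (?y\<^sup>2) = ?x" using g(2)[OF YW(2)] y by simp
    then show "proj_point (?\<gamma> (lin_form ?a Y / lin_form ?b Y)) = proj_point Y"
      using genus2_cone_eq_point(3)[OF Y' YW(1)] by simp
  qed
  moreover have "X \<in> W" using nz r by (auto simp: W_def x0_def)
  ultimately show ?thesis using X by blast
qed

section \<open>Projective closure and connectedness of the genus 2 curve\<close>

lemma sextic_root: "\<exists>x. sextic x = 0"
proof -
  let ?p = "\<lambda>x::real. 4 * x ^ 3 + 8 * x\<^sup>2 + 7 * x + 1"
  \<comment> \<open>This cubic factor takes the values -2 at -1 and 1 at 0. Its root is the branch
    point used for connectedness.\<close>
  have "\<exists>x\<ge>-1. x \<le> 0 \<and> ?p x = 0"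
    by (rule IVT') (auto intro!: continuous_intros)
  then obtain x where "?p x = 0" by blast
  then have "4 * complex_of_real x ^ 3 + 8 * (complex_of_real x)\<^sup>2 + 7 * complex_of_real x + 1 = 0"
    by (metis (mono_tags, opaque_lifting) of_real_0 of_real_1 of_real_add of_real_mult of_real_numeral of_real_power)
  then show ?thesis by (intro exI[of _ "complex_of_real x"]) (simp add: sextic_def)
qed

definition genus2_affine :: "(complex ^ 5) set set" where
  "genus2_affine = {proj_point (vector [1, x, x\<^sup>2, x ^ 3, y]) | x y. y\<^sup>2 = sextic x}"

lemma genus2_affine_eq: "genus2_affine = proj_point ` {X \<in> genus2_cone. X $ 1 \<noteq> 0}"
proof (intro equalityI subsetI)
  fix p assume "p \<in> genus2_affine"
  then obtain x y where "y\<^sup>2 = sextic x" "p = proj_point (genus2_point True x y)"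
    by (auto simp: genus2_affine_def genus2_point_def)
  moreover have "genus2_point True x y $ 1 \<noteq> 0" by (simp add: genus2_point_def)
  ultimately show "p \<in> proj_point ` {X \<in> genus2_cone. X $ 1 \<noteq> 0}"
    using genus2_point_in_cone by blast
next
  fix p assume "p \<in> proj_point ` {X \<in> genus2_cone. X $ 1 \<noteq> 0}"
  then obtain X where X: "X \<in> genus2_cone" "X $ den True \<noteq> 0" "p = proj_point X"
    by (auto simp: den_def)
  from genus2_cone_eq_point(2,3)[OF X(1,2)] X(3) show "p \<in> genus2_affine"
    unfolding genus2_affine_def genus2_point_def by auto
qed

lemma genus2_affine_closure: "(proj_topology closure_of genus2_affine) = proj_point ` genus2_cone"
proof (rule equalityI)
  show "(proj_topology closure_of genus2_affine) \<subseteq> proj_point ` genus2_cone"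
    by (intro closure_of_minimal closedin_proj_point_cone punctured_cone_genus2 closedin_genus2_cone)
      (auto simp: genus2_affine_eq)
  show "proj_point ` genus2_cone \<subseteq> proj_topology closure_of genus2_affine"
  proof
    fix p assume "p \<in> proj_point ` genus2_cone"
    then obtain X where X: "X \<in> genus2_cone" "p = proj_point X" by auto
    have "genus2_affine \<subseteq> topspace proj_topology"
      unfolding genus2_affine_eq topspace_proj_topology by (intro image_mono) auto
    then have sub: "genus2_affine \<subseteq> proj_topology closure_of genus2_affine"
      by (rule closure_of_subset)
    show "p \<in> proj_topology closure_of genus2_affine"
    proof (cases "X $ 1 = 0")
      case False
      then show ?thesis using X sub by (auto simp: genus2_affine_eq)
    next
      case True
      then have X4: "X $ den False \<noteq> 0" using genus2_cone_den_nonzero[OF X(1)] by (simp add: den_def)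
      \<comment> \<open>At infinity the parameter is 0 and \<open>w\<^sup>2 = 4\<close>, so a local
        branch of the root gives an arc through the point all of whose other points are
        affine.\<close>
      define w where "w = X $ 5 / X $ den False"
      have "X $ 3 = 0" using True X(1) by (auto simp: genus2_cone_def)
      then have w: "w\<^sup>2 = sextic 0" and pw: "p = proj_point (genus2_point False 0 w)"
        using genus2_cone_eq_point(2,3)[OF X(1) X4] X(2) by (auto simp: w_def num_def)
      then have "w \<noteq> 0" by (auto simp: sextic_def)
      then obtain N s where N: "open N" "0 \<in> N" "s holomorphic_on N" "s 0 = w"
        and s: "\<And>t. t \<in> N \<Longrightarrow> (s t)\<^sup>2 = sextic t"
        using local_sqrt[OF open_UNIV UNIV_I holomorphic_sextic w[symmetric]] by metis
      let ?h = "\<lambda>t. proj_point (genus2_point False t (s t))"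
      have "continuous_on N (\<lambda>t. \<chi> j. genus2_point False t (s t) $ j)"
        by (intro continuous_on_vec_lambda holomorphic_on_imp_continuous_on holomorphic_on_genus2_point
            N holomorphic_intros)
      moreover have "genus2_point False t (s t) \<noteq> 0" for t
        by (metis genus2_point_nth(1) zero_index zero_neq_one)
      ultimately have "continuous_map (top_of_set N) proj_topology ?h"
        by (intro continuous_map_proj_point_comp) auto
      from continuous_map_image_closure_subset[OF this, of "N - {0}"]
      have "?h ` (top_of_set N closure_of (N - {0})) \<subseteq> proj_topology closure_of (?h ` (N - {0}))" .
      moreover have "0 \<in> top_of_set N closure_of (N - {0})"
      proof -
        have "0 islimpt N" using N by (simp add: interior_limit_point interior_open)
        then have "0 \<in> closure (N - {0})" by (simp add: islimpt_in_closure)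
        then show ?thesis using N by (simp add: closure_of_subtopology Int_absorb1)
      qed
      moreover have "?h ` (N - {0}) \<subseteq> genus2_affine"
      proof (rule image_subsetI)
        fix t assume "t \<in> N - {0}"
        then have t: "t \<in> N" "t \<noteq> 0" by auto
        have "genus2_point False t (s t) $ 1 \<noteq> 0" using t by (simp add: genus2_point_def)
        then show "?h t \<in> genus2_affine" unfolding genus2_affine_eq
          using genus2_point_in_cone[OF s[OF t(1)], of False] by (intro imageI CollectI conjI)
      qed
      ultimately have "?h 0 \<in> proj_topology closure_of genus2_affine"
        using closure_of_mono[of "?h ` (N - {0})" genus2_affine] by (meson imageI subsetD)
      then show ?thesis using pw N by simp
    qed
  qed
qed

text \<open>The affine part is a continuous image of a connected double cover, and closures of
  connected sets are connected.\<close>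

lemma connectedin_genus2: "connectedin proj_topology (proj_point ` genus2_cone)"
proof -
  let ?A = "{(x, y). y\<^sup>2 = sextic x}" and ?v = "\<lambda>(x, y). vector [1, x, x\<^sup>2, x ^ 3, y] :: complex ^ 5"
  obtain x0 where "sextic x0 = 0" using sextic_root by blast
  then have "connected ?A"
    by (rule connected_double_cover[OF holomorphic_on_imp_continuous_on[OF holomorphic_sextic]])
  moreover have "continuous_map euclidean proj_topology (\<lambda>z. proj_point (?v z))"
  proof (rule continuous_map_proj_point_comp)
    have "continuous_on UNIV (\<lambda>z. ?v z $ j)" for j
      using exhaust_5[of j] by (elim disjE; simp add: case_prod_unfold; (intro continuous_intros)?)
    then have "continuous_on UNIV (\<lambda>z. \<chi> j. ?v z $ j)" by (intro continuous_on_vec_lambda)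
    then show "continuous_map euclidean euclidean ?v" by simp
    show "?v z \<noteq> 0" for z
    proof
      assume "?v z = 0"
      then have "?v z $ 1 = 0" by simp
      then show False by (simp add: case_prod_unfold)
    qed
  qed
  ultimately have "connectedin proj_topology ((\<lambda>z. proj_point (?v z)) ` ?A)"
    by (intro connectedin_continuous_map_image) auto
  moreover have "(\<lambda>z. proj_point (?v z)) ` ?A = genus2_affine"
    by (auto simp: genus2_affine_def image_iff) blast
  ultimately show ?thesis using connectedin_closure_of genus2_affine_closure by metis
qed

lemma riemann_surface_genus2: "riemann_surface (projective_curve (proj_point ` genus2_cone))"
proof (rule riemann_surface_projective_curve[OF connectedin_genus2])
  fix p assume "p \<in> proj_point ` genus2_cone"
  then obtain X where X: "X \<in> genus2_cone" "p = proj_point X" by auto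
  obtain c where "X $ den c \<noteq> 0" using genus2_cone_den_nonzero[OF X(1)] by blast
  then show "\<exists>U \<phi>. (U, \<phi>) \<in> atlas (projective_curve (proj_point ` genus2_cone)) \<and> p \<in> U"
    using X genus2_chart_ramified genus2_chart_unramified by metis
qed

section \<open>Bring's curve\<close>

definition bring_cone :: "(complex ^ 5) set" where
  "bring_cone = {x. x \<noteq> 0 \<and> (\<Sum>n\<in>UNIV. x $ n) = 0 \<and> (\<Sum>n\<in>UNIV. (x $ n)\<^sup>2) = 0 \<and>
     (\<Sum>n\<in>UNIV. (x $ n) ^ 3) = 0}"

lemma bring_curve_eq: "bring_curve = projective_curve (proj_point ` bring_cone)"
  unfolding bring_curve_def bring_cone_def by (rule arg_cong[of _ _ projective_curve]) auto

lemma punctured_cone_bring: "punctured_cone bring_cone"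
  by (auto simp: punctured_cone_def bring_cone_def power_mult_distrib sum_distrib_left[symmetric])

lemma closedin_bring_cone: "closedin (top_of_set (- {0})) bring_cone"
proof -
  have "closed {x :: complex ^ 5. (\<Sum>n\<in>UNIV. x $ n) = 0 \<and> (\<Sum>n\<in>UNIV. (x $ n)\<^sup>2) = 0 \<and> (\<Sum>n\<in>UNIV. (x $ n) ^ 3) = 0}"
    (is "closed ?E")
    by (intro closed_Collect_conj closed_Collect_eq continuous_intros)
  moreover have "bring_cone = - {0} \<inter> ?E" by (auto simp: bring_cone_def)
  ultimately show ?thesis by (auto simp: closedin_closed)
qed

lemma bring_cone_subset: "proj_point ` bring_cone \<subseteq> topspace proj_topology"
  by (auto simp: topspace_proj_topology bring_cone_def)

lemma topspace_bring: "topspace (space_of bring_curve) = proj_point ` bring_cone"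
  using bring_cone_subset by (auto simp: bring_curve_eq space_of_projective_curve)

text \<open>Every line in the cone meets the unit sphere, so the curve is a continuous image of a
  compact set. Compactness later turns the map to the genus 2 curve into a quotient map.\<close>

lemma compact_space_bring: "compact_space (space_of bring_curve)"
proof -
  have nz: "x \<noteq> 0" if "x \<in> sphere 0 (1::real)" for x :: "complex ^ 5" using that by auto
  obtain E where E: "closed E" "bring_cone = - {0} \<inter> E"
    using closedin_bring_cone by (auto simp: closedin_closed)
  have "bring_cone \<inter> sphere 0 1 = E \<inter> sphere 0 1" using E nz by auto
  then have "compact (bring_cone \<inter> sphere 0 1)" using E by (simp add: closed_Int_compact)
  then have "compactin (top_of_set (- {0})) (bring_cone \<inter> sphere 0 1)"
    using nz by (auto simp: compactin_subtopology)
  then have c: "compactin proj_topology (proj_point ` (bring_cone \<inter> sphere 0 1))"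
    using continuous_map_proj_point by (rule image_compactin)
  have "proj_point ` bring_cone = proj_point ` (bring_cone \<inter> sphere 0 1)"
  proof (intro equalityI subsetI)
    fix p assume "p \<in> proj_point ` bring_cone"
    then obtain x where x: "x \<in> bring_cone" "p = proj_point x" by auto
    then have n: "norm x \<noteq> 0" by (auto simp: bring_cone_def)
    define c where "c = complex_of_real (1 / norm x)"
    have c: "c \<noteq> 0" using n by (simp add: c_def)
    then have "c *s x \<in> bring_cone" using x punctured_cone_bring by (auto simp: punctured_cone_def)
    moreover have "c *s x = (1 / norm x) *\<^sub>R x" by (simp add: vec_eq_iff c_def scaleR_conv_of_real[where 'a = complex])
    then have "norm (c *s x) = 1" using n by simp
    moreover have "p = proj_point (c *s x)" using x c by (auto simp: proj_point_eq_iff)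
    ultimately show "p \<in> proj_point ` (bring_cone \<inter> sphere 0 1)" by auto
  qed auto
  then show ?thesis using c by (simp add: bring_curve_eq space_of_projective_curve compact_space_subtopology)
qed

text \<open>The five indices stay arbitrary, with \<open>e\<close> fixed and the pairs
  \<open>i, j\<close> and \<open>k, l\<close> exchanged, so every subgroup of order 2 is treated
  directly and no conjugation enters.\<close>

locale double_transposition =
  fixes e i j k l :: 5
  assumes distinct: "distinct [e, i, j, k, l]"
begin

lemma UNIV_eq: "UNIV = {e, i, j, k, l}"
proof -
  have "card {e, i, j, k, l} = CARD(5)" using distinct by simp
  then show ?thesis by (metis card_subset_eq finite subset_UNIV)
qed

lemma index_cases: "n = e \<or> n = i \<or> n = j \<or> n = k \<or> n = l"
  using UNIV_eq by blast

lemma sum_UNIV_eq: "(\<Sum>n\<in>UNIV. f n) = f e + f i + f j + f k + f l" for f :: "5 \<Rightarrow> complex"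
  unfolding UNIV_eq using distinct by (simp add: algebra_simps)

lemma vec_eqI: "x = y" if "x $ e = y $ e" "x $ i = y $ i" "x $ j = y $ j" "x $ k = y $ k" "x $ l = y $ l"
  for x y :: "complex ^ 5"
proof -
  have "x $ n = y $ n" for n using index_cases[of n] that by auto
  then show ?thesis by (simp add: vec_eq_iff)
qed

section \<open>Invariants of the involution and the equations of Bring's curve\<close>

definition tr1 :: "complex ^ 5 \<Rightarrow> complex" where "tr1 x = x $ i + x $ j"
definition tr2 :: "complex ^ 5 \<Rightarrow> complex" where "tr2 x = x $ k + x $ l"
definition pr1 :: "complex ^ 5 \<Rightarrow> complex" where "pr1 x = x $ i * x $ j"
text \<open>Each factor changes sign under the involution, the product does not; its square is the
  product of the discriminants of the two pairs.\<close>

definition disc :: "complex ^ 5 \<Rightarrow> complex" where "disc x = (x $ i - x $ j) * (x $ k - x $ l)"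

lemmas invariant_defs = tr1_def tr2_def pr1_def disc_def

text \<open>A pair with sum \<open>a\<close> and product \<open>p\<close> has power sums
  \<open>a\<close>, \<open>a\<^sup>2 - 2 p\<close> and \<open>a ^ 3 - 3 a p\<close>. The three
  equations then give in turn the coordinate at \<open>e\<close>, the sum of the two products, and a
  relation linear in \<open>p\<close>.\<close>

lemma bring_cone_iff: "x \<in> bring_cone \<longleftrightarrow> x \<noteq> 0 \<and> x $ e = - (tr1 x + tr2 x) \<and>
    pr1 x + x $ k * x $ l = (tr1 x)\<^sup>2 + tr1 x * tr2 x + (tr2 x)\<^sup>2 \<and>
    pr1 x * (tr1 x - tr2 x) = - tr2 x * (2 * (tr1 x)\<^sup>2 + 2 * tr1 x * tr2 x + (tr2 x)\<^sup>2)"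
proof -
  define a b p q where "a = tr1 x" and "b = tr2 x" and "p = pr1 x" and "q = x $ k * x $ l"
  have s1: "(\<Sum>n\<in>UNIV. x $ n) = x $ e + (a + b)"
    by (simp add: sum_UNIV_eq a_def b_def tr1_def tr2_def)
  have s2: "(\<Sum>n\<in>UNIV. (x $ n)\<^sup>2) = (x $ e)\<^sup>2 + (a\<^sup>2 - 2 * p) + (b\<^sup>2 - 2 * q)"
    by (simp add: sum_UNIV_eq a_def b_def p_def q_def tr1_def tr2_def pr1_def power2_eq_square algebra_simps)
  have s3: "(\<Sum>n\<in>UNIV. (x $ n) ^ 3) = (x $ e) ^ 3 + (a ^ 3 - 3 * a * p) + (b ^ 3 - 3 * b * q)"
    by (simp add: sum_UNIV_eq a_def b_def p_def q_def tr1_def tr2_def pr1_def power3_eq_cube algebra_simps)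
  have "x $ e + (a + b) = 0 \<longleftrightarrow> x $ e = - (a + b)" by (rule eq_neg_iff_add_eq_0[symmetric])
  moreover have "(x $ e)\<^sup>2 + (a\<^sup>2 - 2 * p) + (b\<^sup>2 - 2 * q) = 0 \<longleftrightarrow> p + q = a\<^sup>2 + a * b + b\<^sup>2"
    if xe: "x $ e = - (a + b)"
  proof -
    have "(x $ e)\<^sup>2 + (a\<^sup>2 - 2 * p) + (b\<^sup>2 - 2 * q) = 2 * ((a\<^sup>2 + a * b + b\<^sup>2) - (p + q))"
      by (simp add: xe power2_eq_square algebra_simps)
    then show ?thesis by (metis eq_iff_diff_eq_0 mult_eq_0_iff zero_neq_numeral)
  qed
  moreover have "(x $ e) ^ 3 + (a ^ 3 - 3 * a * p) + (b ^ 3 - 3 * b * q) = 0 \<longleftrightarrow>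
      p * (a - b) = - b * (2 * a\<^sup>2 + 2 * a * b + b\<^sup>2)"
    if xe: "x $ e = - (a + b)" and pq: "p + q = a\<^sup>2 + a * b + b\<^sup>2"
  proof -
    have q: "q = a\<^sup>2 + a * b + b\<^sup>2 - p" using pq by (simp add: algebra_simps)
    have "(x $ e) ^ 3 + (a ^ 3 - 3 * a * p) + (b ^ 3 - 3 * b * q)
        = 3 * (- b * (2 * a\<^sup>2 + 2 * a * b + b\<^sup>2) - p * (a - b))"
      by (simp add: xe q power2_eq_square power3_eq_cube algebra_simps)
    then show ?thesis by (metis (no_types, lifting) eq_iff_diff_eq_0 mult_eq_0_iff zero_neq_numeral)
  qed
  ultimately show ?thesis
    unfolding bring_cone_def s1 s2 s3 mem_Collect_eq a_def[symmetric] b_def[symmetric]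
      p_def[symmetric] q_def[symmetric] by blast
qed

lemma bring_cone_discriminants:
  assumes "x \<in> bring_cone"
  shows "(x $ i - x $ j)\<^sup>2 * (tr1 x - tr2 x) = (tr1 x) ^ 3 + 7 * (tr1 x)\<^sup>2 * tr2 x + 8 * tr1 x * (tr2 x)\<^sup>2 + 4 * (tr2 x) ^ 3"
    and "(x $ k - x $ l)\<^sup>2 * (tr1 x - tr2 x) = - (4 * (tr1 x) ^ 3 + 8 * (tr1 x)\<^sup>2 * tr2 x + 7 * tr1 x * (tr2 x)\<^sup>2 + (tr2 x) ^ 3)"
proof -
  define a b p q where "a = tr1 x" and "b = tr2 x" and "p = pr1 x" and "q = x $ k * x $ l"
  have pq: "p + q = a\<^sup>2 + a * b + b\<^sup>2" and p: "p * (a - b) = - b * (2 * a\<^sup>2 + 2 * a * b + b\<^sup>2)"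
    using assms by (simp_all add: bring_cone_iff a_def b_def p_def q_def)
  have "(x $ i - x $ j)\<^sup>2 = a\<^sup>2 - 4 * p"
    by (simp add: a_def p_def tr1_def pr1_def power2_eq_square algebra_simps)
  then have "(x $ i - x $ j)\<^sup>2 * (a - b) = (a\<^sup>2 - 4 * p) * (a - b)" by (rule arg_cong)
  also have "\<dots> = a\<^sup>2 * (a - b) - 4 * (p * (a - b))" by (simp add: algebra_simps)
  finally show "(x $ i - x $ j)\<^sup>2 * (tr1 x - tr2 x) = (tr1 x) ^ 3 + 7 * (tr1 x)\<^sup>2 * tr2 x + 8 * tr1 x * (tr2 x)\<^sup>2 + 4 * (tr2 x) ^ 3"
    unfolding p a_def[symmetric] b_def[symmetric] by (simp add: power2_eq_square power3_eq_cube algebra_simps)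
  have q: "q = a\<^sup>2 + a * b + b\<^sup>2 - p" using pq by (simp add: algebra_simps)
  have "(x $ k - x $ l)\<^sup>2 = b\<^sup>2 - 4 * q"
    by (simp add: b_def q_def tr2_def power2_eq_square algebra_simps)
  then have "(x $ k - x $ l)\<^sup>2 * (a - b) = (b\<^sup>2 - 4 * q) * (a - b)" by (rule arg_cong)
  also have "\<dots> = b\<^sup>2 * (a - b) - 4 * (a\<^sup>2 + a * b + b\<^sup>2) * (a - b) + 4 * (p * (a - b))"
    by (simp add: q algebra_simps)
  finally show "(x $ k - x $ l)\<^sup>2 * (tr1 x - tr2 x) = - (4 * (tr1 x) ^ 3 + 8 * (tr1 x)\<^sup>2 * tr2 x + 7 * tr1 x * (tr2 x)\<^sup>2 + (tr2 x) ^ 3)"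
    unfolding p a_def[symmetric] b_def[symmetric] by (simp add: power2_eq_square power3_eq_cube algebra_simps)
qed

text \<open>For equal traces the cubic relation becomes \<open>5 b ^ 3 = 0\<close>. Hence
  \<open>a - b\<close> can be cancelled wherever the traces do not both vanish.\<close>

lemma tr_eq_imp_zero:
  assumes "x \<in> bring_cone" "tr1 x = tr2 x"
  shows "tr1 x = 0 \<and> tr2 x = 0"
proof -
  have "0 = - tr2 x * (2 * (tr2 x)\<^sup>2 + 2 * tr2 x * tr2 x + (tr2 x)\<^sup>2)"
    using assms by (simp add: bring_cone_iff)
  then have "5 * (tr2 x) ^ 3 = 0" by (simp add: power2_eq_square power3_eq_cube algebra_simps)
  then show ?thesis using assms by simp
qed

text \<open>In the order \<open>e, i, j, k, l\<close> such a point is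
  \<open>[0 : 1 : -1 : v : -v]\<close> with \<open>v\<^sup>2 = - 1\<close>; the involution
  multiplies its representatives by -1.\<close>

lemma tr_zero_imp:
  assumes "x \<in> bring_cone" "tr1 x = 0" "tr2 x = 0"
  shows "x $ e = 0" "x $ j = - x $ i" "x $ l = - x $ k" "(x $ k)\<^sup>2 = - (x $ i)\<^sup>2" "x $ i \<noteq> 0" "pr1 x \<noteq> 0"
proof -
  show e: "x $ e = 0" using assms by (simp add: bring_cone_iff)
  show j: "x $ j = - x $ i" using assms(2) by (simp add: tr1_def add_eq_0_iff)
  show l: "x $ l = - x $ k" using assms(3) by (simp add: tr2_def add_eq_0_iff)
  have "pr1 x + x $ k * x $ l = 0" using assms by (simp add: bring_cone_iff)
  then show sq: "(x $ k)\<^sup>2 = - (x $ i)\<^sup>2"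
    by (simp add: pr1_def j l power2_eq_square add_eq_0_iff)
  show i: "x $ i \<noteq> 0"
  proof
    assume "x $ i = 0"
    then have "x = 0" using e j l sq by (intro vec_eqI) auto
    then show False using assms by (simp add: bring_cone_def)
  qed
  then show "pr1 x \<noteq> 0" by (simp add: pr1_def j)
qed

text \<open>Inverse to the linear coordinates \<open>a\<close>, \<open>b\<close>,
  \<open>c = x $ i - x $ j\<close> and \<open>d = x $ k - x $ l\<close> on the hyperplane where all
  coordinates sum to 0.\<close>

definition bring_point :: "complex \<Rightarrow> complex \<Rightarrow> complex \<Rightarrow> complex \<Rightarrow> complex ^ 5" where
  "bring_point a b c d = (\<chi> n. if n = e then - (a + b) else if n = i then (a + c) / 2
     else if n = j then (a - c) / 2 else if n = k then (b + d) / 2 else (b - d) / 2)"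

lemma bring_point_nth [simp]:
  "bring_point a b c d $ e = - (a + b)" "bring_point a b c d $ i = (a + c) / 2"
  "bring_point a b c d $ j = (a - c) / 2" "bring_point a b c d $ k = (b + d) / 2"
  "bring_point a b c d $ l = (b - d) / 2"
  using distinct by (auto simp: bring_point_def)

lemma bring_point_tr [simp]: "tr1 (bring_point a b c d) = a" "tr2 (bring_point a b c d) = b"
  by (simp_all add: tr1_def tr2_def field_simps)

text \<open>Converse of \<open>bring_cone_discriminants\<close>: the discriminants determine the
  products of the two pairs, and the defining relations follow after cancelling
  \<open>a - b\<close>.\<close>

lemma bring_point_in_cone:
  assumes "a \<noteq> b" and c: "c\<^sup>2 * (a - b) = a ^ 3 + 7 * a\<^sup>2 * b + 8 * a * b\<^sup>2 + 4 * b ^ 3"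
    and d: "d\<^sup>2 * (a - b) = - (4 * a ^ 3 + 8 * a\<^sup>2 * b + 7 * a * b\<^sup>2 + b ^ 3)"
  shows "bring_point a b c d \<in> bring_cone"
proof -
  let ?x = "bring_point a b c d"
  have "?x \<noteq> 0"
  proof
    assume "?x = 0"
    then have "tr1 ?x = tr2 ?x" by (simp add: tr1_def tr2_def del: bring_point_nth)
    then show False using assms(1) by simp
  qed
  moreover have p: "4 * pr1 ?x = a\<^sup>2 - c\<^sup>2" and q: "4 * (?x $ k * ?x $ l) = b\<^sup>2 - d\<^sup>2"
    by (simp_all add: pr1_def field_simps power2_eq_square)
  define S where "S = pr1 ?x + ?x $ k * ?x $ l"
  have "(4 * S) * (a - b) = (4 * (a\<^sup>2 + a * b + b\<^sup>2)) * (a - b)"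
  proof -
    have "(4 * S) * (a - b) = (a\<^sup>2 + b\<^sup>2) * (a - b) - c\<^sup>2 * (a - b) - d\<^sup>2 * (a - b)"
      unfolding S_def distrib_left p q by (simp add: algebra_simps)
    then show ?thesis unfolding c d by (simp add: power2_eq_square power3_eq_cube algebra_simps)
  qed
  then have "S = a\<^sup>2 + a * b + b\<^sup>2"
    using assms(1) by (metis mult_cancel_left mult_cancel_right right_minus_eq zero_neq_numeral)
  moreover have "4 * (pr1 ?x * (a - b)) = 4 * (- b * (2 * a\<^sup>2 + 2 * a * b + b\<^sup>2))"
  proof -
    have "4 * (pr1 ?x * (a - b)) = a\<^sup>2 * (a - b) - c\<^sup>2 * (a - b)"
      unfolding mult.assoc[symmetric] p by (simp add: algebra_simps)
    then show ?thesis unfolding c by (simp add: power2_eq_square power3_eq_cube algebra_simps)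
  qed
  then have "pr1 ?x * (a - b) = - b * (2 * a\<^sup>2 + 2 * a * b + b\<^sup>2)"
    by (metis (no_types) mult_cancel_left zero_neq_numeral)
  ultimately show ?thesis unfolding bring_cone_iff bring_point_tr S_def
    by (simp del: bring_point_nth add: bring_point_nth(1))
qed

lemma eq_bring_point:
  assumes "x \<in> bring_cone"
  shows "x = bring_point (tr1 x) (tr2 x) (x $ i - x $ j) (x $ k - x $ l)"
  by (rule vec_eqI) (use assms in \<open>simp_all add: bring_cone_iff\<close>, simp_all add: tr1_def tr2_def)

text \<open>The map to the genus 2 curve is given by \<^term>\<open>lift1\<close> away from the two fixed points of the
  involution, where both traces vanish, and by \<^term>\<open>lift2\<close> near them. Writing \<open>a, b, p\<close> for the
  traces and \<open>pr1\<close>, the relation \<open>p (a - b) = - b (2 a\<^sup>2 + 2 a b + b\<^sup>2)\<close> says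
  that \<open>a / b = r / p\<close> for \<open>r = p - (2 a\<^sup>2 + 2 a b + b\<^sup>2)\<close>, and this extends \<open>a / b\<close> across the fixed points.\<close>

definition lift1 :: "complex ^ 5 \<Rightarrow> complex ^ 5" where
  "lift1 x = vector [(tr2 x) ^ 3, (tr2 x)\<^sup>2 * tr1 x, tr2 x * (tr1 x)\<^sup>2, (tr1 x) ^ 3,
     \<i> * disc x * (tr1 x - tr2 x)]"

definition rest :: "complex ^ 5 \<Rightarrow> complex" where
  "rest x = pr1 x - (2 * (tr1 x)\<^sup>2 + 2 * tr1 x * tr2 x + (tr2 x)\<^sup>2)"

definition lift2 :: "complex ^ 5 \<Rightarrow> complex ^ 5" where
  "lift2 x = vector [(pr1 x) ^ 3, (pr1 x)\<^sup>2 * rest x, pr1 x * (rest x)\<^sup>2, (rest x) ^ 3,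
     - \<i> * disc x * (2 * (rest x)\<^sup>2 + 2 * rest x * pr1 x + (pr1 x)\<^sup>2)]"

text \<open>With \<open>s = b\<close> and \<open>t = a\<close> the first four coordinates trace the
  twisted cubic. The factor \<open>\<i>\<close> cancels the minus sign of the second discriminant,
  so the square of the last coordinate is the product of the two cubic forms.\<close>

lemma lift1_in_cone:
  assumes x: "x \<in> bring_cone" and nz: "tr1 x \<noteq> 0 \<or> tr2 x \<noteq> 0"
  shows "lift1 x \<in> genus2_cone"
proof -
  define a b where "a = tr1 x" and "b = tr2 x"
  have "lift1 x \<noteq> 0"
    using nz by (auto simp: lift1_def vec_eq_iff forall_5)
  moreover have "(\<i> * disc x * (a - b))\<^sup>2 = - ((x $ i - x $ j)\<^sup>2 * (a - b)) * ((x $ k - x $ l)\<^sup>2 * (a - b))"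
  proof -
    have "(\<i> * (s * t) * w)\<^sup>2 = - (s\<^sup>2 * w) * (t\<^sup>2 * w)" for s t w :: complex
      by (simp add: power_mult_distrib) (simp add: power2_eq_square)
    then show ?thesis unfolding disc_def .
  qed
  then have "(\<i> * disc x * (a - b))\<^sup>2 = (a ^ 3 + 7 * a\<^sup>2 * b + 8 * a * b\<^sup>2 + 4 * b ^ 3) *
      (4 * a ^ 3 + 8 * a\<^sup>2 * b + 7 * a * b\<^sup>2 + b ^ 3)"
    unfolding a_def b_def bring_cone_discriminants[OF x] by (simp only: minus_mult_minus)
  ultimately show ?thesis
    unfolding genus2_cone_def
    by (simp add: lift1_def a_def[symmetric] b_def[symmetric])
      (simp add: power2_eq_square power3_eq_cube power_numeral_reduce algebra_simps)
qed

lemma tr2_rest: "x \<in> bring_cone \<Longrightarrow> tr2 x * rest x = tr1 x * pr1 x"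
  by (simp add: bring_cone_iff rest_def algebra_simps)

text \<open>The factor \<open>h = pr1 x / tr2 x\<close> turns \<open>b, a\<close> into
  \<open>pr1 x, rest x\<close> and satisfies
  \<open>h * (a - b) = - (2 a\<^sup>2 + 2 a b + b\<^sup>2)\<close>. In the last coordinate one of
  the three factors \<open>h\<close> absorbs \<open>a - b\<close>, which is the origin of the
  quadratic form in \<open>lift2\<close>.\<close>

lemma lift2_eq_lift1:
  assumes x: "x \<in> bring_cone" and b: "tr2 x \<noteq> 0"
  shows "lift2 x = (pr1 x / tr2 x) ^ 3 *s lift1 x"
proof -
  define a b h where "a = tr1 x" and "b = tr2 x" and "h = pr1 x / tr2 x"
  have p: "pr1 x = b * h" using b by (simp add: b_def h_def)
  have r: "rest x = a * h" using tr2_rest[OF x] b by (simp add: a_def h_def field_simps)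
  have "pr1 x * (a - b) = - b * (2 * a\<^sup>2 + 2 * a * b + b\<^sup>2)"
    using x by (simp add: bring_cone_iff a_def b_def)
  then have "b * (h * (a - b)) = b * (- (2 * a\<^sup>2 + 2 * a * b + b\<^sup>2))" unfolding p by (simp add: algebra_simps)
  then have h: "h * (a - b) = - (2 * a\<^sup>2 + 2 * a * b + b\<^sup>2)" using b unfolding b_def by (metis mult_left_cancel)
  have "- \<i> * disc x * (2 * (a * h)\<^sup>2 + 2 * (a * h) * (b * h) + (b * h)\<^sup>2)
      = \<i> * disc x * h\<^sup>2 * (- (2 * a\<^sup>2 + 2 * a * b + b\<^sup>2))"
    by (simp add: algebra_simps power2_eq_square)
  also have "\<dots> = h ^ 3 * (\<i> * disc x * (a - b))"
    unfolding h[symmetric] by (simp add: power2_eq_square power3_eq_cube)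
  finally have "lift2 x $ 5 = (h ^ 3 *s lift1 x) $ 5"
    by (simp add: lift1_def lift2_def p r a_def b_def)
  then show ?thesis
    unfolding h_def[symmetric] vec_eq_iff forall_5
    by (simp add: lift1_def lift2_def p r a_def[symmetric] b_def[symmetric])
      (simp add: power2_eq_square power3_eq_cube)
qed

lemma proj_point_lift2:
  assumes x: "x \<in> bring_cone" and p: "pr1 x \<noteq> 0" and nz: "tr1 x \<noteq> 0 \<or> tr2 x \<noteq> 0"
  shows "proj_point (lift2 x) = proj_point (lift1 x)"
proof -
  have b: "tr2 x \<noteq> 0" using tr2_rest[OF x] p nz by auto
  have "proj_point (lift1 x) = proj_point (lift2 x)"
    unfolding proj_point_eq_iff using lift2_eq_lift1[OF x b] p b
    by (intro exI[of _ "(pr1 x / tr2 x) ^ 3"]) simp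
  then show ?thesis by simp
qed

text \<open>Here \<open>rest x = pr1 x\<close>, so \<open>a / b\<close> extends by the value 1. Both
  cubic factors of the sextic equal 20 at 1, whence the constant; the two choices of
  \<open>x $ k / x $ i\<close> give the two points over 1.\<close>

lemma lift2_at_fixed_point:
  assumes x: "x \<in> bring_cone" and z: "tr1 x = 0" "tr2 x = 0"
  shows "lift2 x = (pr1 x) ^ 3 *s genus2_point True 1 (20 * \<i> * (x $ k / x $ i))"
    "(20 * \<i> * (x $ k / x $ i))\<^sup>2 = sextic 1"
proof -
  note t = tr_zero_imp[OF x z]
  have r: "rest x = pr1 x" by (simp add: rest_def z)
  have d: "disc x = 4 * x $ i * x $ k" by (simp add: disc_def t(2,3))
  have p: "pr1 x = - (x $ i)\<^sup>2" by (simp add: pr1_def t(2) power2_eq_square)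
  have "- \<i> * disc x * (5 * (pr1 x)\<^sup>2) = (pr1 x) ^ 3 * (20 * \<i> * (x $ k / x $ i))"
    using t(5) unfolding d p by (simp add: field_simps power2_eq_square power3_eq_cube)
  moreover have "2 * (pr1 x)\<^sup>2 + 2 * pr1 x * pr1 x + (pr1 x)\<^sup>2 = 5 * (pr1 x)\<^sup>2" by (simp add: power2_eq_square)
  ultimately show "lift2 x = (pr1 x) ^ 3 *s genus2_point True 1 (20 * \<i> * (x $ k / x $ i))"
    unfolding vec_eq_iff forall_5 lift2_def r by (simp add: genus2_point_def power2_eq_square power3_eq_cube)
  show "(20 * \<i> * (x $ k / x $ i))\<^sup>2 = sextic 1"
    using t(4,5) by (simp add: sextic_def power_mult_distrib power_divide)
qed

lemma lift2_in_cone: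
  assumes x: "x \<in> bring_cone" and p: "pr1 x \<noteq> 0"
  shows "lift2 x \<in> genus2_cone"
proof (cases "tr1 x = 0 \<and> tr2 x = 0")
  case True
  then have "genus2_point True 1 (20 * \<i> * (x $ k / x $ i)) \<in> genus2_cone"
    using lift2_at_fixed_point(2)[OF x] genus2_point_in_cone by blast
  then show ?thesis
    using lift2_at_fixed_point(1)[OF x] True p punctured_cone_genus2 by (simp add: punctured_cone_def)
next
  case False
  then have "proj_point (lift2 x) \<in> proj_point ` genus2_cone"
    using proj_point_lift2[OF x p] lift1_in_cone[OF x] by simp
  then show ?thesis using proj_point_mem_image_cone[OF punctured_cone_genus2] by blast
qed

text \<open>The lifts are homogeneous of degrees 3 and 6, so the value does not depend on the
  representative. The definition uses \<open>lift2\<close> at the fixed points alone;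
  \<open>quotient_proj_lift\<close> shows that it also computes the map around them.\<close>

definition quotient_proj :: "(complex ^ 5) set \<Rightarrow> (complex ^ 5) set" where
  "quotient_proj = on_rep (\<lambda>x. proj_point (if tr1 x = 0 \<and> tr2 x = 0 then lift2 x else lift1 x))"

lemma lift_scale:
  "tr1 (c *s x) = c * tr1 x" "tr2 (c *s x) = c * tr2 x" "pr1 (c *s x) = c\<^sup>2 * pr1 x"
  "disc (c *s x) = c\<^sup>2 * disc x" "rest (c *s x) = c\<^sup>2 * rest x"
  "lift1 (c *s x) = c ^ 3 *s lift1 x" "lift2 (c *s x) = c ^ 6 *s lift2 x"
proof -
  show t: "tr1 (c *s x) = c * tr1 x" "tr2 (c *s x) = c * tr2 x" "pr1 (c *s x) = c\<^sup>2 * pr1 x"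
    "disc (c *s x) = c\<^sup>2 * disc x"
    by (simp_all add: invariant_defs algebra_simps power2_eq_square)
  show r: "rest (c *s x) = c\<^sup>2 * rest x" by (simp add: rest_def t power_mult_distrib algebra_simps power2_eq_square)
  show "lift1 (c *s x) = c ^ 3 *s lift1 x"
    by (simp add: vec_eq_iff forall_5 lift1_def t algebra_simps power2_eq_square power3_eq_cube)
  show "lift2 (c *s x) = c ^ 6 *s lift2 x"
    by (simp add: vec_eq_iff forall_5 lift2_def t r algebra_simps power_numeral_reduce)
qed

lemma quotient_proj_eq:
  assumes "x \<noteq> 0"
  shows "quotient_proj (proj_point x) = proj_point (if tr1 x = 0 \<and> tr2 x = 0 then lift2 x else lift1 x)"
  unfolding quotient_proj_def
proof (rule on_rep_proj_point[OF _ assms])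
  fix c :: complex assume c: "c \<noteq> 0"
  have "proj_point (c ^ n *s y) = proj_point y" for n and y :: "complex ^ 5"
    using c by (metis proj_point_eq_iff power_not_zero)
  then show "proj_point (if tr1 (c *s x) = 0 \<and> tr2 (c *s x) = 0 then lift2 (c *s x) else lift1 (c *s x))
      = proj_point (if tr1 x = 0 \<and> tr2 x = 0 then lift2 x else lift1 x)"
    using c by (simp add: lift_scale)
qed

lemma quotient_proj_lift:
  assumes "x \<in> bring_cone"
  shows "tr1 x \<noteq> 0 \<or> tr2 x \<noteq> 0 \<Longrightarrow> quotient_proj (proj_point x) = proj_point (lift1 x)"
    and "pr1 x \<noteq> 0 \<Longrightarrow> quotient_proj (proj_point x) = proj_point (lift2 x)"
proof -
  have "x \<noteq> 0" using assms by (simp add: bring_cone_def)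
  note eq = quotient_proj_eq[OF this]
  show "tr1 x \<noteq> 0 \<or> tr2 x \<noteq> 0 \<Longrightarrow> quotient_proj (proj_point x) = proj_point (lift1 x)"
    unfolding eq by auto
  show "pr1 x \<noteq> 0 \<Longrightarrow> quotient_proj (proj_point x) = proj_point (lift2 x)"
    unfolding eq using proj_point_lift2[OF assms] by auto
qed

lemma lift_cases: "x \<in> bring_cone \<Longrightarrow> (tr1 x \<noteq> 0 \<or> tr2 x \<noteq> 0) \<or> pr1 x \<noteq> 0"
  using tr_zero_imp by blast

section \<open>The involution and the fibres of the map\<close>

definition refl :: "complex ^ 5 \<Rightarrow> complex ^ 5" where
  "refl x = (\<chi> n. x $ (if n = i then j else if n = j then i else if n = k then l else if n = l then k else n))"

lemma refl_nth [simp]: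
  "refl x $ e = x $ e" "refl x $ i = x $ j" "refl x $ j = x $ i" "refl x $ k = x $ l" "refl x $ l = x $ k"
  using distinct by (auto simp: refl_def)

lemma refl_refl: "refl (refl x) = x"
  by (rule vec_eqI) simp_all

lemma refl_scale: "refl (c *s x) = c *s refl x"
  by (rule vec_eqI) simp_all

lemma refl_invariants: "tr1 (refl x) = tr1 x" "tr2 (refl x) = tr2 x" "pr1 (refl x) = pr1 x"
  "disc (refl x) = disc x"
  by (simp_all add: invariant_defs algebra_simps)

lemma refl_in_cone: "x \<in> bring_cone \<Longrightarrow> refl x \<in> bring_cone"
  using refl_refl[of x] by (auto simp: bring_cone_iff refl_invariants mult.commute vec_eq_iff[of _ 0])
    (metis index_cases refl_nth(1-5) zero_index)

lemma quotient_proj_refl: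
  assumes "x \<in> bring_cone"
  shows "quotient_proj (proj_point (refl x)) = quotient_proj (proj_point x)"
proof -
  have "x \<noteq> 0" "refl x \<noteq> 0" using assms refl_in_cone[OF assms] by (auto simp: bring_cone_def)
  then show ?thesis
    by (simp add: quotient_proj_eq refl_invariants lift1_def lift2_def rest_def)
qed

lemma quotient_proj_in_genus2:
  assumes "x \<in> bring_cone"
  shows "quotient_proj (proj_point x) \<in> proj_point ` genus2_cone"
  using lift_cases[OF assms] quotient_proj_lift[OF assms] lift1_in_cone[OF assms] lift2_in_cone[OF assms]
  by auto

text \<open>The traces determine the squares of both differences, and \<open>disc\<close> ties their
  signs together. The remaining freedom is a simultaneous sign change, which is the
  involution.\<close>

lemma eq_or_eq_refl:
  assumes x: "x \<in> bring_cone" and y: "y \<in> bring_cone" and ne: "tr1 x \<noteq> tr2 x"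
    and eq: "tr1 y = tr1 x" "tr2 y = tr2 x" "disc y = disc x"
  shows "y = x \<or> y = refl x"
proof -
  have "(y $ i - y $ j)\<^sup>2 * (tr1 x - tr2 x) = (x $ i - x $ j)\<^sup>2 * (tr1 x - tr2 x)"
    "(y $ k - y $ l)\<^sup>2 * (tr1 x - tr2 x) = (x $ k - x $ l)\<^sup>2 * (tr1 x - tr2 x)"
    using bring_cone_discriminants[OF x] bring_cone_discriminants[OF y] by (simp_all add: eq)
  then have sq: "(y $ i - y $ j)\<^sup>2 = (x $ i - x $ j)\<^sup>2" "(y $ k - y $ l)\<^sup>2 = (x $ k - x $ l)\<^sup>2"
    using ne by simp_all
  have "(y $ i - y $ j = x $ i - x $ j \<and> y $ k - y $ l = x $ k - x $ l) \<or>
      (y $ i - y $ j = - (x $ i - x $ j) \<and> y $ k - y $ l = - (x $ k - x $ l))"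
    using sq eq(3) unfolding power2_eq_iff disc_def by auto
  then show ?thesis
  proof
    assume "y $ i - y $ j = x $ i - x $ j \<and> y $ k - y $ l = x $ k - x $ l"
    then have "y = x" using eq_bring_point[OF x] eq_bring_point[OF y] eq by simp
    then show ?thesis ..
  next
    assume *: "y $ i - y $ j = - (x $ i - x $ j) \<and> y $ k - y $ l = - (x $ k - x $ l)"
    have "refl x = bring_point (tr1 x) (tr2 x) (x $ j - x $ i) (x $ l - x $ k)"
      using eq_bring_point[OF refl_in_cone[OF x]] by (simp add: refl_invariants)
    then have "y = refl x" using eq_bring_point[OF y] eq * by simp
    then show ?thesis ..
  qed
qed

text \<open>Injectivity of the twisted cubic in homogeneous coordinates. The factor has to be the
  particular cube root of \<open>c\<close> that scales both traces, hence \<open>b' / b\<close> or,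
  for \<open>b = 0\<close>, \<open>a' / a\<close>.\<close>

lemma proportional_traces:
  fixes a b a' b' c :: complex
  assumes "a \<noteq> 0 \<or> b \<noteq> 0" "c \<noteq> 0" "b' ^ 3 = c * b ^ 3" "b'\<^sup>2 * a' = c * (b\<^sup>2 * a)" "a' ^ 3 = c * a ^ 3"
  shows "\<exists>h. h \<noteq> 0 \<and> h ^ 3 = c \<and> a' = h * a \<and> b' = h * b"
proof (cases "b = 0")
  case True
  then have a: "a \<noteq> 0" "b' = 0" using assms by auto
  then have "a' \<noteq> 0" using assms by auto
  then show ?thesis using a True assms(5) by (intro exI[of _ "a' / a"]) (simp add: power_divide)
next
  case False
  define h where "h = b' / b"
  have b': "b' = h * b" using False by (simp add: h_def)
  have "h ^ 3 * b ^ 3 = c * b ^ 3" using assms(3) by (simp add: b' power_mult_distrib)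
  then have h: "h ^ 3 = c" using False by simp
  then have h0: "h \<noteq> 0" using assms(2) by auto
  have "(h\<^sup>2 * b\<^sup>2) * a' = (h\<^sup>2 * b\<^sup>2) * (h * a)"
    using assms(4) by (simp add: b' h[symmetric] power_mult_distrib power2_eq_square power3_eq_cube algebra_simps)
  moreover have "h\<^sup>2 * b\<^sup>2 \<noteq> 0" using h0 False by simp
  ultimately have "a' = h * a" by (metis mult_left_cancel)
  then show ?thesis using h h0 b' by blast
qed

lemma quotient_proj_fibre:
  assumes x: "x \<in> bring_cone" and y: "y \<in> bring_cone"
    and eq: "quotient_proj (proj_point y) = quotient_proj (proj_point x)"
  shows "proj_point y = proj_point x \<or> proj_point y = proj_point (refl x)"
proof -
  \<comment> \<open>A fixed point is sent to \<open>x = 1\<close>; at any other point this value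
    would mean equal traces, hence vanishing ones.\<close>
  have mixed: False if "z \<in> bring_cone" "w \<in> bring_cone" "tr1 z = 0" "tr2 z = 0" "tr1 w \<noteq> 0 \<or> tr2 w \<noteq> 0"
    "quotient_proj (proj_point z) = quotient_proj (proj_point w)" for z w
  proof -
    note t = tr_zero_imp[OF that(1,3,4)]
    have "proj_point (lift2 z) = proj_point (lift1 w)"
      using that quotient_proj_lift(2)[OF that(1) t(6)] quotient_proj_lift(1)[OF that(2,5)] by simp
    then obtain c where c: "c \<noteq> 0" "lift1 w = c *s lift2 z" by (auto simp: proj_point_eq_iff)
    let ?q = "c * (pr1 z) ^ 3"
    have "lift1 w = ?q *s genus2_point True 1 (20 * \<i> * (z $ k / z $ i))"
      using c(2) lift2_at_fixed_point(1)[OF that(1,3,4)] by simp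
    then have "lift1 w $ 1 = ?q" "lift1 w $ 2 = ?q" by (simp_all add: genus2_point_def)
    then have b3: "(tr2 w) ^ 3 = ?q" and b2a: "(tr2 w)\<^sup>2 * tr1 w = ?q" by (simp_all add: lift1_def)
    have "?q \<noteq> 0" using c t by simp
    then have b: "tr2 w \<noteq> 0" using b3 by auto
    have "(tr2 w)\<^sup>2 * tr1 w = (tr2 w)\<^sup>2 * tr2 w"
      using b3 b2a by (simp add: power2_eq_square power3_eq_cube)
    then have "tr1 w = tr2 w" using b by simp
    then show False using tr_eq_imp_zero[OF that(2)] b by simp
  qed
  consider (fixed) "tr1 x = 0" "tr2 x = 0" "tr1 y = 0" "tr2 y = 0"
    | (free) "tr1 x \<noteq> 0 \<or> tr2 x \<noteq> 0" "tr1 y \<noteq> 0 \<or> tr2 y \<noteq> 0"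
    using mixed[OF x y] mixed[OF y x] eq by metis
  then show ?thesis
  proof cases
    case fixed
    note tx = tr_zero_imp[OF x fixed(1,2)] and ty = tr_zero_imp[OF y fixed(3,4)]
    have "proj_point (lift2 y) = proj_point (lift2 x)"
      using eq quotient_proj_lift(2)[OF x tx(6)] quotient_proj_lift(2)[OF y ty(6)] by simp
    then obtain c where c: "c \<noteq> 0" "lift2 x = c *s lift2 y" by (auto simp: proj_point_eq_iff)
    \<comment> \<open>The last coordinate recovers the ratio of the coordinates at \<open>k\<close>
      and \<open>i\<close>, and this ratio determines a fixed point.\<close>
    have "(pr1 x) ^ 3 *s genus2_point True 1 (20 * \<i> * (x $ k / x $ i))
        = (c * (pr1 y) ^ 3) *s genus2_point True 1 (20 * \<i> * (y $ k / y $ i))" (is "?v = ?w")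
      using c(2) lift2_at_fixed_point(1)[OF x fixed(1,2)] lift2_at_fixed_point(1)[OF y fixed(3,4)] by simp
    then have "?v $ 1 = ?w $ 1" "?v $ 5 = ?w $ 5" by simp_all
    then have "(pr1 x) ^ 3 = c * (pr1 y) ^ 3"
      "(pr1 x) ^ 3 * (20 * \<i> * (x $ k / x $ i)) = (c * (pr1 y) ^ 3) * (20 * \<i> * (y $ k / y $ i))"
      by (simp_all add: genus2_point_def)
    then have "20 * \<i> * (x $ k / x $ i) = 20 * \<i> * (y $ k / y $ i)"
      using c(1) ty(6) by (metis mult_eq_0_iff mult_left_cancel power_not_zero)
    then have "x $ k / x $ i = y $ k / y $ i"
      by (metis complex_i_not_zero mult_eq_0_iff mult_left_cancel zero_neq_numeral)
    then have "y $ k = (y $ i / x $ i) * x $ k" using tx(5) ty(5) by (simp add: field_simps)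
    then have "y = (y $ i / x $ i) *s x"
      by (intro vec_eqI) (use tx ty in simp_all)
    moreover have "y $ i / x $ i \<noteq> 0" using tx(5) ty(5) by simp
    ultimately have "proj_point x = proj_point y" unfolding proj_point_eq_iff by blast
    then show ?thesis by simp
  next
    case free
    have "proj_point (lift1 x) = proj_point (lift1 y)"
      using eq quotient_proj_lift(1)[OF x free(1)] quotient_proj_lift(1)[OF y free(2)] by simp
    then obtain c where c: "c \<noteq> 0" "lift1 y = c *s lift1 x" by (auto simp: proj_point_eq_iff)
    have cn: "lift1 y $ n = c * lift1 x $ n" for n using c(2) by simp
    have "\<exists>h. h \<noteq> 0 \<and> h ^ 3 = c \<and> tr1 y = h * tr1 x \<and> tr2 y = h * tr2 x"
      by (rule proportional_traces[OF free(1) c(1)])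
        (use cn[of 1] cn[of 2] cn[of 4] in \<open>simp_all add: lift1_def\<close>)
    then obtain h where h: "h \<noteq> 0" "h ^ 3 = c" "tr1 y = h * tr1 x" "tr2 y = h * tr2 x" by blast
    \<comment> \<open>Rescaling \<open>x\<close> by \<open>h\<close> makes its traces those of
      \<open>y\<close>. The last coordinates then give equal \<open>disc\<close>, because the
      difference of the traces is nonzero.\<close>
    let ?x = "h *s x"
    have hx: "?x \<in> bring_cone" using x h(1) punctured_cone_bring by (simp add: punctured_cone_def)
    have ne: "tr1 ?x \<noteq> tr2 ?x" using tr_eq_imp_zero[OF hx] free h(1) by (auto simp: lift_scale)
    have "lift1 y $ 5 = lift1 ?x $ 5" unfolding lift_scale using cn h by simp
    then have "disc y * (tr1 ?x - tr2 ?x) = disc ?x * (tr1 ?x - tr2 ?x)"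
      unfolding lift1_def by (simp add: lift_scale(1,2) h)
    then have "disc y = disc ?x" using ne by simp
    then have "y = ?x \<or> y = refl ?x"
      using eq_or_eq_refl[OF hx y ne] h by (simp add: lift_scale(1,2))
    then show ?thesis
      unfolding refl_scale using h(1) by (metis proj_point_eq_iff)
  qed
qed

section \<open>Surjectivity, continuity and holomorphy of the map\<close>

lemma quotient_proj_surj:
  "quotient_proj ` (proj_point ` bring_cone) = proj_point ` genus2_cone"
proof (intro equalityI subsetI)
  fix p assume "p \<in> proj_point ` genus2_cone"
  then obtain X where X: "X \<in> genus2_cone" "p = proj_point X" by auto
  have nz: "X $ 1 \<noteq> 0 \<or> X $ 4 \<noteq> 0" using genus2_cone_den_nonzero[OF X(1)] by (simp add: den_def)
  show "p \<in> quotient_proj ` (proj_point ` bring_cone)"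
  proof (cases "X $ 1 = X $ 2 \<and> X $ 1 \<noteq> 0")
    case True
    then have X1: "X $ 1 \<noteq> 0" "X $ 2 = X $ 1" by auto
    define w where "w = X $ 5 / X $ 1"
    have w: "w\<^sup>2 = sextic 1" "proj_point (genus2_point True 1 w) = p"
      using genus2_cone_eq_point(2,3)[OF X(1), of True] X1 X(2) by (simp_all add: den_def num_def w_def)
    have w400: "w\<^sup>2 = 400" using w(1) by (simp add: sextic_def)
    \<comment> \<open>Points over 1 come from fixed points: \<open>v\<close> solves
      \<open>w = 20 * \<i> * v\<close> and becomes the coordinate at \<open>k\<close> when the one
      at \<open>i\<close> is 1.\<close>
    define v where "v = w / (20 * \<i>)"
    have wv: "w = 20 * \<i> * v" by (simp add: v_def)
    have v: "v\<^sup>2 = - 1" using w400 by (simp add: v_def power_divide power_mult_distrib)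
    let ?x = "bring_point 0 0 2 (2 * v)"
    have "?x $ i = 1" "?x $ k = v" "?x $ l = - v" "?x $ j = - 1" by simp_all
    then have "pr1 ?x + ?x $ k * ?x $ l = 0" "?x \<noteq> 0"
      using v by (auto simp: pr1_def power2_eq_square simp del: bring_point_nth)
    then have x: "?x \<in> bring_cone" unfolding bring_cone_iff by simp
    have t: "tr1 ?x = 0" "tr2 ?x = 0" by simp_all
    have "proj_point (genus2_point True 1 (20 * \<i> * (?x $ k / ?x $ i))) = proj_point (lift2 ?x)"
      using lift2_at_fixed_point(1)[OF x t] tr_zero_imp(6)[OF x t]
      by (metis proj_point_eq_iff power_not_zero)
    moreover have "20 * \<i> * (?x $ k / ?x $ i) = w" by (simp add: wv)
    ultimately have "p = quotient_proj (proj_point ?x)"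
      using w(2) quotient_proj_lift(2)[OF x tr_zero_imp(6)[OF x t]] by simp
    then show ?thesis using x by blast
  next
    case False
    \<comment> \<open>Homogeneous parameters, equal to \<open>(1, x)\<close> on the affine part and
      to \<open>(0, 1)\<close> at infinity.\<close>
    obtain s t w where st: "s \<noteq> t" and w: "w\<^sup>2 = (t ^ 3 + 7 * t\<^sup>2 * s + 8 * t * s\<^sup>2 + 4 * s ^ 3) *
        (4 * t ^ 3 + 8 * t\<^sup>2 * s + 7 * t * s\<^sup>2 + s ^ 3)"
      and p: "p = proj_point (vector [s ^ 3, s\<^sup>2 * t, s * t\<^sup>2, t ^ 3, w])"
    proof (cases "X $ 1 = 0")
      case True
      then have X4: "X $ den False \<noteq> 0" using nz by (simp add: den_def)
      have "X $ 3 = 0" using True X(1) by (auto simp: genus2_cone_def)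
      then have "(X $ 5 / X $ 4)\<^sup>2 = sextic 0" "p = proj_point (genus2_point False 0 (X $ 5 / X $ 4))"
        using genus2_cone_eq_point(2,3)[OF X(1) X4] X(2) by (simp_all add: den_def num_def)
      then show ?thesis
        by (intro that[of 0 1 "X $ 5 / X $ 4"]) (simp_all add: sextic_def genus2_point_def)
    next
      case X1: False
      then have X1': "X $ den True \<noteq> 0" by (simp add: den_def)
      have "(X $ 5 / X $ 1)\<^sup>2 = sextic (X $ 2 / X $ 1)"
        "p = proj_point (genus2_point True (X $ 2 / X $ 1) (X $ 5 / X $ 1))"
        using genus2_cone_eq_point(2,3)[OF X(1) X1'] X(2) by (simp_all add: den_def num_def)
      then show ?thesis using False X1
        by (intro that[of 1 "X $ 2 / X $ 1" "X $ 5 / X $ 1"])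
          (simp_all add: sextic_def genus2_point_def mult.commute)
    qed
    let ?P = "t ^ 3 + 7 * t\<^sup>2 * s + 8 * t * s\<^sup>2 + 4 * s ^ 3"
      and ?Q = "4 * t ^ 3 + 8 * t\<^sup>2 * s + 7 * t * s\<^sup>2 + s ^ 3"
    define c where "c = csqrt (?P / (t - s))"
    define d0 where "d0 = csqrt (- ?Q / (t - s))"
    have c: "c\<^sup>2 * (t - s) = ?P" and d0: "d0\<^sup>2 * (t - s) = - ?Q"
      using st by (simp_all add: c_def d0_def)
    have "(\<i> * (c * d0) * (t - s))\<^sup>2 = - (c\<^sup>2 * (t - s)) * (d0\<^sup>2 * (t - s))"
      by (simp add: power_mult_distrib) (simp add: power2_eq_square)
    then have "(\<i> * (c * d0) * (t - s))\<^sup>2 = w\<^sup>2" unfolding c d0 w by (simp only: minus_mult_minus)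
    \<comment> \<open>Arbitrary roots of the two discriminants reproduce \<open>w\<close> up to sign
      only; negating one of the differences repairs this.\<close>
    then have "w = \<i> * (c * d0) * (t - s) \<or> w = \<i> * (c * - d0) * (t - s)"
      unfolding power2_eq_iff by auto
    then obtain d where d: "d = d0 \<or> d = - d0" "w = \<i> * (c * d) * (t - s)" by metis
    have d': "d\<^sup>2 * (t - s) = - ?Q" using d(1) d0 by auto
    let ?x = "bring_point t s c d"
    have x: "?x \<in> bring_cone" using st by (intro bring_point_in_cone c d') auto
    have "disc ?x = c * d" by (simp add: disc_def diff_divide_distrib[symmetric])
    then have "lift1 ?x = vector [s ^ 3, s\<^sup>2 * t, s * t\<^sup>2, t ^ 3, w]"
      by (simp add: lift1_def d(2))
    then have "p = quotient_proj (proj_point ?x)"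
      using p quotient_proj_lift(1)[OF x] st by (metis bring_point_tr)
    then show ?thesis using x by blast
  qed
qed (use quotient_proj_in_genus2 in auto)

lemma continuous_on_lift: "continuous_on S lift1" "continuous_on S lift2"
proof -
  have "continuous_on S (\<lambda>x. lift1 x $ n)" "continuous_on S (\<lambda>x. lift2 x $ n)" for n
    using exhaust_5[of n]
    by (elim disjE; simp add: lift1_def lift2_def rest_def invariant_defs; intro continuous_intros)+
  then have "continuous_on S (\<lambda>x. \<chi> n. lift1 x $ n) \<and> continuous_on S (\<lambda>x. \<chi> n. lift2 x $ n)"
    by (intro conjI continuous_on_vec_lambda)
  then show "continuous_on S lift1" "continuous_on S lift2" by simp_all
qed

lemma preserves_holomorphic_lift: "preserves_holomorphic lift1" "preserves_holomorphic lift2"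
proof -
  have "(\<lambda>t. lift1 (G t) $ n) holomorphic_on N" "(\<lambda>t. lift2 (G t) $ n) holomorphic_on N"
    if "\<forall>m. (\<lambda>t. G t $ m) holomorphic_on N" for G N n
    using exhaust_5[of n]
    by (elim disjE; simp add: lift1_def lift2_def rest_def invariant_defs;
        intro holomorphic_intros that[rule_format])+
  then show "preserves_holomorphic lift1" "preserves_holomorphic lift2"
    unfolding preserves_holomorphic_def by blast+
qed

lemma open_lift_domains: "open {x. tr1 x \<noteq> 0 \<or> tr2 x \<noteq> 0}" "open {x. pr1 x \<noteq> 0}"
  by (intro open_Collect_disj open_Collect_neq continuous_intros; simp add: invariant_defs; intro continuous_intros)+

text \<open>The two lifts give continuous formulas on two relatively open sets that cover the cone,
  and both formulas compute the same map.\<close>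

lemma continuous_map_quotient_proj:
  "continuous_map (subtopology proj_topology (proj_point ` bring_cone))
     (subtopology proj_topology (proj_point ` genus2_cone)) quotient_proj"
  unfolding continuous_map_in_subtopology
proof
  show "quotient_proj \<in> topspace (subtopology proj_topology (proj_point ` bring_cone)) \<rightarrow> proj_point ` genus2_cone"
    using quotient_proj_in_genus2 by auto
  show "continuous_map (subtopology proj_topology (proj_point ` bring_cone)) proj_topology quotient_proj"
  proof (rule continuous_compose_quotient_map[OF quotient_map_proj_point_cone[OF punctured_cone_bring]])
    show "open bring_cone \<or> closedin (top_of_set (- {0})) bring_cone" using closedin_bring_cone by simp
    define T where "T c = bring_cone \<inter> (if c then {x. tr1 x \<noteq> 0 \<or> tr2 x \<noteq> 0} else {x. pr1 x \<noteq> 0})" for c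
    define h where "h c = (if c then lift1 else lift2)" for c
    have T: "quotient_proj (proj_point x) = proj_point (h c x)" "h c x \<noteq> 0" if "x \<in> T c" for x c
      using that quotient_proj_lift[of x] lift1_in_cone[of x] lift2_in_cone[of x]
      by (cases c; auto simp: T_def h_def genus2_cone_def)+
    show "continuous_map (top_of_set bring_cone) proj_topology (quotient_proj \<circ> proj_point)"
    proof (rule pasting_lemma[where I = UNIV and T = T and f = "\<lambda>c x. proj_point (h c x)"])
      fix c
      show "openin (top_of_set bring_cone) (T c)"
        using open_lift_domains by (auto simp: T_def openin_open)
      have "subtopology (top_of_set bring_cone) (T c) = top_of_set (T c)"
        by (simp add: T_def subtopology_subtopology)
      then show "continuous_map (subtopology (top_of_set bring_cone) (T c)) proj_topology (\<lambda>x. proj_point (h c x))"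
        using T by (intro continuous_map_proj_point_comp) (auto simp: h_def continuous_on_lift)
    next
      fix c d x assume "x \<in> topspace (top_of_set bring_cone) \<inter> T c \<inter> T d"
      then show "proj_point (h c x) = proj_point (h d x)" using T by (metis IntD1 IntD2)
    next
      fix x assume "x \<in> topspace (top_of_set bring_cone)"
      then have "x \<in> T True \<or> x \<in> T False" using lift_cases[of x] by (auto simp: T_def)
      then show "\<exists>c. c \<in> UNIV \<and> x \<in> T c \<and> (quotient_proj \<circ> proj_point) x = proj_point (h c x)"
        using T by auto
    qed
  qed
qed

text \<open>A continuous surjection from a compact space onto a Hausdorff space is a quotient
  map.\<close>

lemma quotient_map_quotient_proj:
  "quotient_map (space_of bring_curve) (space_of (projective_curve (proj_point ` genus2_cone))) quotient_proj"
proof (rule T1_Spaces.continuous_imp_quotient_map)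
  show "continuous_map (space_of bring_curve) (space_of (projective_curve (proj_point ` genus2_cone))) quotient_proj"
    using continuous_map_quotient_proj by (simp add: bring_curve_eq space_of_projective_curve)
  show "compact_space (space_of bring_curve)" by (rule compact_space_bring)
  show "Hausdorff_space (space_of (projective_curve (proj_point ` genus2_cone)))"
    using riemann_surface_genus2 by (simp add: riemann_surface_def)
  have "proj_point ` genus2_cone \<subseteq> topspace proj_topology"
    using connectedin_genus2 connectedin_subset_topspace by blast
  then show "quotient_proj ` topspace (space_of bring_curve)
      = topspace (space_of (projective_curve (proj_point ` genus2_cone)))"
    unfolding topspace_bring quotient_proj_surj by (auto simp: space_of_projective_curve)
qed

lemma holomorphic_map_quotient_proj:
  "holomorphic_map bring_curve (projective_curve (proj_point ` genus2_cone)) quotient_proj"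
  unfolding bring_curve_eq
proof (rule holomorphic_map_into_projective_curve[OF continuous_map_quotient_proj bring_cone_subset])
  fix x n assume "proj_point x \<in> proj_point ` bring_cone"
  then have x: "x \<in> bring_cone" using proj_point_mem_image_cone[OF punctured_cone_bring] by blast
  have in_cone: "y \<in> bring_cone" if "proj_point y \<in> proj_point ` bring_cone" for y
    using that proj_point_mem_image_cone[OF punctured_cone_bring] by blast
  have nz: "X \<noteq> 0" if "X \<in> genus2_cone" for X using that by (simp add: genus2_cone_def)
  from lift_cases[OF x] show "\<exists>W g. open W \<and> x \<in> W \<and> preserves_holomorphic g \<and>
      (\<forall>y\<in>W. proj_point y \<in> proj_point ` bring_cone \<longrightarrow> g y \<noteq> 0 \<and> quotient_proj (proj_point y) = proj_point (g y))"
  proof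
    assume "tr1 x \<noteq> 0 \<or> tr2 x \<noteq> 0"
    then show ?thesis
      using open_lift_domains(1) preserves_holomorphic_lift(1) in_cone quotient_proj_lift(1) lift1_in_cone nz
      by (intro exI[of _ "{x. tr1 x \<noteq> 0 \<or> tr2 x \<noteq> 0}"] exI[of _ lift1]) blast
  next
    assume "pr1 x \<noteq> 0"
    then show ?thesis
      using open_lift_domains(2) preserves_holomorphic_lift(2) in_cone quotient_proj_lift(2) lift2_in_cone nz
      by (intro exI[of _ "{x. pr1 x \<noteq> 0}"] exI[of _ lift2]) blast
  qed
qed

section \<open>The local parameter \<open>a / b\<close> and the finite exceptional set\<close>

lemma bring_point_scale: "h *s bring_point a b c d = bring_point (h * a) (h * b) (h * c) (h * d)"
  by (rule vec_eqI) (simp_all add: algebra_simps)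

text \<open>Normalised by \<open>b = 1\<close>, the two differences are square roots of the rational
  functions \<open>D1\<close> and \<open>D2\<close> of \<open>a / b\<close>, with holomorphic
  branches as long as neither vanishes. The chart domain fixes both branches, whereas the involution
  negates both differences, so the domain contains at most one point of each fibre.\<close>

lemma bring_chart:
  assumes x: "x \<in> bring_cone" and b: "tr2 x \<noteq> 0" and ab: "tr1 x \<noteq> tr2 x"
    and ij: "x $ i \<noteq> x $ j" and kl: "x $ k \<noteq> x $ l"
  shows "\<exists>U \<phi>. (U, \<phi>) \<in> atlas bring_curve \<and> proj_point x \<in> U \<and> inj_on quotient_proj U"
proof -
  define S where "S = {t::complex. t \<noteq> 1}"
  have oS: "open S" unfolding S_def by (intro open_Collect_neq continuous_intros)
  define D1 where "D1 t = (t ^ 3 + 7 * t\<^sup>2 + 8 * t + 4) / (t - 1)" for t :: complex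
  define D2 where "D2 t = - (4 * t ^ 3 + 8 * t\<^sup>2 + 7 * t + 1) / (t - 1)" for t :: complex
  have hD: "D1 holomorphic_on S" "D2 holomorphic_on S"
    unfolding D1_def D2_def by (intro holomorphic_intros; simp add: S_def)+
  have D: "D1 (tr1 y / tr2 y) = ((y $ i - y $ j) / tr2 y)\<^sup>2" "D2 (tr1 y / tr2 y) = ((y $ k - y $ l) / tr2 y)\<^sup>2"
    if y: "y \<in> bring_cone" "tr2 y \<noteq> 0" "tr1 y / tr2 y \<in> S" for y
  proof -
    define b where "b = tr2 y"
    define t where "t = tr1 y / b"
    have b: "b \<noteq> 0" "tr1 y = t * b" and t: "t - 1 \<noteq> 0" using y by (simp_all add: S_def t_def b_def)
    have quotient: "(z / b)\<^sup>2 = R / (t - 1)" if "z\<^sup>2 * (t * b - b) = b ^ 3 * R" for z R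
    proof -
      have "b ^ 3 * ((z / b)\<^sup>2 * (t - 1)) = z\<^sup>2 * (t * b - b)"
        using b(1) by (simp add: field_simps power2_eq_square power3_eq_cube)
      then have "b ^ 3 * ((z / b)\<^sup>2 * (t - 1)) = b ^ 3 * R" using that by simp
      then have "(z / b)\<^sup>2 * (t - 1) = R" using b(1) by simp
      then show ?thesis using t by (simp add: nonzero_eq_divide_eq)
    qed
    show "D1 (tr1 y / tr2 y) = ((y $ i - y $ j) / tr2 y)\<^sup>2"
      unfolding b_def[symmetric] t_def[symmetric] D1_def
      by (rule quotient[symmetric], unfold bring_cone_discriminants(1)[OF y(1), folded b_def, unfolded b(2)])
        (simp add: power_mult_distrib algebra_simps power2_eq_square power3_eq_cube)
    show "D2 (tr1 y / tr2 y) = ((y $ k - y $ l) / tr2 y)\<^sup>2"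
      unfolding b_def[symmetric] t_def[symmetric] D2_def
      by (rule quotient[symmetric], unfold bring_cone_discriminants(2)[OF y(1), folded b_def, unfolded b(2)])
        (simp add: power_mult_distrib algebra_simps power2_eq_square power3_eq_cube)
  qed
  define t0 r1 r2 where "t0 = tr1 x / tr2 x" and "r1 = (x $ i - x $ j) / tr2 x" and "r2 = (x $ k - x $ l) / tr2 x"
  have t0: "t0 \<in> S" using ab b by (simp add: S_def t0_def)
  have r: "r1 \<noteq> 0" "r2 \<noteq> 0" using ij kl b by (simp_all add: r1_def r2_def)
  have D0: "D1 t0 = r1\<^sup>2" "D2 t0 = r2\<^sup>2"
    using D[OF x b] t0 by (simp_all add: t0_def r1_def r2_def)
  obtain N1 s1 where N1: "open N1" "t0 \<in> N1" "N1 \<subseteq> S" "s1 holomorphic_on N1"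
    and s1: "\<And>t. t \<in> N1 \<Longrightarrow> (s1 t)\<^sup>2 = D1 t" "\<And>t. t \<in> N1 \<Longrightarrow> 0 < Re (s1 t / r1)"
    using local_sqrt[OF oS t0 hD(1) D0(1) r(1)] by metis
  obtain N2 s2 where N2: "open N2" "t0 \<in> N2" "N2 \<subseteq> S" "s2 holomorphic_on N2"
    and s2: "\<And>t. t \<in> N2 \<Longrightarrow> (s2 t)\<^sup>2 = D2 t" "\<And>t. t \<in> N2 \<Longrightarrow> 0 < Re (s2 t / r2)"
    using local_sqrt[OF oS t0 hD(2) D0(2) r(2)] by metis
  define N where "N = N1 \<inter> N2"
  have N: "open N" "t0 \<in> N" using N1 N2 by (auto simp: N_def)
  have sN: "s1 holomorphic_on N" "s2 holomorphic_on N"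
    using N1(4) N2(4) by (auto simp: N_def intro: holomorphic_on_subset)
  have NS: "t \<noteq> 1" if "t \<in> N" for t using that N1 by (auto simp: N_def S_def)
  define \<gamma> where "\<gamma> t = bring_point t 1 (s1 t) (s2 t)" for t
  have \<gamma>C: "\<gamma> t \<in> bring_cone" if "t \<in> N" for t
    unfolding \<gamma>_def
  proof (rule bring_point_in_cone)
    show "t \<noteq> 1" using NS[OF that] .
    show "(s1 t)\<^sup>2 * (t - 1) = t ^ 3 + 7 * t\<^sup>2 * 1 + 8 * t * 1\<^sup>2 + 4 * 1 ^ 3"
      "(s2 t)\<^sup>2 * (t - 1) = - (4 * t ^ 3 + 8 * t\<^sup>2 * 1 + 7 * t * 1\<^sup>2 + 1 ^ 3)"
      using s1(1)[of t] s2(1)[of t] that NS[OF that] by (simp_all add: N_def D1_def D2_def)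
  qed
  let ?a = "axis i 1 + axis j 1" and ?b = "axis k 1 + axis l 1"
  have lin: "lin_form ?a y = tr1 y" "lin_form ?b y = tr2 y" for y by (simp_all add: tr1_def tr2_def)
  define W where "W = {y. tr2 y \<noteq> 0 \<and> tr1 y / tr2 y \<in> N \<and> 0 < Re ((y $ i - y $ j) / tr2 y / r1) \<and>
     0 < Re ((y $ k - y $ l) / tr2 y / r2)}"
  have oW: "open W"
  proof -
    have ct: "continuous_on A tr1" "continuous_on A tr2" for A
      unfolding tr1_def tr2_def by (intro continuous_intros)+
    have o: "open {y. tr2 y \<noteq> 0}" by (intro open_Collect_neq ct continuous_intros)
    have pre: "open ({y. tr2 y \<noteq> 0} \<inter> f -` B)" if "continuous_on {y. tr2 y \<noteq> 0} f" "open B"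
      for f :: "complex ^ 5 \<Rightarrow> complex" and B
      using continuous_open_preimage[OF that(1) o that(2)] .
    have "open (({y. tr2 y \<noteq> 0} \<inter> (\<lambda>y. tr1 y / tr2 y) -` N)
        \<inter> (({y. tr2 y \<noteq> 0} \<inter> (\<lambda>y. (y $ i - y $ j) / tr2 y * inverse r1) -` {z. 0 < Re z})
        \<inter> ({y. tr2 y \<noteq> 0} \<inter> (\<lambda>y. (y $ k - y $ l) / tr2 y * inverse r2) -` {z. 0 < Re z})))"
      by (intro open_Int pre N open_halfspace_Re_gt continuous_intros ct) auto
    then show ?thesis by (rule back_subst[of "open"]) (auto simp: W_def divide_inverse)
  qed
  have t_in: "t = tr1 (\<gamma> t)" "tr2 (\<gamma> t) = 1" for t by (simp_all add: \<gamma>_def)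
  have W_point: "proj_point (\<gamma> (tr1 y / tr2 y)) = proj_point y" if y: "y \<in> W" "y \<in> bring_cone" for y
  proof -
    have yW: "tr2 y \<noteq> 0" "tr1 y / tr2 y \<in> N1" "tr1 y / tr2 y \<in> N2" "tr1 y / tr2 y \<in> S"
      "0 < Re ((y $ i - y $ j) / tr2 y / r1)" "0 < Re ((y $ k - y $ l) / tr2 y / r2)"
      using y(1) N1(3) by (auto simp: W_def N_def)
    have "(y $ i - y $ j) / tr2 y = s1 (tr1 y / tr2 y)"
      by (rule sqrt_unique_halfplane[OF _ yW(5) s1(2)[OF yW(2)]])
        (simp only: s1(1)[OF yW(2)] D[OF y(2) yW(1,4)])
    moreover have "(y $ k - y $ l) / tr2 y = s2 (tr1 y / tr2 y)"
      by (rule sqrt_unique_halfplane[OF _ yW(6) s2(2)[OF yW(3)]])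
        (simp only: s2(1)[OF yW(3)] D[OF y(2) yW(1,4)])
    ultimately have "\<gamma> (tr1 y / tr2 y) = bring_point (tr1 y / tr2 y) 1 ((y $ i - y $ j) / tr2 y) ((y $ k - y $ l) / tr2 y)"
      by (simp add: \<gamma>_def)
    then have "tr2 y *s \<gamma> (tr1 y / tr2 y) = y"
      using yW(1) eq_bring_point[OF y(2)] by (simp add: bring_point_scale)
    then show ?thesis using yW(1) unfolding proj_point_eq_iff by metis
  qed
  have cone: "y \<in> bring_cone" if "proj_point y \<in> proj_point ` bring_cone" for y
    using that proj_point_mem_image_cone[OF punctured_cone_bring] by blast
  have pW: "punctured_cone W"
  proof -
    have "tr2 0 = 0" by (simp add: tr2_def)
    then show ?thesis
      by (auto simp: punctured_cone_def W_def lift_scale(1,2) right_diff_distrib[symmetric])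
  qed
  let ?U = "proj_point ` bring_cone \<inter> proj_point ` W"
  have "(?U, on_rep (\<lambda>x. lin_form ?a x / lin_form ?b x)) \<in> atlas (projective_curve (proj_point ` bring_cone))"
  proof (rule parametrization_in_atlas[where M = N and \<gamma> = \<gamma>, OF oW pW])
    show "lin_form ?b y \<noteq> 0" if "y \<in> W" for y using that unfolding lin by (simp add: W_def)
    show "open N" by (rule N)
    show "(\<lambda>t. \<gamma> t $ n) holomorphic_on N" for n
      using index_cases[of n]
      by (elim disjE; simp add: \<gamma>_def; intro holomorphic_intros sN) auto
    fix t assume t: "t \<in> N"
    show "\<gamma> t \<in> W" using t s1(2)[of t] s2(2)[of t] by (simp add: W_def \<gamma>_def N_def field_simps)
    show "proj_point (\<gamma> t) \<in> proj_point ` bring_cone" using \<gamma>C[OF t] by simp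
    show "lin_form ?b (\<gamma> t) = 1" "lin_form ?a (\<gamma> t) = t" unfolding lin using t_in[of t] by simp_all
  next
    fix y assume y: "y \<in> W" "proj_point y \<in> proj_point ` bring_cone"
    show "lin_form ?a y / lin_form ?b y \<in> N" unfolding lin using y(1) by (simp add: W_def)
    show "proj_point (\<gamma> (lin_form ?a y / lin_form ?b y)) = proj_point y"
      unfolding lin using W_point y cone by blast
  qed
  moreover have "proj_point x \<in> ?U"
    using x b N r by (intro IntI imageI) (simp_all add: W_def t0_def r1_def r2_def)
  moreover have "inj_on quotient_proj ?U"
  proof (rule inj_onI)
    fix p q assume p: "p \<in> ?U" and q: "q \<in> ?U" and eq: "quotient_proj p = quotient_proj q"
    from p obtain y where y: "y \<in> W" "p = proj_point y" by (elim IntE imageE)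
    with p cone[of y] have y: "y \<in> W" "p = proj_point y" "y \<in> bring_cone" by simp_all
    from q obtain z where z: "z \<in> W" "q = proj_point z" by (elim IntE imageE)
    with q cone[of z] have z: "z \<in> W" "q = proj_point z" "z \<in> bring_cone" by simp_all
    have nz: "tr2 y \<noteq> 0" "tr2 z \<noteq> 0" using y z by (auto simp: W_def)
    \<comment> \<open>The image determines \<open>a / b\<close>, and by \<open>W_point\<close> this
      parameter determines the point within the domain.\<close>
    have "proj_point (lift1 y) = proj_point (lift1 z)"
      using eq quotient_proj_lift(1)[OF y(3)] quotient_proj_lift(1)[OF z(3)] nz y z by simp
    then obtain c where c: "c \<noteq> 0" "lift1 z = c *s lift1 y" by (auto simp: proj_point_eq_iff)
    then have "lift1 z $ 1 = c * lift1 y $ 1" "lift1 z $ 2 = c * lift1 y $ 2" by simp_all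
    then have c1: "(tr2 z) ^ 3 = c * (tr2 y) ^ 3" and c2: "(tr2 z)\<^sup>2 * tr1 z = c * ((tr2 y)\<^sup>2 * tr1 y)"
      by (simp_all add: lift1_def)
    have "tr1 z / tr2 z = ((tr2 z)\<^sup>2 * tr1 z) / (tr2 z) ^ 3"
      using nz by (simp add: power2_eq_square power3_eq_cube)
    also have "\<dots> = tr1 y / tr2 y" unfolding c1 c2 using nz c(1) by (simp add: power2_eq_square power3_eq_cube)
    finally show "p = q" using W_point[OF y(1,3)] W_point[OF z(1,3)] y(2) z(2) by simp
  qed
  ultimately show ?thesis unfolding bring_curve_eq by (intro exI conjI)
qed

text \<open>Contains the images of all points at which \<open>bring_chart\<close> does not apply:
  \<open>X $ 1 = 0\<close> stands for \<open>b = 0\<close>, \<open>X $ 2 = X $ 1\<close> for the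
  value 1 taken at the fixed points, and \<open>X $ 5 = 0\<close> for a vanishing
  difference.\<close>

definition special_points :: "(complex ^ 5) set set" where
  "special_points = proj_point ` {X \<in> genus2_cone. X $ 1 = 0 \<or> X $ 2 = X $ 1 \<or> X $ 5 = 0}"

lemma finite_special_points: "finite special_points"
proof -
  have fin: "finite {y. y\<^sup>2 = c}" for c :: complex using finite_nth_roots[of 2 c] by simp
  have "sextic x = poly [:4, 36, 95, 130, 95, 36, 4:] x" for x
    by (simp add: sextic_def algebra_simps power2_eq_square power3_eq_cube)
  then have roots: "finite {x. sextic x = 0}" using poly_roots_finite[of "[:4, 36, 95, 130, 95, 36, 4:] :: complex poly"] by simp
  have "special_points \<subseteq> (\<lambda>y. proj_point (genus2_point False 0 y)) ` {y. y\<^sup>2 = sextic 0}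
      \<union> (\<lambda>y. proj_point (genus2_point True 1 y)) ` {y. y\<^sup>2 = sextic 1}
      \<union> (\<lambda>x. proj_point (genus2_point True x 0)) ` {x. sextic x = 0}" (is "_ \<subseteq> ?A \<union> ?B \<union> ?C")
  proof
    fix p assume "p \<in> special_points"
    then obtain X where X: "X \<in> genus2_cone" "p = proj_point X" "X $ 1 = 0 \<or> X $ 2 = X $ 1 \<or> X $ 5 = 0"
      by (auto simp: special_points_def)
    show "p \<in> ?A \<union> ?B \<union> ?C"
    proof (cases "X $ 1 = 0")
      case True
      then have X4: "X $ den False \<noteq> 0" using genus2_cone_den_nonzero[OF X(1)] by (simp add: den_def)
      have "X $ 3 = 0" using True X(1) by (auto simp: genus2_cone_def)
      then have "p \<in> ?A" using genus2_cone_eq_point(2,3)[OF X(1) X4] X(2) by (auto simp: num_def)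
      then show ?thesis by simp
    next
      case False
      then have X1: "X $ den True \<noteq> 0" by (simp add: den_def)
      note pt = genus2_cone_eq_point(2,3)[OF X(1) X1]
      from X(3) False consider "X $ 2 = X $ 1" | "X $ 5 = 0" by blast
      then show ?thesis
      proof cases
        case 1
        then have "p \<in> ?B" using pt X(2) False by (auto simp: num_def den_def)
        then show ?thesis by simp
      next
        case 2
        then have "p \<in> ?C" using pt X(2) by auto
        then show ?thesis by simp
      qed
    qed
  qed
  then show ?thesis using fin roots by (meson finite_UnI finite_imageI finite_subset)
qed

lemma bring_chart_off_special_points:
  assumes x: "x \<in> bring_cone" and nsp: "quotient_proj (proj_point x) \<notin> special_points"
  shows "\<exists>U \<phi>. (U, \<phi>) \<in> atlas bring_curve \<and> proj_point x \<in> U \<and> inj_on quotient_proj U"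
proof (rule bring_chart[OF x])
  have ns: "\<not> (X $ 1 = 0 \<or> X $ 2 = X $ 1 \<or> X $ 5 = 0)"
    if "X \<in> genus2_cone" "quotient_proj (proj_point x) = proj_point X" for X
    using nsp that unfolding special_points_def by blast
  have nz: "tr1 x \<noteq> 0 \<or> tr2 x \<noteq> 0"
  proof (rule ccontr)
    assume "\<not> ?thesis"
    then have z: "tr1 x = 0" "tr2 x = 0" by auto
    then have "lift2 x $ 2 = lift2 x $ 1"
      using lift2_at_fixed_point(1)[OF x z] by (simp add: genus2_point_def)
    then show False
      using ns[OF lift2_in_cone[OF x] quotient_proj_lift(2)[OF x]] tr_zero_imp(6)[OF x z] by simp
  qed
  note n = ns[OF lift1_in_cone[OF x nz] quotient_proj_lift(1)[OF x nz]]
  then show b: "tr2 x \<noteq> 0" by (auto simp: lift1_def)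
  from n show "tr1 x \<noteq> tr2 x" "x $ i \<noteq> x $ j" "x $ k \<noteq> x $ l" by (auto simp: lift1_def disc_def)
qed

text \<open>Stated for any \<open>q\<close> whose values are the orbits of the involution, which
  keeps the group action out of the geometry.\<close>

lemma biholomorphic_bring_quotient:
  assumes q: "\<And>x. x \<in> bring_cone \<Longrightarrow> q (proj_point x) = {proj_point x, proj_point (refl x)}"
  shows "biholomorphic (quotient_surface bring_curve q) (projective_curve (proj_point ` genus2_cone))"
proof (rule biholomorphic_quotient_surface[OF riemann_surface_genus2 _ quotient_map_quotient_proj _
      holomorphic_map_quotient_proj finite_special_points])
  show "complex_chart (space_of bring_curve) V \<psi>" if "(V, \<psi>) \<in> atlas bring_curve" for V \<psi>
    using that by (auto simp: bring_curve_eq projective_curve_def)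
  show "\<exists>V \<psi>. (V, \<psi>) \<in> atlas bring_curve \<and> p \<in> V \<and> inj_on quotient_proj V"
    if "p \<in> topspace (space_of bring_curve)" "quotient_proj p \<notin> special_points" for p
    using that bring_chart_off_special_points unfolding topspace_bring by blast
  fix p r assume "p \<in> topspace (space_of bring_curve)" "r \<in> topspace (space_of bring_curve)"
  then obtain x y where x: "x \<in> bring_cone" "p = proj_point x" and y: "y \<in> bring_cone" "r = proj_point y"
    unfolding topspace_bring by blast
  show "q p = q r \<longleftrightarrow> quotient_proj p = quotient_proj r"
  proof
    assume "q p = q r"
    then have "proj_point x = proj_point y \<or> proj_point x = proj_point (refl y)"
      using x y q by auto
    then show "quotient_proj p = quotient_proj r"
      using x y quotient_proj_refl by auto
  next
    assume "quotient_proj p = quotient_proj r"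
    then have "proj_point x = proj_point y \<or> proj_point x = proj_point (refl y)"
      using quotient_proj_fibre[OF y(1) x(1)] x y by simp
    then show "q p = q r"
    proof
      assume eq: "proj_point x = proj_point (refl y)"
      then obtain c where "c \<noteq> 0" "refl y = c *s x" by (auto simp: proj_point_eq_iff)
      then have "proj_point (refl x) = proj_point y"
        using refl_refl[of y] by (metis proj_point_eq_iff refl_scale)
      then show ?thesis
        unfolding x(2) y(2) q[OF x(1)] q[OF y(1)] using eq by (simp add: insert_commute)
    qed (use x y in simp)
  qed
qed

end

text \<open>A moved index yields one exchanged pair; if nothing else moved, the permutation would be
  a transposition and hence odd. After a second pair a single index is left, which must be
  fixed.\<close>

lemma even_involution_cases:
  fixes \<sigma> :: "5 \<Rightarrow> 5"
  assumes inv: "\<And>n. \<sigma> (\<sigma> n) = n" and "\<sigma> \<noteq> id" and ev: "evenperm \<sigma>"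
  obtains e i j k l where "double_transposition e i j k l"
    "\<sigma> e = e" "\<sigma> i = j" "\<sigma> j = i" "\<sigma> k = l" "\<sigma> l = k"
proof -
  obtain i where i: "\<sigma> i \<noteq> i" using \<open>\<sigma> \<noteq> id\<close> by (auto simp: fun_eq_iff)
  define j where "j = \<sigma> i"
  have ij: "\<sigma> i = j" "\<sigma> j = i" "i \<noteq> j" using i inv by (auto simp: j_def)
  obtain k where k: "k \<noteq> i" "k \<noteq> j" "\<sigma> k \<noteq> k"
  proof (rule ccontr)
    assume "\<not> thesis"
    then have "\<sigma> = Transposition.transpose i j" using that ij by (auto simp: fun_eq_iff Transposition.transpose_def)
    then show False using ev ij(3) by (simp add: evenperm_swap)
  qed
  define l where "l = \<sigma> k"
  have kl: "\<sigma> k = l" "\<sigma> l = k" "k \<noteq> l" "l \<noteq> i" "l \<noteq> j"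
    using k inv ij by (auto simp: l_def) metis+
  have "card {i, j, k, l} = 4" using ij k kl by auto
  then have "{i, j, k, l} \<noteq> UNIV" by (auto dest: arg_cong[of _ _ card])
  then obtain e where e: "e \<notin> {i, j, k, l}" by blast
  have d: "double_transposition e i j k l"
    using e ij k kl by unfold_locales auto
  have "\<sigma> e = e"
    using double_transposition.index_cases[OF d, of "\<sigma> e"] e ij kl inv by (metis insertCI)
  then show ?thesis using that d ij kl by blast
qed

theorem proposition7p1:
  fixes G :: "(5 \<Rightarrow> 5) set"
  assumes "subgroup G alternating_group"
    and "card G = 2"
  shows "biholomorphic (bring_quotient G)
    (genus2_model {(x, y). y\<^sup>2 = (4 * x ^ 3 + 8 * x\<^sup>2 + 7 * x + 1) * (x ^ 3 + 7 * x\<^sup>2 + 8 * x + 4)})"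
proof -
  have sub: "G \<subseteq> {\<sigma>. \<sigma> permutes UNIV \<and> evenperm \<sigma>}" and one: "id \<in> G"
    and mult: "\<And>\<sigma> \<tau>. \<sigma> \<in> G \<Longrightarrow> \<tau> \<in> G \<Longrightarrow> \<sigma> \<circ> \<tau> \<in> G"
    using assms(1) by (auto simp: subgroup_def alternating_group_def)
  obtain \<sigma> where \<sigma>: "G = {id, \<sigma>}" "\<sigma> \<noteq> id"
    using assms(2) one by (metis card_2_iff doubleton_eq_iff insert_iff singletonD)
  have perm: "\<sigma> permutes UNIV" and ev: "evenperm \<sigma>" using sub \<sigma> by auto
  \<comment> \<open>The square of \<open>\<sigma>\<close> lies in \<open>{id, \<sigma>}\<close>, so
    excluding \<open>\<sigma>\<close> by injectivity makes it an involution.\<close>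
  have "\<sigma> \<circ> \<sigma> \<noteq> \<sigma>"
  proof
    assume "\<sigma> \<circ> \<sigma> = \<sigma>"
    then have "\<sigma> (\<sigma> n) = \<sigma> n" for n by (metis comp_apply)
    then have "\<sigma> n = n" for n using permutes_inj[OF perm] by (metis injD)
    then show False using \<sigma>(2) by auto
  qed
  then have "\<sigma> \<circ> \<sigma> = id" using mult[of \<sigma> \<sigma>] \<sigma>(1) by auto
  then have inv: "\<sigma> (\<sigma> n) = n" for n by (metis comp_apply id_apply)
  then obtain e i j k l where d: "double_transposition e i j k l"
    and s: "\<sigma> e = e" "\<sigma> i = j" "\<sigma> j = i" "\<sigma> k = l" "\<sigma> l = k"
    using even_involution_cases[OF _ \<sigma>(2) ev] by metis
  interpret double_transposition e i j k l by (rule d)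
  \<comment> \<open>Since \<open>\<sigma>\<close> is its own inverse, the inverse in
    \<open>permute_coords\<close> disappears and the action on vectors is
    \<open>refl\<close>.\<close>
  have "Hilbert_Choice.inv \<sigma> = \<sigma>" by (rule inv_unique_comp) (simp_all add: fun_eq_iff inv)
  moreover have "(\<chi> n. x $ \<sigma> n) = refl x" for x
    by (rule vec_eqI) (simp_all add: s)
  ultimately have ps: "permute_coords \<sigma> p = refl ` p" for p
    by (simp add: permute_coords_def)
  have "refl ` proj_point x = proj_point (refl x)" for x
    unfolding proj_point_def by (auto simp: refl_scale image_iff) (metis refl_scale)
  with ps have ps': "permute_coords \<sigma> (proj_point x) = proj_point (refl x)" for x by simp
  have pi: "permute_coords id p = p" for p :: "(complex ^ 5) set"
    by (simp add: permute_coords_def)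
  have "orbit (alternating_group\<lparr>carrier := G\<rparr>) permute_coords (proj_point x) = {proj_point x, proj_point (refl x)}" for x
  proof -
    have "orbit (alternating_group\<lparr>carrier := G\<rparr>) permute_coords (proj_point x)
        = (\<lambda>g. permute_coords g (proj_point x)) ` {id, \<sigma>}"
      by (auto simp: orbit_def \<sigma>(1))
    then show ?thesis by (simp add: ps' pi)
  qed
  then have "biholomorphic (bring_quotient G) (projective_curve (proj_point ` genus2_cone))"
    unfolding bring_quotient_def by (intro biholomorphic_bring_quotient)
  moreover have "genus2_model {(x, y). y\<^sup>2 = (4 * x ^ 3 + 8 * x\<^sup>2 + 7 * x + 1) * (x ^ 3 + 7 * x\<^sup>2 + 8 * x + 4)}
      = projective_curve (proj_point ` genus2_cone)"
    unfolding genus2_model_def genus2_affine_closure[symmetric] genus2_affine_def sextic_def by simp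
  ultimately show ?thesis by simp
qed

end
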